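(* The translation $(-)^{\mathcal N}$ (defined in the context) is an interpretation of $\mathbf{emTT}^c$ into $\mathbf{emTT}$, in the sense that it preserves derivability of judgements between the two theories: 1. if $\mathbf{emTT}^c\vdash\Gamma\ ctx$, then $\mathbf{emTT}\vdash\Gamma^{\mathcal N}\ ctx$; 2. if $\mathbf{emTT}^c\vdash A\ type\ [\Gamma]$, then $\mathbf{emTT}\vdash A^{\mathcal N}\ type\ [\Gamma^{\mathcal N}]$; 3. if $\mathbf{emTT}^c\vdash a\in A\ [\Gamma]$, then $\mathbf{emTT}\vdash a^{\mathcal N}\in A^{\mathcal N}\ [\Gamma^{\mathcal N}]$; 4. if $\mathbf{emTT}^c\vdash A=B\ type\ [\Gamma]$, then $\mathbf{emTT}\vdash A^{\mathcal N}=B^{\mathcal N}\ type\ [\Gamma^{\mathcal N}]$; 5. if $\mathbf{emTT}^c\vdash a=b\in A\ [\Gamma]$, then $\mathbf{emTT}\vdash a^{\mathcal N}=b^{\mathcal N}\in A^{\mathcal N}\ [\Gamma^{\mathcal N}]$. (In 2 and 4, $type$ is any of the kinds $prop_s, prop, set, col$, the same one in hypothesis and conclusion.) Moreover, the translation produces stable propositions and, in particular, collections with stable equality: 6. if $\mathbf{emTT}^c\vdash\varphi\ prop\ [\Gamma]$, then $\mathbf{emTT}\vdash\neg\neg\varphi^{\mathcal N}\Rightarrow\varphi^{\mathcal N}$ true $[\Gamma^{\mathcal N}]$; 7. if $\mathbf{emTT}^c\vdash A\ col\ [\Gamma]$, then $\mathbf{emTT}\vdash\neg\neg\mathsf{Eq}(A^{\mathcal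 N},x,y)\Rightarrow\mathsf{Eq}(A^{\mathcal N},x,y)$ true $[\Gamma^{\mathcal N},x\in A^{\mathcal N},y\in A^{\mathcal N}]$.
   Context: "$\varphi$ true $[\Gamma]$" means $\mathsf{true}\in\varphi\ [\Gamma]$. $\mathbf{emTT}^c$ is $\mathbf{emTT}$ extended with the rule $\mathsf{LEM}$: from $\varphi\ prop\ [\Gamma]$ infer $\varphi\vee\neg\varphi$ true $[\Gamma]$. A proposition $\varphi$ of $\mathbf{emTT}$ is stable if $\neg\neg\varphi\Rightarrow\varphi$ true is derivable; a collection $A$ has stable equality if the proposition $\mathsf{Eq}(A,x,y)\ [x,y\in A]$ is stable in $\mathbf{emTT}$. THE THEORY $\mathbf{emTT}$ (the extensional level of the Minimalist Foundation). Judgements: $\Gamma\ ctx$, $A\ type\ [\Gamma]$, $A=B\ type\ [\Gamma]$, $a\in A\ [\Gamma]$, $a=b\in A\ [\Gamma]$, where $type$ is one of the kinds $prop_s$ (small propositions), $prop$, $set$, $col$ (collections). Contexts are lists $x_1\in A_1,\dots,x_n\in A_n$, each $A_i$ a collection in the preceding context. The common context is left implicit below. Structural rules: variables, weakening, substitution; $=$ is an equivalence relation on types and on terms; conversion; every type and term constructor (including binders) is a congruence for $=$; inclusions $prop_s\subseteq prop$, $prop_s\subseteq set$, $prop\subseteq col$, $set\subseteq col$. Formation. Propositions: $\bot$ is small; $\varphi\wedge\psi,\varphi\vee\psi,\varphi\Rightarrow\psi$ are propositions, small if $\varphi,\psi$ are; $(\exists x\in A)\varphi$, $(\forall x\in A)\varphi$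 for $A\ col$, $\varphi\ prop\ [x\in A]$, small if $A\ set$ and $\varphi\ prop_s$; $\mathsf{Eq}(A,a,b)$ (written $a=_A b$) for $A\ col$, $a,b\in A$, small if $A\ set$. Sets: $\mathsf N_0$, $\mathsf N_1$; $\mathsf{List}(A)$, $A+B$ for sets $A,B$; $(\Sigma x\in A)B$, $(\Pi x\in A)B$ for $A\ set$, $B\ set\ [x\in A]$; $A/R$ for $A\ set$ and $R(x,y)\ prop_s\ [x,y\in A]$ derivably an equivalence relation. Collections: $\mathcal P(1)$; $A\to\mathcal P(1)$ (the non-dependent product) for $A\ set$; $(\Sigma x\in A)B$ for $A\ col$, $B\ col\ [x\in A]$. Terms. Propositions are proof-irrelevant: if $\varphi\ prop$ and $p\in\varphi$ then $\mathsf{true}\in\varphi$; if $p,q\in\varphi$ then $p=q\in\varphi$. The usual intuitionistic natural deduction rules hold for the connectives and quantifiers, with all proof-terms $\mathsf{true}$ and hypotheses given by context variables; eliminations are only towards propositions (not depending on the eliminated proof). $a\in A$ gives $\mathsf{true}\in\mathsf{Eq}(A,a,a)$; reflection: $\mathsf{true}\in\mathsf{Eq}(A,a,b)$ gives $a=b\in A$. $\mathsf N_0$ (no constructor), $\mathsf N_1$ (constructor $\star$), $\mathsf{List}(A)$ ($\epsilon$, $\mathsf{cons}(l,a)$), $A+B$ ($\mathsf{inl},\mathsf{inr}$), $(\Sigma x\in A)B$ ($\langle a,b\rangle$) have the usual dependent eliminators $\mathsf{El}$ towards arbitrary dependent collections, with $\beta$-equalities. Products $(\Pi x\in A)B$ and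 $A\to\mathcal P(1)$ have $\lambda$, $\mathsf{Ap}$ (also written $f(a)$), $\beta$ and $\eta$. Quotients: $a\in A$ gives $[a]\in A/R$; $R(a,b)$ true gives $[a]=[b]\in A/R$; conversely $[a]=[b]\in A/R$ gives $R(a,b)$ true; eliminator $\mathsf{El_Q}(p,(x).l)\in L(p)$ for $L(z)\ col\ [z\in A/R]$, $p\in A/R$, $l(x)\in L([x])\ [x\in A]$ with $l(x)=l(y)\in L([x])\ [x,y\in A, w\in R(x,y)]$, with $\beta$. $\mathcal P(1)$: $\varphi\ prop_s$ gives $[\varphi]\in\mathcal P(1)$; for small $\varphi,\psi$, $[\varphi]=[\psi]\in\mathcal P(1)$ is derivable from $\varphi\Leftrightarrow\psi$ true, and conversely; for $U\in\mathcal P(1)$, $U=[\mathsf{Eq}(\mathcal P(1),U,[\top])]\in\mathcal P(1)$. Here $\neg\varphi:\equiv\varphi\Rightarrow\bot$, $\top:\equiv\neg\bot$, $\varphi\Leftrightarrow\psi:\equiv(\varphi\Rightarrow\psi)\wedge(\psi\Rightarrow\varphi)$. The decoding of $U\in\mathcal P(1)$ is $\mathsf{Dc}(U):\equiv\mathsf{Eq}(\mathcal P(1),U,[\top])$. THE TRANSLATION $(-)^{\mathcal N}$, defined by simultaneous recursion on raw contexts, types, propositions and terms (raw syntax is fully type-annotated): - $x^{\mathcal N}:\equiv x$; $()^{\mathcal N}:\equiv()$; $(\Gamma,x\in A)^{\mathcal N}:\equiv\Gamma^{\mathcal N},x\in A^{\mathcal N}$. - $\bot^{\mathcal N}:\equiv\bot$;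 $(\varphi\wedge\psi)^{\mathcal N}:\equiv\varphi^{\mathcal N}\wedge\psi^{\mathcal N}$; $(\varphi\Rightarrow\psi)^{\mathcal N}:\equiv\varphi^{\mathcal N}\Rightarrow\psi^{\mathcal N}$; $(\varphi\vee\psi)^{\mathcal N}:\equiv\neg\neg(\varphi^{\mathcal N}\vee\psi^{\mathcal N})$; $((\exists x\in A)\varphi)^{\mathcal N}:\equiv\neg\neg(\exists x\in A^{\mathcal N})\varphi^{\mathcal N}$; $((\forall x\in A)\varphi)^{\mathcal N}:\equiv(\forall x\in A^{\mathcal N})\varphi^{\mathcal N}$; $\mathsf{Eq}(A,a,b)^{\mathcal N}:\equiv\mathsf{Eq}(A^{\mathcal N},a^{\mathcal N},b^{\mathcal N})$; $\mathsf{true}^{\mathcal N}:\equiv\mathsf{true}$. - On $\mathsf N_0$, $\mathsf N_1$, lists, disjoint sums, dependent sums, dependent products and quotients, and on their term constructors and eliminators, the translation is applied recursively to all subexpressions, leaving the constructor unchanged, e.g. $\mathsf N_0^{\mathcal N}:\equiv\mathsf N_0$, $\mathsf{El}_{\mathsf N_0}(c)^{\mathcal N}:\equiv\mathsf{El}_{\mathsf N_0}(c^{\mathcal N})$, $((\Sigma x\in A)B)^{\mathcal N}:\equiv(\Sigma x\in A^{\mathcal N})B^{\mathcal N}$, $\langle a,b\rangle^{\mathcal N}:\equiv\langle a^{\mathcal N},b^{\mathcal N}\rangle$, $\mathsf{El}_\Sigma(d,(x,y).m)^{\mathcal N}:\equiv\mathsf{El}_\Sigma(d^{\mathcal N},(x,y).m^{\mathcal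 N})$, and likewise $((\Pi x\in A)B)^{\mathcal N}:\equiv(\Pi x\in A^{\mathcal N})B^{\mathcal N}$, $((\lambda x\in A)b)^{\mathcal N}:\equiv(\lambda x\in A^{\mathcal N})b^{\mathcal N}$, $\mathsf{Ap}(f,a)^{\mathcal N}:\equiv\mathsf{Ap}(f^{\mathcal N},a^{\mathcal N})$. The function collections $A\to\mathcal P(1)$, being non-dependent products, follow this same pattern: $(A\to\mathcal P(1))^{\mathcal N}:\equiv A^{\mathcal N}\to\mathcal P(1)^{\mathcal N}$. - $\mathcal P(1)^{\mathcal N}:\equiv(\Sigma x\in\mathcal P(1))(\neg\neg\mathsf{Dc}(x)\Rightarrow\mathsf{Dc}(x))$; $[\varphi]^{\mathcal N}:\equiv\langle[\varphi^{\mathcal N}],\mathsf{true}\rangle$.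
   Formalization: (A→P(1))^N is taken as (Σf∈A^N→P(1))(∀x∈A^N)(¬¬Dc(f(x))⇒Dc(f(x))), with matching λ and Ap; Eq(P(1),a,b)^N as Eq(P(1),π1 a^N,π1 b^N); and Eq(P(1),U,V) with V=[⊤] is a small proposition by rule. As written, N1→P(1) and [Dc(U)] have ill-formed translations. *)

theory Defs
  imports Main
begin

section \<open>Raw syntax\<close>

text \<open>
  De Bruijn syntax. Binding: the last argument of \<open>Exi\<close>, \<open>Uni\<close>, \<open>Sig\<close>, \<open>Pi\<close> binds one variable,
  the relation of \<open>Quot\<close> binds two (\<open>x\<close> is index 1, \<open>y\<close> is index 0). Every term former carries the
  types of its constituents; an eliminator carries its motive \<open>L\<close>, which binds one variable.
  \<open>FunP1 A\<close> is the function collection \<open>A \<rightarrow> P(1)\<close>, with its own abstraction \<open>LamP1\<close> and application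
  \<open>ApP1\<close>; \<open>Code \<phi>\<close> is \<open>[\<phi>] \<in> P(1)\<close> and \<open>Cls A R a\<close> is \<open>[a] \<in> A/R\<close>.
\<close>

datatype ty =
    Falsum
  | Conj ty ty
  | Disj ty ty
  | Impl ty ty
  | Exi ty ty
  | Uni ty ty
  | Eq ty tm tm
  | N0
  | N1
  | List ty
  | Sum ty ty
  | Sig ty ty
  | Pi ty ty
  | Quot ty ty
  | P1
  | FunP1 ty
and tm =
    Var nat
  | true
  | ElN0 ty tm                      \<comment> \<open>\<open>ElN0 L c\<close>\<close>
  | Star
  | ElN1 ty tm tm                   \<comment> \<open>\<open>ElN1 L c a\<close>\<close>
  | Nil ty
  | Cons ty tm tm                   \<comment> \<open>\<open>Cons A l a\<close>\<close>
  | ElList ty ty tm tm tm           \<comment> \<open>\<open>ElList A L c a m\<close>, \<open>m\<close> binds \<open>x \<in> List A, y \<in> A, z \<in> L(x)\<close>\<close>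
  | Inl ty ty tm
  | Inr ty ty tm
  | ElSum ty ty ty tm tm tm         \<comment> \<open>\<open>ElSum A B L c m n\<close>, \<open>m\<close> and \<open>n\<close> bind one variable each\<close>
  | Pair ty ty tm tm                \<comment> \<open>\<open>Pair A B a b\<close>, \<open>B\<close> binds one variable\<close>
  | ElSig ty ty ty tm tm            \<comment> \<open>\<open>ElSig A B L d m\<close>, \<open>B\<close> binds one variable, \<open>m\<close> binds \<open>x \<in> A, y \<in> B\<close>\<close>
  | Lam ty ty tm                    \<comment> \<open>\<open>Lam A B b\<close>, \<open>B\<close> and \<open>b\<close> bind one variable each\<close>
  | Ap ty ty tm tm                  \<comment> \<open>\<open>Ap A B f a\<close>, \<open>B\<close> binds one variable\<close>
  | Cls ty ty tm
  | ElQ ty ty ty tm tm              \<comment> \<open>\<open>ElQ A R L p m\<close>, \<open>m\<close> binds one variable\<close>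
  | Code ty
  | LamP1 ty tm                     \<comment> \<open>\<open>LamP1 A b\<close>, \<open>b\<close> binds one variable\<close>
  | ApP1 ty tm tm                   \<comment> \<open>\<open>ApP1 A f a\<close>\<close>

definition upr :: "(nat \<Rightarrow> nat) \<Rightarrow> nat \<Rightarrow> nat" where
  "upr r = (\<lambda>n. case n of 0 \<Rightarrow> 0 | Suc m \<Rightarrow> Suc (r m))"

primrec ren_ty :: "(nat \<Rightarrow> nat) \<Rightarrow> ty \<Rightarrow> ty" and ren_tm :: "(nat \<Rightarrow> nat) \<Rightarrow> tm \<Rightarrow> tm" where
  "ren_ty r Falsum = Falsum"
| "ren_ty r (Conj \<phi> \<psi>) = Conj (ren_ty r \<phi>) (ren_ty r \<psi>)"
| "ren_ty r (Disj \<phi> \<psi>) = Disj (ren_ty r \<phi>) (ren_ty r \<psi>)"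
| "ren_ty r (Impl \<phi> \<psi>) = Impl (ren_ty r \<phi>) (ren_ty r \<psi>)"
| "ren_ty r (Exi A \<phi>) = Exi (ren_ty r A) (ren_ty (upr r) \<phi>)"
| "ren_ty r (Uni A \<phi>) = Uni (ren_ty r A) (ren_ty (upr r) \<phi>)"
| "ren_ty r (Eq A a b) = Eq (ren_ty r A) (ren_tm r a) (ren_tm r b)"
| "ren_ty r N0 = N0"
| "ren_ty r N1 = N1"
| "ren_ty r (List A) = List (ren_ty r A)"
| "ren_ty r (Sum A B) = Sum (ren_ty r A) (ren_ty r B)"
| "ren_ty r (Sig A B) = Sig (ren_ty r A) (ren_ty (upr r) B)"
| "ren_ty r (Pi A B) = Pi (ren_ty r A) (ren_ty (upr r) B)"
| "ren_ty r (Quot A R) = Quot (ren_ty r A) (ren_ty (upr (upr r)) R)"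
| "ren_ty r P1 = P1"
| "ren_ty r (FunP1 A) = FunP1 (ren_ty r A)"
| "ren_tm r (Var n) = Var (r n)"
| "ren_tm r true = true"
| "ren_tm r (ElN0 L c) = ElN0 (ren_ty (upr r) L) (ren_tm r c)"
| "ren_tm r Star = Star"
| "ren_tm r (ElN1 L c a) = ElN1 (ren_ty (upr r) L) (ren_tm r c) (ren_tm r a)"
| "ren_tm r (Nil A) = Nil (ren_ty r A)"
| "ren_tm r (Cons A l a) = Cons (ren_ty r A) (ren_tm r l) (ren_tm r a)"
| "ren_tm r (ElList A L c a m) = ElList (ren_ty r A) (ren_ty (upr r) L) (ren_tm r c) (ren_tm r a) (ren_tm (upr (upr (upr r))) m)"
| "ren_tm r (Inl A B a) = Inl (ren_ty r A) (ren_ty r B) (ren_tm r a)"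
| "ren_tm r (Inr A B b) = Inr (ren_ty r A) (ren_ty r B) (ren_tm r b)"
| "ren_tm r (ElSum A B L c m n) = ElSum (ren_ty r A) (ren_ty r B) (ren_ty (upr r) L) (ren_tm r c) (ren_tm (upr r) m) (ren_tm (upr r) n)"
| "ren_tm r (Pair A B a b) = Pair (ren_ty r A) (ren_ty (upr r) B) (ren_tm r a) (ren_tm r b)"
| "ren_tm r (ElSig A B L d m) = ElSig (ren_ty r A) (ren_ty (upr r) B) (ren_ty (upr r) L) (ren_tm r d) (ren_tm (upr (upr r)) m)"
| "ren_tm r (Lam A B b) = Lam (ren_ty r A) (ren_ty (upr r) B) (ren_tm (upr r) b)"
| "ren_tm r (Ap A B f a) = Ap (ren_ty r A) (ren_ty (upr r) B) (ren_tm r f) (ren_tm r a)"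
| "ren_tm r (Cls A R a) = Cls (ren_ty r A) (ren_ty (upr (upr r)) R) (ren_tm r a)"
| "ren_tm r (ElQ A R L p m) = ElQ (ren_ty r A) (ren_ty (upr (upr r)) R) (ren_ty (upr r) L) (ren_tm r p) (ren_tm (upr r) m)"
| "ren_tm r (Code \<phi>) = Code (ren_ty r \<phi>)"
| "ren_tm r (LamP1 A b) = LamP1 (ren_ty r A) (ren_tm (upr r) b)"
| "ren_tm r (ApP1 A f a) = ApP1 (ren_ty r A) (ren_tm r f) (ren_tm r a)"

definition scons :: "tm \<Rightarrow> (nat \<Rightarrow> tm) \<Rightarrow> nat \<Rightarrow> tm" (infixr "\<cdot>" 80) where
  "a \<cdot> \<sigma> = (\<lambda>n. case n of 0 \<Rightarrow> a | Suc m \<Rightarrow> \<sigma> m)"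

definition wk :: "nat \<Rightarrow> nat \<Rightarrow> tm" where
  "wk k = (\<lambda>n. Var (n + k))"

definition up :: "(nat \<Rightarrow> tm) \<Rightarrow> nat \<Rightarrow> tm" where
  "up \<sigma> = Var 0 \<cdot> (\<lambda>n. ren_tm Suc (\<sigma> n))"

text \<open>
  Simultaneous substitution, \<open>A \<bullet> \<sigma>\<close> on types and \<open>a \<star> \<sigma>\<close> on terms. In particular \<open>A \<bullet> wk k\<close> weakens
  \<open>A\<close> by \<open>k\<close> variables, \<open>B \<bullet> (a \<cdot> Var)\<close> is \<open>B(a)\<close>, and \<open>B \<bullet> (a \<cdot> wk k)\<close> is \<open>B(a)\<close> in a context
  extended by \<open>k\<close> variables.
\<close>

primrec sub_ty :: "ty \<Rightarrow> (nat \<Rightarrow> tm) \<Rightarrow> ty" (infixl "\<bullet>" 75)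
  and sub_tm :: "tm \<Rightarrow> (nat \<Rightarrow> tm) \<Rightarrow> tm" (infixl "\<star>" 75) where
  "Falsum \<bullet> \<sigma> = Falsum"
| "(Conj \<phi> \<psi>) \<bullet> \<sigma> = Conj (\<phi> \<bullet> \<sigma>) (\<psi> \<bullet> \<sigma>)"
| "(Disj \<phi> \<psi>) \<bullet> \<sigma> = Disj (\<phi> \<bullet> \<sigma>) (\<psi> \<bullet> \<sigma>)"
| "(Impl \<phi> \<psi>) \<bullet> \<sigma> = Impl (\<phi> \<bullet> \<sigma>) (\<psi> \<bullet> \<sigma>)"
| "(Exi A \<phi>) \<bullet> \<sigma> = Exi (A \<bullet> \<sigma>) (\<phi> \<bullet> (up \<sigma>))"
| "(Uni A \<phi>) \<bullet> \<sigma> = Uni (A \<bullet> \<sigma>) (\<phi> \<bullet> (up \<sigma>))"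
| "(Eq A a b) \<bullet> \<sigma> = Eq (A \<bullet> \<sigma>) (a \<star> \<sigma>) (b \<star> \<sigma>)"
| "N0 \<bullet> \<sigma> = N0"
| "N1 \<bullet> \<sigma> = N1"
| "(List A) \<bullet> \<sigma> = List (A \<bullet> \<sigma>)"
| "(Sum A B) \<bullet> \<sigma> = Sum (A \<bullet> \<sigma>) (B \<bullet> \<sigma>)"
| "(Sig A B) \<bullet> \<sigma> = Sig (A \<bullet> \<sigma>) (B \<bullet> (up \<sigma>))"
| "(Pi A B) \<bullet> \<sigma> = Pi (A \<bullet> \<sigma>) (B \<bullet> (up \<sigma>))"
| "(Quot A R) \<bullet> \<sigma> = Quot (A \<bullet> \<sigma>) (R \<bullet> (up (up \<sigma>)))"
| "P1 \<bullet> \<sigma> = P1"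
| "(FunP1 A) \<bullet> \<sigma> = FunP1 (A \<bullet> \<sigma>)"
| "Var n \<star> \<sigma> = \<sigma> n"
| "true \<star> \<sigma> = true"
| "(ElN0 L c) \<star> \<sigma> = ElN0 (L \<bullet> (up \<sigma>)) (c \<star> \<sigma>)"
| "Star \<star> \<sigma> = Star"
| "(ElN1 L c a) \<star> \<sigma> = ElN1 (L \<bullet> (up \<sigma>)) (c \<star> \<sigma>) (a \<star> \<sigma>)"
| "(Nil A) \<star> \<sigma> = Nil (A \<bullet> \<sigma>)"
| "(Cons A l a) \<star> \<sigma> = Cons (A \<bullet> \<sigma>) (l \<star> \<sigma>) (a \<star> \<sigma>)"
| "(ElList A L c a m) \<star> \<sigma> = ElList (A \<bullet> \<sigma>) (L \<bullet> (up \<sigma>)) (c \<star> \<sigma>) (a \<star> \<sigma>) (m \<star> (up (up (up \<sigma>))))"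
| "(Inl A B a) \<star> \<sigma> = Inl (A \<bullet> \<sigma>) (B \<bullet> \<sigma>) (a \<star> \<sigma>)"
| "(Inr A B b) \<star> \<sigma> = Inr (A \<bullet> \<sigma>) (B \<bullet> \<sigma>) (b \<star> \<sigma>)"
| "(ElSum A B L c m n) \<star> \<sigma> = ElSum (A \<bullet> \<sigma>) (B \<bullet> \<sigma>) (L \<bullet> (up \<sigma>)) (c \<star> \<sigma>) (m \<star> (up \<sigma>)) (n \<star> (up \<sigma>))"
| "(Pair A B a b) \<star> \<sigma> = Pair (A \<bullet> \<sigma>) (B \<bullet> (up \<sigma>)) (a \<star> \<sigma>) (b \<star> \<sigma>)"
| "(ElSig A B L d m) \<star> \<sigma> = ElSig (A \<bullet> \<sigma>) (B \<bullet> (up \<sigma>)) (L \<bullet> (up \<sigma>)) (d \<star> \<sigma>) (m \<star> (up (up \<sigma>)))"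
| "(Lam A B b) \<star> \<sigma> = Lam (A \<bullet> \<sigma>) (B \<bullet> (up \<sigma>)) (b \<star> (up \<sigma>))"
| "(Ap A B f a) \<star> \<sigma> = Ap (A \<bullet> \<sigma>) (B \<bullet> (up \<sigma>)) (f \<star> \<sigma>) (a \<star> \<sigma>)"
| "(Cls A R a) \<star> \<sigma> = Cls (A \<bullet> \<sigma>) (R \<bullet> (up (up \<sigma>))) (a \<star> \<sigma>)"
| "(ElQ A R L p m) \<star> \<sigma> = ElQ (A \<bullet> \<sigma>) (R \<bullet> (up (up \<sigma>))) (L \<bullet> (up \<sigma>)) (p \<star> \<sigma>) (m \<star> (up \<sigma>))"
| "(Code \<phi>) \<star> \<sigma> = Code (\<phi> \<bullet> \<sigma>)"
| "(LamP1 A b) \<star> \<sigma> = LamP1 (A \<bullet> \<sigma>) (b \<star> (up \<sigma>))"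
| "(ApP1 A f a) \<star> \<sigma> = ApP1 (A \<bullet> \<sigma>) (f \<star> \<sigma>) (a \<star> \<sigma>)"

definition Neg :: "ty \<Rightarrow> ty" where
  "Neg \<phi> = Impl \<phi> Falsum"

definition Top :: ty where
  "Top = Neg Falsum"

definition Iff :: "ty \<Rightarrow> ty \<Rightarrow> ty" where
  "Iff \<phi> \<psi> = Conj (Impl \<phi> \<psi>) (Impl \<psi> \<phi>)"

definition Dc :: "tm \<Rightarrow> ty" where
  "Dc U = Eq P1 U (Code Top)"

definition Stab :: "ty \<Rightarrow> ty" where
  "Stab \<phi> = Impl (Neg (Neg \<phi>)) \<phi>"


section \<open>The theories emTT and emTT with excluded middle\<close>

datatype kind = PropS | Prop | Set | Col

inductive incl :: "kind \<Rightarrow> kind \<Rightarrow> bool" where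
  "incl PropS Prop"
| "incl PropS Set"
| "incl Prop Col"
| "incl Set Col"

text \<open>
  \<open>prop_over K K'\<close>: quantifying a proposition of kind \<open>K\<close> over, or forming equality on, a type of
  kind \<open>K'\<close> gives a proposition of kind \<open>K\<close>.
\<close>

inductive prop_over :: "kind \<Rightarrow> kind \<Rightarrow> bool" where
  "prop_over PropS Set"
| "prop_over Prop Col"

datatype calculus = emTT | emTTc

abbreviation (input) rel :: "ty \<Rightarrow> nat \<Rightarrow> tm \<Rightarrow> tm \<Rightarrow> ty" where
  "rel R k a b \<equiv> R \<bullet> (b \<cdot> a \<cdot> wk k)"

text \<open>
  Contexts are lists with the most recent variable at the head. The rules \<open>sub_\<dots>\<close> are substitution
  along an arbitrary context morphism; weakening is the instance \<open>\<sigma> = wk 1\<close>. The two \<open>sub_eq\<close> rules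
  substitute equals for equals (take a reflexive equality for the plain rule on equality judgements).
  In the names, \<open>C_\<close> is congruence and \<open>B_\<close> is beta.

  The rule \<open>F_Dc\<close> says that \<open>Dc U\<close> is a small proposition. It is what gives sense to the rule
  \<open>U = [Dc U] \<in> P(1)\<close>, because \<open>[\<phi>]\<close> is formed for small \<open>\<phi>\<close> only and \<open>P(1)\<close> is not a set. It is
  stated up to judgemental equality of the second argument with \<open>[\<top>]\<close>.
\<close>

inductive
      ctx_ok :: "calculus \<Rightarrow> ty list \<Rightarrow> bool" ("_ \<turnstile> _ ctx" [51, 51] 50)
  and is_ty :: "calculus \<Rightarrow> ty list \<Rightarrow> ty \<Rightarrow> kind \<Rightarrow> bool" ("_ \<parallel> _ \<turnstile> _ type _" [51, 51, 51, 51] 50)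
  and is_tm :: "calculus \<Rightarrow> ty list \<Rightarrow> tm \<Rightarrow> ty \<Rightarrow> bool" ("_ \<parallel> _ \<turnstile> _ \<Colon> _" [51, 51, 51, 51] 50)
  and eq_ty :: "calculus \<Rightarrow> ty list \<Rightarrow> ty \<Rightarrow> ty \<Rightarrow> kind \<Rightarrow> bool"
        ("_ \<parallel> _ \<turnstile> _ \<doteq> _ type _" [51, 51, 51, 51, 51] 50)
  and eq_tm :: "calculus \<Rightarrow> ty list \<Rightarrow> tm \<Rightarrow> tm \<Rightarrow> ty \<Rightarrow> bool"
        ("_ \<parallel> _ \<turnstile> _ \<doteq> _ \<Colon> _" [51, 51, 51, 51, 51] 50)
  for T :: calculus
where
  ctx_empty: "T \<turnstile> [] ctx"
| ctx_ext: "T \<parallel> \<Gamma> \<turnstile> A type Col \<Longrightarrow> T \<turnstile> A # \<Gamma> ctx"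
| var: "\<lbrakk>T \<turnstile> \<Gamma> ctx; i < length \<Gamma>\<rbrakk> \<Longrightarrow> T \<parallel> \<Gamma> \<turnstile> Var i \<Colon> (\<Gamma> ! i) \<bullet> wk (Suc i)"
| sub_ty:
    "\<lbrakk>T \<parallel> \<Delta> \<turnstile> A type K; T \<turnstile> \<Gamma> ctx; \<forall>i<length \<Delta>. T \<parallel> \<Gamma> \<turnstile> \<sigma> i \<Colon> (\<Delta> ! i) \<bullet> wk (Suc i) \<bullet> \<sigma>\<rbrakk>
      \<Longrightarrow> T \<parallel> \<Gamma> \<turnstile> A \<bullet> \<sigma> type K"
| sub_tm:
    "\<lbrakk>T \<parallel> \<Delta> \<turnstile> a \<Colon> A; T \<turnstile> \<Gamma> ctx; \<forall>i<length \<Delta>. T \<parallel> \<Gamma> \<turnstile> \<sigma> i \<Colon> (\<Delta> ! i) \<bullet> wk (Suc i) \<bullet> \<sigma>\<rbrakk>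
      \<Longrightarrow> T \<parallel> \<Gamma> \<turnstile> a \<star> \<sigma> \<Colon> A \<bullet> \<sigma>"
| sub_eq_ty:
    "\<lbrakk>T \<parallel> \<Delta> \<turnstile> A \<doteq> B type K; T \<turnstile> \<Gamma> ctx; \<forall>i<length \<Delta>. T \<parallel> \<Gamma> \<turnstile> \<sigma> i \<Colon> (\<Delta> ! i) \<bullet> wk (Suc i) \<bullet> \<sigma>;
      \<forall>i<length \<Delta>. T \<parallel> \<Gamma> \<turnstile> \<tau> i \<Colon> (\<Delta> ! i) \<bullet> wk (Suc i) \<bullet> \<tau>;
      \<forall>i<length \<Delta>. T \<parallel> \<Gamma> \<turnstile> \<sigma> i \<doteq> \<tau> i \<Colon> (\<Delta> ! i) \<bullet> wk (Suc i) \<bullet> \<sigma>\<rbrakk>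
      \<Longrightarrow> T \<parallel> \<Gamma> \<turnstile> A \<bullet> \<sigma> \<doteq> B \<bullet> \<tau> type K"
| sub_eq_tm:
    "\<lbrakk>T \<parallel> \<Delta> \<turnstile> a \<doteq> b \<Colon> A; T \<turnstile> \<Gamma> ctx; \<forall>i<length \<Delta>. T \<parallel> \<Gamma> \<turnstile> \<sigma> i \<Colon> (\<Delta> ! i) \<bullet> wk (Suc i) \<bullet> \<sigma>;
      \<forall>i<length \<Delta>. T \<parallel> \<Gamma> \<turnstile> \<tau> i \<Colon> (\<Delta> ! i) \<bullet> wk (Suc i) \<bullet> \<tau>;
      \<forall>i<length \<Delta>. T \<parallel> \<Gamma> \<turnstile> \<sigma> i \<doteq> \<tau> i \<Colon> (\<Delta> ! i) \<bullet> wk (Suc i) \<bullet> \<sigma>\<rbrakk>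
      \<Longrightarrow> T \<parallel> \<Gamma> \<turnstile> a \<star> \<sigma> \<doteq> b \<star> \<tau> \<Colon> A \<bullet> \<sigma>"

| ty_refl: "T \<parallel> \<Gamma> \<turnstile> A type K \<Longrightarrow> T \<parallel> \<Gamma> \<turnstile> A \<doteq> A type K"
| ty_sym: "T \<parallel> \<Gamma> \<turnstile> A \<doteq> B type K \<Longrightarrow> T \<parallel> \<Gamma> \<turnstile> B \<doteq> A type K"
| ty_trans: "\<lbrakk>T \<parallel> \<Gamma> \<turnstile> A \<doteq> B type K; T \<parallel> \<Gamma> \<turnstile> B \<doteq> C type K\<rbrakk> \<Longrightarrow> T \<parallel> \<Gamma> \<turnstile> A \<doteq> C type K"
| tm_refl: "T \<parallel> \<Gamma> \<turnstile> a \<Colon> A \<Longrightarrow> T \<parallel> \<Gamma> \<turnstile> a \<doteq> a \<Colon> A"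
| tm_sym: "T \<parallel> \<Gamma> \<turnstile> a \<doteq> b \<Colon> A \<Longrightarrow> T \<parallel> \<Gamma> \<turnstile> b \<doteq> a \<Colon> A"
| tm_trans: "\<lbrakk>T \<parallel> \<Gamma> \<turnstile> a \<doteq> b \<Colon> A; T \<parallel> \<Gamma> \<turnstile> b \<doteq> c \<Colon> A\<rbrakk> \<Longrightarrow> T \<parallel> \<Gamma> \<turnstile> a \<doteq> c \<Colon> A"
| conv: "\<lbrakk>T \<parallel> \<Gamma> \<turnstile> a \<Colon> A; T \<parallel> \<Gamma> \<turnstile> A \<doteq> B type Col\<rbrakk> \<Longrightarrow> T \<parallel> \<Gamma> \<turnstile> a \<Colon> B"
| conv_eq: "\<lbrakk>T \<parallel> \<Gamma> \<turnstile> a \<doteq> b \<Colon> A; T \<parallel> \<Gamma> \<turnstile> A \<doteq> B type Col\<rbrakk> \<Longrightarrow> T \<parallel> \<Gamma> \<turnstile> a \<doteq> b \<Colon> B"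
| incl_ty: "\<lbrakk>T \<parallel> \<Gamma> \<turnstile> A type K; incl K K'\<rbrakk> \<Longrightarrow> T \<parallel> \<Gamma> \<turnstile> A type K'"
| incl_eq_ty: "\<lbrakk>T \<parallel> \<Gamma> \<turnstile> A \<doteq> B type K; incl K K'\<rbrakk> \<Longrightarrow> T \<parallel> \<Gamma> \<turnstile> A \<doteq> B type K'"

| F_Falsum: "T \<turnstile> \<Gamma> ctx \<Longrightarrow> T \<parallel> \<Gamma> \<turnstile> Falsum type PropS"
| F_Conj: "\<lbrakk>K \<in> {PropS, Prop}; T \<parallel> \<Gamma> \<turnstile> \<phi> type K; T \<parallel> \<Gamma> \<turnstile> \<psi> type K\<rbrakk> \<Longrightarrow> T \<parallel> \<Gamma> \<turnstile> Conj \<phi> \<psi> type K"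
| F_Disj: "\<lbrakk>K \<in> {PropS, Prop}; T \<parallel> \<Gamma> \<turnstile> \<phi> type K; T \<parallel> \<Gamma> \<turnstile> \<psi> type K\<rbrakk> \<Longrightarrow> T \<parallel> \<Gamma> \<turnstile> Disj \<phi> \<psi> type K"
| F_Impl: "\<lbrakk>K \<in> {PropS, Prop}; T \<parallel> \<Gamma> \<turnstile> \<phi> type K; T \<parallel> \<Gamma> \<turnstile> \<psi> type K\<rbrakk> \<Longrightarrow> T \<parallel> \<Gamma> \<turnstile> Impl \<phi> \<psi> type K"
| F_Exi: "\<lbrakk>prop_over K K'; T \<parallel> \<Gamma> \<turnstile> A type K'; T \<parallel> A # \<Gamma> \<turnstile> \<phi> type K\<rbrakk> \<Longrightarrow> T \<parallel> \<Gamma> \<turnstile> Exi A \<phi> type K"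
| F_Uni: "\<lbrakk>prop_over K K'; T \<parallel> \<Gamma> \<turnstile> A type K'; T \<parallel> A # \<Gamma> \<turnstile> \<phi> type K\<rbrakk> \<Longrightarrow> T \<parallel> \<Gamma> \<turnstile> Uni A \<phi> type K"
| F_Eq:
    "\<lbrakk>prop_over K K'; T \<parallel> \<Gamma> \<turnstile> A type K'; T \<parallel> \<Gamma> \<turnstile> a \<Colon> A; T \<parallel> \<Gamma> \<turnstile> b \<Colon> A\<rbrakk>
      \<Longrightarrow> T \<parallel> \<Gamma> \<turnstile> Eq A a b type K"
| F_Dc: "\<lbrakk>T \<parallel> \<Gamma> \<turnstile> U \<Colon> P1; T \<parallel> \<Gamma> \<turnstile> V \<doteq> Code Top \<Colon> P1\<rbrakk> \<Longrightarrow> T \<parallel> \<Gamma> \<turnstile> Eq P1 U V type PropS"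
| C_Conj:
    "\<lbrakk>K \<in> {PropS, Prop}; T \<parallel> \<Gamma> \<turnstile> \<phi> \<doteq> \<phi>' type K; T \<parallel> \<Gamma> \<turnstile> \<psi> \<doteq> \<psi>' type K\<rbrakk>
      \<Longrightarrow> T \<parallel> \<Gamma> \<turnstile> Conj \<phi> \<psi> \<doteq> Conj \<phi>' \<psi>' type K"
| C_Disj:
    "\<lbrakk>K \<in> {PropS, Prop}; T \<parallel> \<Gamma> \<turnstile> \<phi> \<doteq> \<phi>' type K; T \<parallel> \<Gamma> \<turnstile> \<psi> \<doteq> \<psi>' type K\<rbrakk>
      \<Longrightarrow> T \<parallel> \<Gamma> \<turnstile> Disj \<phi> \<psi> \<doteq> Disj \<phi>' \<psi>' type K"
| C_Impl:
    "\<lbrakk>K \<in> {PropS, Prop}; T \<parallel> \<Gamma> \<turnstile> \<phi> \<doteq> \<phi>' type K; T \<parallel> \<Gamma> \<turnstile> \<psi> \<doteq> \<psi>' type K\<rbrakk>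
      \<Longrightarrow> T \<parallel> \<Gamma> \<turnstile> Impl \<phi> \<psi> \<doteq> Impl \<phi>' \<psi>' type K"
| C_Exi:
    "\<lbrakk>prop_over K K'; T \<parallel> \<Gamma> \<turnstile> A \<doteq> A' type K'; T \<parallel> A # \<Gamma> \<turnstile> \<phi> \<doteq> \<phi>' type K\<rbrakk>
      \<Longrightarrow> T \<parallel> \<Gamma> \<turnstile> Exi A \<phi> \<doteq> Exi A' \<phi>' type K"
| C_Uni:
    "\<lbrakk>prop_over K K'; T \<parallel> \<Gamma> \<turnstile> A \<doteq> A' type K'; T \<parallel> A # \<Gamma> \<turnstile> \<phi> \<doteq> \<phi>' type K\<rbrakk>
      \<Longrightarrow> T \<parallel> \<Gamma> \<turnstile> Uni A \<phi> \<doteq> Uni A' \<phi>' type K"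
| C_Eq:
    "\<lbrakk>prop_over K K'; T \<parallel> \<Gamma> \<turnstile> A \<doteq> A' type K'; T \<parallel> \<Gamma> \<turnstile> a \<doteq> a' \<Colon> A; T \<parallel> \<Gamma> \<turnstile> b \<doteq> b' \<Colon> A\<rbrakk>
      \<Longrightarrow> T \<parallel> \<Gamma> \<turnstile> Eq A a b \<doteq> Eq A' a' b' type K"
| C_Dc:
    "\<lbrakk>T \<parallel> \<Gamma> \<turnstile> U \<doteq> U' \<Colon> P1; T \<parallel> \<Gamma> \<turnstile> V \<doteq> V' \<Colon> P1; T \<parallel> \<Gamma> \<turnstile> V \<doteq> Code Top \<Colon> P1\<rbrakk>
      \<Longrightarrow> T \<parallel> \<Gamma> \<turnstile> Eq P1 U V \<doteq> Eq P1 U' V' type PropS"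

| true_I: "\<lbrakk>T \<parallel> \<Gamma> \<turnstile> \<phi> type Prop; T \<parallel> \<Gamma> \<turnstile> p \<Colon> \<phi>\<rbrakk> \<Longrightarrow> T \<parallel> \<Gamma> \<turnstile> true \<Colon> \<phi>"
| proof_irr: "\<lbrakk>T \<parallel> \<Gamma> \<turnstile> \<phi> type Prop; T \<parallel> \<Gamma> \<turnstile> p \<Colon> \<phi>; T \<parallel> \<Gamma> \<turnstile> q \<Colon> \<phi>\<rbrakk> \<Longrightarrow> T \<parallel> \<Gamma> \<turnstile> p \<doteq> q \<Colon> \<phi>"
| E_Falsum: "\<lbrakk>T \<parallel> \<Gamma> \<turnstile> true \<Colon> Falsum; T \<parallel> \<Gamma> \<turnstile> \<phi> type Prop\<rbrakk> \<Longrightarrow> T \<parallel> \<Gamma> \<turnstile> true \<Colon> \<phi>"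
| I_Conj:
    "\<lbrakk>T \<parallel> \<Gamma> \<turnstile> \<phi> type Prop; T \<parallel> \<Gamma> \<turnstile> \<psi> type Prop; T \<parallel> \<Gamma> \<turnstile> true \<Colon> \<phi>; T \<parallel> \<Gamma> \<turnstile> true \<Colon> \<psi>\<rbrakk>
      \<Longrightarrow> T \<parallel> \<Gamma> \<turnstile> true \<Colon> Conj \<phi> \<psi>"
| E1_Conj:
    "\<lbrakk>T \<parallel> \<Gamma> \<turnstile> \<phi> type Prop; T \<parallel> \<Gamma> \<turnstile> \<psi> type Prop; T \<parallel> \<Gamma> \<turnstile> true \<Colon> Conj \<phi> \<psi>\<rbrakk>
      \<Longrightarrow> T \<parallel> \<Gamma> \<turnstile> true \<Colon> \<phi>"
| E2_Conj:
    "\<lbrakk>T \<parallel> \<Gamma> \<turnstile> \<phi> type Prop; T \<parallel> \<Gamma> \<turnstile> \<psi> type Prop; T \<parallel> \<Gamma> \<turnstile> true \<Colon> Conj \<phi> \<psi>\<rbrakk>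
      \<Longrightarrow> T \<parallel> \<Gamma> \<turnstile> true \<Colon> \<psi>"
| I1_Disj:
    "\<lbrakk>T \<parallel> \<Gamma> \<turnstile> \<phi> type Prop; T \<parallel> \<Gamma> \<turnstile> \<psi> type Prop; T \<parallel> \<Gamma> \<turnstile> true \<Colon> \<phi>\<rbrakk>
      \<Longrightarrow> T \<parallel> \<Gamma> \<turnstile> true \<Colon> Disj \<phi> \<psi>"
| I2_Disj:
    "\<lbrakk>T \<parallel> \<Gamma> \<turnstile> \<phi> type Prop; T \<parallel> \<Gamma> \<turnstile> \<psi> type Prop; T \<parallel> \<Gamma> \<turnstile> true \<Colon> \<psi>\<rbrakk>
      \<Longrightarrow> T \<parallel> \<Gamma> \<turnstile> true \<Colon> Disj \<phi> \<psi>"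
| E_Disj:
    "\<lbrakk>T \<parallel> \<Gamma> \<turnstile> \<phi> type Prop; T \<parallel> \<Gamma> \<turnstile> \<psi> type Prop; T \<parallel> \<Gamma> \<turnstile> \<chi> type Prop; T \<parallel> \<Gamma> \<turnstile> true \<Colon> Disj \<phi> \<psi>;
      T \<parallel> \<phi> # \<Gamma> \<turnstile> true \<Colon> \<chi> \<bullet> wk 1; T \<parallel> \<psi> # \<Gamma> \<turnstile> true \<Colon> \<chi> \<bullet> wk 1\<rbrakk>
      \<Longrightarrow> T \<parallel> \<Gamma> \<turnstile> true \<Colon> \<chi>"
| I_Impl:
    "\<lbrakk>T \<parallel> \<Gamma> \<turnstile> \<phi> type Prop; T \<parallel> \<Gamma> \<turnstile> \<psi> type Prop; T \<parallel> \<phi> # \<Gamma> \<turnstile> true \<Colon> \<psi> \<bullet> wk 1\<rbrakk>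
      \<Longrightarrow> T \<parallel> \<Gamma> \<turnstile> true \<Colon> Impl \<phi> \<psi>"
| E_Impl:
    "\<lbrakk>T \<parallel> \<Gamma> \<turnstile> \<phi> type Prop; T \<parallel> \<Gamma> \<turnstile> \<psi> type Prop; T \<parallel> \<Gamma> \<turnstile> true \<Colon> Impl \<phi> \<psi>; T \<parallel> \<Gamma> \<turnstile> true \<Colon> \<phi>\<rbrakk>
      \<Longrightarrow> T \<parallel> \<Gamma> \<turnstile> true \<Colon> \<psi>"
| I_Exi:
    "\<lbrakk>T \<parallel> \<Gamma> \<turnstile> A type Col; T \<parallel> A # \<Gamma> \<turnstile> \<phi> type Prop; T \<parallel> \<Gamma> \<turnstile> a \<Colon> A; T \<parallel> \<Gamma> \<turnstile> true \<Colon> \<phi> \<bullet> (a \<cdot> Var)\<rbrakk>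
      \<Longrightarrow> T \<parallel> \<Gamma> \<turnstile> true \<Colon> Exi A \<phi>"
| E_Exi:
    "\<lbrakk>T \<parallel> \<Gamma> \<turnstile> A type Col; T \<parallel> A # \<Gamma> \<turnstile> \<phi> type Prop; T \<parallel> \<Gamma> \<turnstile> \<chi> type Prop; T \<parallel> \<Gamma> \<turnstile> true \<Colon> Exi A \<phi>;
      T \<parallel> \<phi> # A # \<Gamma> \<turnstile> true \<Colon> \<chi> \<bullet> wk 2\<rbrakk>
      \<Longrightarrow> T \<parallel> \<Gamma> \<turnstile> true \<Colon> \<chi>"
| I_Uni:
    "\<lbrakk>T \<parallel> \<Gamma> \<turnstile> A type Col; T \<parallel> A # \<Gamma> \<turnstile> \<phi> type Prop; T \<parallel> A # \<Gamma> \<turnstile> true \<Colon> \<phi>\<rbrakk>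
      \<Longrightarrow> T \<parallel> \<Gamma> \<turnstile> true \<Colon> Uni A \<phi>"
| E_Uni:
    "\<lbrakk>T \<parallel> \<Gamma> \<turnstile> A type Col; T \<parallel> A # \<Gamma> \<turnstile> \<phi> type Prop; T \<parallel> \<Gamma> \<turnstile> true \<Colon> Uni A \<phi>; T \<parallel> \<Gamma> \<turnstile> a \<Colon> A\<rbrakk>
      \<Longrightarrow> T \<parallel> \<Gamma> \<turnstile> true \<Colon> \<phi> \<bullet> (a \<cdot> Var)"
| I_Eq: "\<lbrakk>T \<parallel> \<Gamma> \<turnstile> A type Col; T \<parallel> \<Gamma> \<turnstile> a \<Colon> A\<rbrakk> \<Longrightarrow> T \<parallel> \<Gamma> \<turnstile> true \<Colon> Eq A a a"
| E_Eq:
    "\<lbrakk>T \<parallel> \<Gamma> \<turnstile> A type Col; T \<parallel> \<Gamma> \<turnstile> a \<Colon> A; T \<parallel> \<Gamma> \<turnstile> b \<Colon> A; T \<parallel> \<Gamma> \<turnstile> true \<Colon> Eq A a b\<rbrakk>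
      \<Longrightarrow> T \<parallel> \<Gamma> \<turnstile> a \<doteq> b \<Colon> A"
| LEM: "\<lbrakk>T = emTTc; T \<parallel> \<Gamma> \<turnstile> \<phi> type Prop\<rbrakk> \<Longrightarrow> T \<parallel> \<Gamma> \<turnstile> true \<Colon> Disj \<phi> (Neg \<phi>)"

| F_N0: "T \<turnstile> \<Gamma> ctx \<Longrightarrow> T \<parallel> \<Gamma> \<turnstile> N0 type Set"
| E_N0: "\<lbrakk>T \<parallel> N0 # \<Gamma> \<turnstile> L type Col; T \<parallel> \<Gamma> \<turnstile> c \<Colon> N0\<rbrakk> \<Longrightarrow> T \<parallel> \<Gamma> \<turnstile> ElN0 L c \<Colon> L \<bullet> (c \<cdot> Var)"
| C_ElN0:
    "\<lbrakk>T \<parallel> N0 # \<Gamma> \<turnstile> L \<doteq> L' type Col; T \<parallel> \<Gamma> \<turnstile> c \<doteq> c' \<Colon> N0\<rbrakk>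
      \<Longrightarrow> T \<parallel> \<Gamma> \<turnstile> ElN0 L c \<doteq> ElN0 L' c' \<Colon> L \<bullet> (c \<cdot> Var)"

| F_N1: "T \<turnstile> \<Gamma> ctx \<Longrightarrow> T \<parallel> \<Gamma> \<turnstile> N1 type Set"
| I_N1: "T \<turnstile> \<Gamma> ctx \<Longrightarrow> T \<parallel> \<Gamma> \<turnstile> Star \<Colon> N1"
| E_N1:
    "\<lbrakk>T \<parallel> N1 # \<Gamma> \<turnstile> L type Col; T \<parallel> \<Gamma> \<turnstile> c \<Colon> N1; T \<parallel> \<Gamma> \<turnstile> a \<Colon> L \<bullet> (Star \<cdot> Var)\<rbrakk>
      \<Longrightarrow> T \<parallel> \<Gamma> \<turnstile> ElN1 L c a \<Colon> L \<bullet> (c \<cdot> Var)"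
| B_N1:
    "\<lbrakk>T \<parallel> N1 # \<Gamma> \<turnstile> L type Col; T \<parallel> \<Gamma> \<turnstile> a \<Colon> L \<bullet> (Star \<cdot> Var)\<rbrakk>
      \<Longrightarrow> T \<parallel> \<Gamma> \<turnstile> ElN1 L Star a \<doteq> a \<Colon> L \<bullet> (Star \<cdot> Var)"
| C_ElN1:
    "\<lbrakk>T \<parallel> N1 # \<Gamma> \<turnstile> L \<doteq> L' type Col; T \<parallel> \<Gamma> \<turnstile> c \<doteq> c' \<Colon> N1; T \<parallel> \<Gamma> \<turnstile> a \<doteq> a' \<Colon> L \<bullet> (Star \<cdot> Var)\<rbrakk>
      \<Longrightarrow> T \<parallel> \<Gamma> \<turnstile> ElN1 L c a \<doteq> ElN1 L' c' a' \<Colon> L \<bullet> (c \<cdot> Var)"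

| F_List: "T \<parallel> \<Gamma> \<turnstile> A type Set \<Longrightarrow> T \<parallel> \<Gamma> \<turnstile> List A type Set"
| C_List: "T \<parallel> \<Gamma> \<turnstile> A \<doteq> A' type Set \<Longrightarrow> T \<parallel> \<Gamma> \<turnstile> List A \<doteq> List A' type Set"
| I_Nil: "T \<parallel> \<Gamma> \<turnstile> A type Set \<Longrightarrow> T \<parallel> \<Gamma> \<turnstile> Nil A \<Colon> List A"
| C_Nil: "T \<parallel> \<Gamma> \<turnstile> A \<doteq> A' type Set \<Longrightarrow> T \<parallel> \<Gamma> \<turnstile> Nil A \<doteq> Nil A' \<Colon> List A"
| I_Cons: "\<lbrakk>T \<parallel> \<Gamma> \<turnstile> A type Set; T \<parallel> \<Gamma> \<turnstile> l \<Colon> List A; T \<parallel> \<Gamma> \<turnstile> a \<Colon> A\<rbrakk> \<Longrightarrow> T \<parallel> \<Gamma> \<turnstile> Cons A l a \<Colon> List A"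
| C_Cons:
    "\<lbrakk>T \<parallel> \<Gamma> \<turnstile> A \<doteq> A' type Set; T \<parallel> \<Gamma> \<turnstile> l \<doteq> l' \<Colon> List A; T \<parallel> \<Gamma> \<turnstile> a \<doteq> a' \<Colon> A\<rbrakk>
      \<Longrightarrow> T \<parallel> \<Gamma> \<turnstile> Cons A l a \<doteq> Cons A' l' a' \<Colon> List A"
| E_List:
    "\<lbrakk>T \<parallel> \<Gamma> \<turnstile> A type Set; T \<parallel> List A # \<Gamma> \<turnstile> L type Col; T \<parallel> \<Gamma> \<turnstile> c \<Colon> List A;
      T \<parallel> \<Gamma> \<turnstile> a \<Colon> L \<bullet> (Nil A \<cdot> Var);
      T \<parallel> L \<bullet> (Var 1 \<cdot> wk 2) # A \<bullet> wk 1 # List A # \<Gamma> \<turnstile> m \<Colon> L \<bullet> (Cons (A \<bullet> wk 3) (Var 2) (Var 1) \<cdot> wk 3)\<rbrakk>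
      \<Longrightarrow> T \<parallel> \<Gamma> \<turnstile> ElList A L c a m \<Colon> L \<bullet> (c \<cdot> Var)"
| B1_List:
    "\<lbrakk>T \<parallel> \<Gamma> \<turnstile> A type Set; T \<parallel> List A # \<Gamma> \<turnstile> L type Col; T \<parallel> \<Gamma> \<turnstile> a \<Colon> L \<bullet> (Nil A \<cdot> Var);
      T \<parallel> L \<bullet> (Var 1 \<cdot> wk 2) # A \<bullet> wk 1 # List A # \<Gamma> \<turnstile> m \<Colon> L \<bullet> (Cons (A \<bullet> wk 3) (Var 2) (Var 1) \<cdot> wk 3)\<rbrakk>
      \<Longrightarrow> T \<parallel> \<Gamma> \<turnstile> ElList A L (Nil A) a m \<doteq> a \<Colon> L \<bullet> (Nil A \<cdot> Var)"
| B2_List: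
    "\<lbrakk>T \<parallel> \<Gamma> \<turnstile> A type Set; T \<parallel> List A # \<Gamma> \<turnstile> L type Col; T \<parallel> \<Gamma> \<turnstile> l \<Colon> List A; T \<parallel> \<Gamma> \<turnstile> b \<Colon> A;
      T \<parallel> \<Gamma> \<turnstile> a \<Colon> L \<bullet> (Nil A \<cdot> Var);
      T \<parallel> L \<bullet> (Var 1 \<cdot> wk 2) # A \<bullet> wk 1 # List A # \<Gamma> \<turnstile> m \<Colon> L \<bullet> (Cons (A \<bullet> wk 3) (Var 2) (Var 1) \<cdot> wk 3)\<rbrakk>
      \<Longrightarrow> T \<parallel> \<Gamma> \<turnstile> ElList A L (Cons A l b) a m \<doteq> m \<star> (ElList A L l a m \<cdot> b \<cdot> l \<cdot> Var) \<Colon> L \<bullet> (Cons A l b \<cdot> Var)"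
| C_ElList:
    "\<lbrakk>T \<parallel> \<Gamma> \<turnstile> A \<doteq> A' type Set; T \<parallel> List A # \<Gamma> \<turnstile> L \<doteq> L' type Col; T \<parallel> \<Gamma> \<turnstile> c \<doteq> c' \<Colon> List A;
      T \<parallel> \<Gamma> \<turnstile> a \<doteq> a' \<Colon> L \<bullet> (Nil A \<cdot> Var);
      T \<parallel> L \<bullet> (Var 1 \<cdot> wk 2) # A \<bullet> wk 1 # List A # \<Gamma> \<turnstile> m \<doteq> m' \<Colon> L \<bullet> (Cons (A \<bullet> wk 3) (Var 2) (Var 1) \<cdot> wk 3)\<rbrakk>
      \<Longrightarrow> T \<parallel> \<Gamma> \<turnstile> ElList A L c a m \<doteq> ElList A' L' c' a' m' \<Colon> L \<bullet> (c \<cdot> Var)"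

| F_Sum: "\<lbrakk>T \<parallel> \<Gamma> \<turnstile> A type Set; T \<parallel> \<Gamma> \<turnstile> B type Set\<rbrakk> \<Longrightarrow> T \<parallel> \<Gamma> \<turnstile> Sum A B type Set"
| C_Sum:
    "\<lbrakk>T \<parallel> \<Gamma> \<turnstile> A \<doteq> A' type Set; T \<parallel> \<Gamma> \<turnstile> B \<doteq> B' type Set\<rbrakk>
      \<Longrightarrow> T \<parallel> \<Gamma> \<turnstile> Sum A B \<doteq> Sum A' B' type Set"
| I_Inl: "\<lbrakk>T \<parallel> \<Gamma> \<turnstile> A type Set; T \<parallel> \<Gamma> \<turnstile> B type Set; T \<parallel> \<Gamma> \<turnstile> a \<Colon> A\<rbrakk> \<Longrightarrow> T \<parallel> \<Gamma> \<turnstile> Inl A B a \<Colon> Sum A B"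
| I_Inr: "\<lbrakk>T \<parallel> \<Gamma> \<turnstile> A type Set; T \<parallel> \<Gamma> \<turnstile> B type Set; T \<parallel> \<Gamma> \<turnstile> b \<Colon> B\<rbrakk> \<Longrightarrow> T \<parallel> \<Gamma> \<turnstile> Inr A B b \<Colon> Sum A B"
| C_Inl:
    "\<lbrakk>T \<parallel> \<Gamma> \<turnstile> A \<doteq> A' type Set; T \<parallel> \<Gamma> \<turnstile> B \<doteq> B' type Set; T \<parallel> \<Gamma> \<turnstile> a \<doteq> a' \<Colon> A\<rbrakk>
      \<Longrightarrow> T \<parallel> \<Gamma> \<turnstile> Inl A B a \<doteq> Inl A' B' a' \<Colon> Sum A B"
| C_Inr:
    "\<lbrakk>T \<parallel> \<Gamma> \<turnstile> A \<doteq> A' type Set; T \<parallel> \<Gamma> \<turnstile> B \<doteq> B' type Set; T \<parallel> \<Gamma> \<turnstile> b \<doteq> b' \<Colon> B\<rbrakk>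
      \<Longrightarrow> T \<parallel> \<Gamma> \<turnstile> Inr A B b \<doteq> Inr A' B' b' \<Colon> Sum A B"
| E_Sum:
    "\<lbrakk>T \<parallel> \<Gamma> \<turnstile> A type Set; T \<parallel> \<Gamma> \<turnstile> B type Set; T \<parallel> Sum A B # \<Gamma> \<turnstile> L type Col; T \<parallel> \<Gamma> \<turnstile> c \<Colon> Sum A B;
      T \<parallel> A # \<Gamma> \<turnstile> m \<Colon> L \<bullet> (Inl (A \<bullet> wk 1) (B \<bullet> wk 1) (Var 0) \<cdot> wk 1);
      T \<parallel> B # \<Gamma> \<turnstile> n \<Colon> L \<bullet> (Inr (A \<bullet> wk 1) (B \<bullet> wk 1) (Var 0) \<cdot> wk 1)\<rbrakk>
      \<Longrightarrow> T \<parallel> \<Gamma> \<turnstile> ElSum A B L c m n \<Colon> L \<bullet> (c \<cdot> Var)"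
| B1_Sum:
    "\<lbrakk>T \<parallel> \<Gamma> \<turnstile> A type Set; T \<parallel> \<Gamma> \<turnstile> B type Set; T \<parallel> Sum A B # \<Gamma> \<turnstile> L type Col; T \<parallel> \<Gamma> \<turnstile> a \<Colon> A;
      T \<parallel> A # \<Gamma> \<turnstile> m \<Colon> L \<bullet> (Inl (A \<bullet> wk 1) (B \<bullet> wk 1) (Var 0) \<cdot> wk 1);
      T \<parallel> B # \<Gamma> \<turnstile> n \<Colon> L \<bullet> (Inr (A \<bullet> wk 1) (B \<bullet> wk 1) (Var 0) \<cdot> wk 1)\<rbrakk>
      \<Longrightarrow> T \<parallel> \<Gamma> \<turnstile> ElSum A B L (Inl A B a) m n \<doteq> m \<star> (a \<cdot> Var) \<Colon> L \<bullet> (Inl A B a \<cdot> Var)"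
| B2_Sum:
    "\<lbrakk>T \<parallel> \<Gamma> \<turnstile> A type Set; T \<parallel> \<Gamma> \<turnstile> B type Set; T \<parallel> Sum A B # \<Gamma> \<turnstile> L type Col; T \<parallel> \<Gamma> \<turnstile> b \<Colon> B;
      T \<parallel> A # \<Gamma> \<turnstile> m \<Colon> L \<bullet> (Inl (A \<bullet> wk 1) (B \<bullet> wk 1) (Var 0) \<cdot> wk 1);
      T \<parallel> B # \<Gamma> \<turnstile> n \<Colon> L \<bullet> (Inr (A \<bullet> wk 1) (B \<bullet> wk 1) (Var 0) \<cdot> wk 1)\<rbrakk>
      \<Longrightarrow> T \<parallel> \<Gamma> \<turnstile> ElSum A B L (Inr A B b) m n \<doteq> n \<star> (b \<cdot> Var) \<Colon> L \<bullet> (Inr A B b \<cdot> Var)"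
| C_ElSum:
    "\<lbrakk>T \<parallel> \<Gamma> \<turnstile> A \<doteq> A' type Set; T \<parallel> \<Gamma> \<turnstile> B \<doteq> B' type Set; T \<parallel> Sum A B # \<Gamma> \<turnstile> L \<doteq> L' type Col;
      T \<parallel> \<Gamma> \<turnstile> c \<doteq> c' \<Colon> Sum A B;
      T \<parallel> A # \<Gamma> \<turnstile> m \<doteq> m' \<Colon> L \<bullet> (Inl (A \<bullet> wk 1) (B \<bullet> wk 1) (Var 0) \<cdot> wk 1);
      T \<parallel> B # \<Gamma> \<turnstile> n \<doteq> n' \<Colon> L \<bullet> (Inr (A \<bullet> wk 1) (B \<bullet> wk 1) (Var 0) \<cdot> wk 1)\<rbrakk>
      \<Longrightarrow> T \<parallel> \<Gamma> \<turnstile> ElSum A B L c m n \<doteq> ElSum A' B' L' c' m' n' \<Colon> L \<bullet> (c \<cdot> Var)"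

| F_Sig: "\<lbrakk>K \<in> {Set, Col}; T \<parallel> \<Gamma> \<turnstile> A type K; T \<parallel> A # \<Gamma> \<turnstile> B type K\<rbrakk> \<Longrightarrow> T \<parallel> \<Gamma> \<turnstile> Sig A B type K"
| C_Sig:
    "\<lbrakk>K \<in> {Set, Col}; T \<parallel> \<Gamma> \<turnstile> A \<doteq> A' type K; T \<parallel> A # \<Gamma> \<turnstile> B \<doteq> B' type K\<rbrakk>
      \<Longrightarrow> T \<parallel> \<Gamma> \<turnstile> Sig A B \<doteq> Sig A' B' type K"
| I_Sig:
    "\<lbrakk>T \<parallel> \<Gamma> \<turnstile> A type Col; T \<parallel> A # \<Gamma> \<turnstile> B type Col; T \<parallel> \<Gamma> \<turnstile> a \<Colon> A; T \<parallel> \<Gamma> \<turnstile> b \<Colon> B \<bullet> (a \<cdot> Var)\<rbrakk>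
      \<Longrightarrow> T \<parallel> \<Gamma> \<turnstile> Pair A B a b \<Colon> Sig A B"
| C_Pair:
    "\<lbrakk>T \<parallel> \<Gamma> \<turnstile> A \<doteq> A' type Col; T \<parallel> A # \<Gamma> \<turnstile> B \<doteq> B' type Col; T \<parallel> \<Gamma> \<turnstile> a \<doteq> a' \<Colon> A;
      T \<parallel> \<Gamma> \<turnstile> b \<doteq> b' \<Colon> B \<bullet> (a \<cdot> Var)\<rbrakk>
      \<Longrightarrow> T \<parallel> \<Gamma> \<turnstile> Pair A B a b \<doteq> Pair A' B' a' b' \<Colon> Sig A B"
| E_Sig:
    "\<lbrakk>T \<parallel> \<Gamma> \<turnstile> A type Col; T \<parallel> A # \<Gamma> \<turnstile> B type Col; T \<parallel> Sig A B # \<Gamma> \<turnstile> L type Col;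
      T \<parallel> \<Gamma> \<turnstile> d \<Colon> Sig A B;
      T \<parallel> B # A # \<Gamma> \<turnstile> m \<Colon> L \<bullet> (Pair (A \<bullet> wk 2) (B \<bullet> up (wk 2)) (Var 1) (Var 0) \<cdot> wk 2)\<rbrakk>
      \<Longrightarrow> T \<parallel> \<Gamma> \<turnstile> ElSig A B L d m \<Colon> L \<bullet> (d \<cdot> Var)"
| B_Sig:
    "\<lbrakk>T \<parallel> \<Gamma> \<turnstile> A type Col; T \<parallel> A # \<Gamma> \<turnstile> B type Col; T \<parallel> Sig A B # \<Gamma> \<turnstile> L type Col; T \<parallel> \<Gamma> \<turnstile> a \<Colon> A;
      T \<parallel> \<Gamma> \<turnstile> b \<Colon> B \<bullet> (a \<cdot> Var);
      T \<parallel> B # A # \<Gamma> \<turnstile> m \<Colon> L \<bullet> (Pair (A \<bullet> wk 2) (B \<bullet> up (wk 2)) (Var 1) (Var 0) \<cdot> wk 2)\<rbrakk>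
      \<Longrightarrow> T \<parallel> \<Gamma> \<turnstile> ElSig A B L (Pair A B a b) m \<doteq> m \<star> (b \<cdot> a \<cdot> Var) \<Colon> L \<bullet> (Pair A B a b \<cdot> Var)"
| C_ElSig:
    "\<lbrakk>T \<parallel> \<Gamma> \<turnstile> A \<doteq> A' type Col; T \<parallel> A # \<Gamma> \<turnstile> B \<doteq> B' type Col; T \<parallel> Sig A B # \<Gamma> \<turnstile> L \<doteq> L' type Col;
      T \<parallel> \<Gamma> \<turnstile> d \<doteq> d' \<Colon> Sig A B;
      T \<parallel> B # A # \<Gamma> \<turnstile> m \<doteq> m' \<Colon> L \<bullet> (Pair (A \<bullet> wk 2) (B \<bullet> up (wk 2)) (Var 1) (Var 0) \<cdot> wk 2)\<rbrakk>
      \<Longrightarrow> T \<parallel> \<Gamma> \<turnstile> ElSig A B L d m \<doteq> ElSig A' B' L' d' m' \<Colon> L \<bullet> (d \<cdot> Var)"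

| F_Pi: "\<lbrakk>T \<parallel> \<Gamma> \<turnstile> A type Set; T \<parallel> A # \<Gamma> \<turnstile> B type Set\<rbrakk> \<Longrightarrow> T \<parallel> \<Gamma> \<turnstile> Pi A B type Set"
| C_Pi:
    "\<lbrakk>T \<parallel> \<Gamma> \<turnstile> A \<doteq> A' type Set; T \<parallel> A # \<Gamma> \<turnstile> B \<doteq> B' type Set\<rbrakk>
      \<Longrightarrow> T \<parallel> \<Gamma> \<turnstile> Pi A B \<doteq> Pi A' B' type Set"
| I_Pi:
    "\<lbrakk>T \<parallel> \<Gamma> \<turnstile> A type Set; T \<parallel> A # \<Gamma> \<turnstile> B type Set; T \<parallel> A # \<Gamma> \<turnstile> b \<Colon> B\<rbrakk>
      \<Longrightarrow> T \<parallel> \<Gamma> \<turnstile> Lam A B b \<Colon> Pi A B"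
| C_Lam:
    "\<lbrakk>T \<parallel> \<Gamma> \<turnstile> A \<doteq> A' type Set; T \<parallel> A # \<Gamma> \<turnstile> B \<doteq> B' type Set; T \<parallel> A # \<Gamma> \<turnstile> b \<doteq> b' \<Colon> B\<rbrakk>
      \<Longrightarrow> T \<parallel> \<Gamma> \<turnstile> Lam A B b \<doteq> Lam A' B' b' \<Colon> Pi A B"
| E_Pi:
    "\<lbrakk>T \<parallel> \<Gamma> \<turnstile> A type Set; T \<parallel> A # \<Gamma> \<turnstile> B type Set; T \<parallel> \<Gamma> \<turnstile> f \<Colon> Pi A B; T \<parallel> \<Gamma> \<turnstile> a \<Colon> A\<rbrakk>
      \<Longrightarrow> T \<parallel> \<Gamma> \<turnstile> Ap A B f a \<Colon> B \<bullet> (a \<cdot> Var)"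
| C_Ap:
    "\<lbrakk>T \<parallel> \<Gamma> \<turnstile> A \<doteq> A' type Set; T \<parallel> A # \<Gamma> \<turnstile> B \<doteq> B' type Set; T \<parallel> \<Gamma> \<turnstile> f \<doteq> f' \<Colon> Pi A B;
      T \<parallel> \<Gamma> \<turnstile> a \<doteq> a' \<Colon> A\<rbrakk>
      \<Longrightarrow> T \<parallel> \<Gamma> \<turnstile> Ap A B f a \<doteq> Ap A' B' f' a' \<Colon> B \<bullet> (a \<cdot> Var)"
| B_Pi:
    "\<lbrakk>T \<parallel> \<Gamma> \<turnstile> A type Set; T \<parallel> A # \<Gamma> \<turnstile> B type Set; T \<parallel> A # \<Gamma> \<turnstile> b \<Colon> B; T \<parallel> \<Gamma> \<turnstile> a \<Colon> A\<rbrakk>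
      \<Longrightarrow> T \<parallel> \<Gamma> \<turnstile> Ap A B (Lam A B b) a \<doteq> b \<star> (a \<cdot> Var) \<Colon> B \<bullet> (a \<cdot> Var)"
| eta_Pi:
    "\<lbrakk>T \<parallel> \<Gamma> \<turnstile> A type Set; T \<parallel> A # \<Gamma> \<turnstile> B type Set; T \<parallel> \<Gamma> \<turnstile> f \<Colon> Pi A B\<rbrakk>
      \<Longrightarrow> T \<parallel> \<Gamma> \<turnstile> Lam A B (Ap (A \<bullet> wk 1) (B \<bullet> up (wk 1)) (f \<star> wk 1) (Var 0)) \<doteq> f \<Colon> Pi A B"

| F_Quot:
    "\<lbrakk>T \<parallel> \<Gamma> \<turnstile> A type Set; T \<parallel> A \<bullet> wk 1 # A # \<Gamma> \<turnstile> R type PropS;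
      T \<parallel> A # \<Gamma> \<turnstile> true \<Colon> rel R 1 (Var 0) (Var 0);
      T \<parallel> R # A \<bullet> wk 1 # A # \<Gamma> \<turnstile> true \<Colon> rel R 3 (Var 1) (Var 2);
      T \<parallel> rel R 4 (Var 2) (Var 1) # rel R 3 (Var 2) (Var 1) # A \<bullet> wk 2 # A \<bullet> wk 1 # A # \<Gamma> \<turnstile> true \<Colon> rel R 5 (Var 4) (Var 2)\<rbrakk>
      \<Longrightarrow> T \<parallel> \<Gamma> \<turnstile> Quot A R type Set"
| C_Quot:
    "\<lbrakk>T \<parallel> \<Gamma> \<turnstile> A \<doteq> A' type Set; T \<parallel> A \<bullet> wk 1 # A # \<Gamma> \<turnstile> R \<doteq> R' type PropS;
      T \<parallel> \<Gamma> \<turnstile> Quot A R type Set; T \<parallel> \<Gamma> \<turnstile> Quot A' R' type Set\<rbrakk>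
      \<Longrightarrow> T \<parallel> \<Gamma> \<turnstile> Quot A R \<doteq> Quot A' R' type Set"
| I_Quot: "\<lbrakk>T \<parallel> \<Gamma> \<turnstile> Quot A R type Set; T \<parallel> \<Gamma> \<turnstile> a \<Colon> A\<rbrakk> \<Longrightarrow> T \<parallel> \<Gamma> \<turnstile> Cls A R a \<Colon> Quot A R"
| C_Cls:
    "\<lbrakk>T \<parallel> \<Gamma> \<turnstile> A \<doteq> A' type Set; T \<parallel> A \<bullet> wk 1 # A # \<Gamma> \<turnstile> R \<doteq> R' type PropS;
      T \<parallel> \<Gamma> \<turnstile> Quot A R type Set; T \<parallel> \<Gamma> \<turnstile> Quot A' R' type Set; T \<parallel> \<Gamma> \<turnstile> a \<doteq> a' \<Colon> A\<rbrakk>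
      \<Longrightarrow> T \<parallel> \<Gamma> \<turnstile> Cls A R a \<doteq> Cls A' R' a' \<Colon> Quot A R"
| eq_Quot:
    "\<lbrakk>T \<parallel> \<Gamma> \<turnstile> Quot A R type Set; T \<parallel> \<Gamma> \<turnstile> a \<Colon> A; T \<parallel> \<Gamma> \<turnstile> b \<Colon> A; T \<parallel> \<Gamma> \<turnstile> true \<Colon> rel R 0 a b\<rbrakk>
      \<Longrightarrow> T \<parallel> \<Gamma> \<turnstile> Cls A R a \<doteq> Cls A R b \<Colon> Quot A R"
| eff_Quot:
    "\<lbrakk>T \<parallel> \<Gamma> \<turnstile> Quot A R type Set; T \<parallel> \<Gamma> \<turnstile> a \<Colon> A; T \<parallel> \<Gamma> \<turnstile> b \<Colon> A;
      T \<parallel> \<Gamma> \<turnstile> Cls A R a \<doteq> Cls A R b \<Colon> Quot A R\<rbrakk>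
      \<Longrightarrow> T \<parallel> \<Gamma> \<turnstile> true \<Colon> rel R 0 a b"
| E_Quot:
    "\<lbrakk>T \<parallel> \<Gamma> \<turnstile> Quot A R type Set; T \<parallel> Quot A R # \<Gamma> \<turnstile> L type Col; T \<parallel> \<Gamma> \<turnstile> p \<Colon> Quot A R;
      T \<parallel> A # \<Gamma> \<turnstile> m \<Colon> L \<bullet> (Cls (A \<bullet> wk 1) (R \<bullet> up (up (wk 1))) (Var 0) \<cdot> wk 1);
      T \<parallel> R # A \<bullet> wk 1 # A # \<Gamma> \<turnstile> m \<star> (Var 2 \<cdot> wk 3) \<doteq> m \<star> (Var 1 \<cdot> wk 3) \<Colon> L \<bullet> (Cls (A \<bullet> wk 3) (R \<bullet> up (up (wk 3))) (Var 2) \<cdot> wk 3)\<rbrakk>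
      \<Longrightarrow> T \<parallel> \<Gamma> \<turnstile> ElQ A R L p m \<Colon> L \<bullet> (p \<cdot> Var)"
| B_Quot:
    "\<lbrakk>T \<parallel> \<Gamma> \<turnstile> Quot A R type Set; T \<parallel> Quot A R # \<Gamma> \<turnstile> L type Col; T \<parallel> \<Gamma> \<turnstile> a \<Colon> A;
      T \<parallel> A # \<Gamma> \<turnstile> m \<Colon> L \<bullet> (Cls (A \<bullet> wk 1) (R \<bullet> up (up (wk 1))) (Var 0) \<cdot> wk 1);
      T \<parallel> R # A \<bullet> wk 1 # A # \<Gamma> \<turnstile> m \<star> (Var 2 \<cdot> wk 3) \<doteq> m \<star> (Var 1 \<cdot> wk 3) \<Colon> L \<bullet> (Cls (A \<bullet> wk 3) (R \<bullet> up (up (wk 3))) (Var 2) \<cdot> wk 3)\<rbrakk>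
      \<Longrightarrow> T \<parallel> \<Gamma> \<turnstile> ElQ A R L (Cls A R a) m \<doteq> m \<star> (a \<cdot> Var) \<Colon> L \<bullet> (Cls A R a \<cdot> Var)"
| C_ElQ:
    "\<lbrakk>T \<parallel> \<Gamma> \<turnstile> A \<doteq> A' type Set; T \<parallel> A \<bullet> wk 1 # A # \<Gamma> \<turnstile> R \<doteq> R' type PropS;
      T \<parallel> \<Gamma> \<turnstile> Quot A R type Set; T \<parallel> \<Gamma> \<turnstile> Quot A' R' type Set; T \<parallel> Quot A R # \<Gamma> \<turnstile> L \<doteq> L' type Col;
      T \<parallel> \<Gamma> \<turnstile> p \<doteq> p' \<Colon> Quot A R;
      T \<parallel> A # \<Gamma> \<turnstile> m \<doteq> m' \<Colon> L \<bullet> (Cls (A \<bullet> wk 1) (R \<bullet> up (up (wk 1))) (Var 0) \<cdot> wk 1);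
      T \<parallel> R # A \<bullet> wk 1 # A # \<Gamma> \<turnstile> m \<star> (Var 2 \<cdot> wk 3) \<doteq> m \<star> (Var 1 \<cdot> wk 3) \<Colon> L \<bullet> (Cls (A \<bullet> wk 3) (R \<bullet> up (up (wk 3))) (Var 2) \<cdot> wk 3)\<rbrakk>
      \<Longrightarrow> T \<parallel> \<Gamma> \<turnstile> ElQ A R L p m \<doteq> ElQ A' R' L' p' m' \<Colon> L \<bullet> (p \<cdot> Var)"

| F_P1: "T \<turnstile> \<Gamma> ctx \<Longrightarrow> T \<parallel> \<Gamma> \<turnstile> P1 type Col"
| I_P1: "T \<parallel> \<Gamma> \<turnstile> \<phi> type PropS \<Longrightarrow> T \<parallel> \<Gamma> \<turnstile> Code \<phi> \<Colon> P1"
| C_Code: "T \<parallel> \<Gamma> \<turnstile> \<phi> \<doteq> \<psi> type PropS \<Longrightarrow> T \<parallel> \<Gamma> \<turnstile> Code \<phi> \<doteq> Code \<psi> \<Colon> P1"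
| eq_P1:
    "\<lbrakk>T \<parallel> \<Gamma> \<turnstile> \<phi> type PropS; T \<parallel> \<Gamma> \<turnstile> \<psi> type PropS; T \<parallel> \<Gamma> \<turnstile> true \<Colon> Iff \<phi> \<psi>\<rbrakk>
      \<Longrightarrow> T \<parallel> \<Gamma> \<turnstile> Code \<phi> \<doteq> Code \<psi> \<Colon> P1"
| eff_P1:
    "\<lbrakk>T \<parallel> \<Gamma> \<turnstile> \<phi> type PropS; T \<parallel> \<Gamma> \<turnstile> \<psi> type PropS; T \<parallel> \<Gamma> \<turnstile> Code \<phi> \<doteq> Code \<psi> \<Colon> P1\<rbrakk>
      \<Longrightarrow> T \<parallel> \<Gamma> \<turnstile> true \<Colon> Iff \<phi> \<psi>"
| eta_P1: "T \<parallel> \<Gamma> \<turnstile> U \<Colon> P1 \<Longrightarrow> T \<parallel> \<Gamma> \<turnstile> U \<doteq> Code (Dc U) \<Colon> P1"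

| F_FunP1: "T \<parallel> \<Gamma> \<turnstile> A type Set \<Longrightarrow> T \<parallel> \<Gamma> \<turnstile> FunP1 A type Col"
| C_FunP1: "T \<parallel> \<Gamma> \<turnstile> A \<doteq> A' type Set \<Longrightarrow> T \<parallel> \<Gamma> \<turnstile> FunP1 A \<doteq> FunP1 A' type Col"
| I_FunP1: "\<lbrakk>T \<parallel> \<Gamma> \<turnstile> A type Set; T \<parallel> A # \<Gamma> \<turnstile> b \<Colon> P1\<rbrakk> \<Longrightarrow> T \<parallel> \<Gamma> \<turnstile> LamP1 A b \<Colon> FunP1 A"
| C_LamP1:
    "\<lbrakk>T \<parallel> \<Gamma> \<turnstile> A \<doteq> A' type Set; T \<parallel> A # \<Gamma> \<turnstile> b \<doteq> b' \<Colon> P1\<rbrakk>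
      \<Longrightarrow> T \<parallel> \<Gamma> \<turnstile> LamP1 A b \<doteq> LamP1 A' b' \<Colon> FunP1 A"
| E_FunP1: "\<lbrakk>T \<parallel> \<Gamma> \<turnstile> A type Set; T \<parallel> \<Gamma> \<turnstile> f \<Colon> FunP1 A; T \<parallel> \<Gamma> \<turnstile> a \<Colon> A\<rbrakk> \<Longrightarrow> T \<parallel> \<Gamma> \<turnstile> ApP1 A f a \<Colon> P1"
| C_ApP1:
    "\<lbrakk>T \<parallel> \<Gamma> \<turnstile> A \<doteq> A' type Set; T \<parallel> \<Gamma> \<turnstile> f \<doteq> f' \<Colon> FunP1 A; T \<parallel> \<Gamma> \<turnstile> a \<doteq> a' \<Colon> A\<rbrakk>
      \<Longrightarrow> T \<parallel> \<Gamma> \<turnstile> ApP1 A f a \<doteq> ApP1 A' f' a' \<Colon> P1"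
| B_FunP1:
    "\<lbrakk>T \<parallel> \<Gamma> \<turnstile> A type Set; T \<parallel> A # \<Gamma> \<turnstile> b \<Colon> P1; T \<parallel> \<Gamma> \<turnstile> a \<Colon> A\<rbrakk>
      \<Longrightarrow> T \<parallel> \<Gamma> \<turnstile> ApP1 A (LamP1 A b) a \<doteq> b \<star> (a \<cdot> Var) \<Colon> P1"
| eta_FunP1:
    "\<lbrakk>T \<parallel> \<Gamma> \<turnstile> A type Set; T \<parallel> \<Gamma> \<turnstile> f \<Colon> FunP1 A\<rbrakk>
      \<Longrightarrow> T \<parallel> \<Gamma> \<turnstile> LamP1 A (ApP1 (A \<bullet> wk 1) (f \<star> wk 1) (Var 0)) \<doteq> f \<Colon> FunP1 A"


section \<open>The translation\<close>

text \<open>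
  \<open>P1N\<close> is \<open>(\<Sigma>x\<in>P(1)) (\<not>\<not>Dc(x) \<Rightarrow> Dc(x))\<close>, with first projection \<open>fstP1\<close>.
\<close>

definition P1N :: ty where
  "P1N = Sig P1 (Stab (Dc (Var 0)))"

definition fstP1 :: "tm \<Rightarrow> tm" where
  "fstP1 u = ElSig P1 (Stab (Dc (Var 0))) P1 u (Var 1)"

text \<open>
  The non-dependent product \<open>A \<rightarrow> P1N\<close>, which translates \<open>A \<rightarrow> P(1)\<close>. It is not a primitive
  collection: the function collections of emTT are those into \<open>P(1)\<close>, a dependent product needs a
  family of sets, and \<open>Pi A P1N\<close> is not even derivably a collection. \<open>A \<rightarrow> P1N\<close> is therefore
  the collection \<open>(\<Sigma>f\<in>A\<rightarrow>P(1)) (\<forall>x\<in>A) (\<not>\<not>Dc(f(x)) \<Rightarrow> Dc(f(x)))\<close>, whose abstraction \<open>LamP1N\<close> takes a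
  family of elements of \<open>P1N\<close> and whose application \<open>ApP1N\<close> returns an element of \<open>P1N\<close>.
\<close>

definition FunStab :: "ty \<Rightarrow> ty" where
  "FunStab A = Uni (A \<bullet> wk 1) (Stab (Dc (ApP1 (A \<bullet> wk 2) (Var 1) (Var 0))))"

definition FunP1N :: "ty \<Rightarrow> ty" where
  "FunP1N A = Sig (FunP1 A) (FunStab A)"

definition LamP1N :: "ty \<Rightarrow> tm \<Rightarrow> tm" where
  "LamP1N A b = Pair (FunP1 A) (FunStab A) (LamP1 A (fstP1 b)) true"

definition ApP1N :: "ty \<Rightarrow> tm \<Rightarrow> tm \<Rightarrow> tm" where
  "ApP1N A f a = Pair P1 (Stab (Dc (Var 0)))
     (ApP1 A (ElSig (FunP1 A) (FunStab A) (FunP1 (A \<bullet> wk 1)) f (Var 1)) a) true"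

text \<open>
  On \<open>Eq P1\<close> the translation is not \<open>Eq P1N a b\<close> but the equality in \<open>P(1)\<close> of the first components,
  which is equivalent to it, the second components being proofs. \<open>Dc U\<close> is small and \<open>Code (Dc U)\<close>
  is formed in the source theory, but \<open>Eq P1N a b\<close> is not derivably small, as \<open>P1N\<close> is not a set.
\<close>

primrec N_ty :: "ty \<Rightarrow> ty" and N_tm :: "tm \<Rightarrow> tm" where
  "N_ty Falsum = Falsum"
| "N_ty (Conj \<phi> \<psi>) = Conj (N_ty \<phi>) (N_ty \<psi>)"
| "N_ty (Disj \<phi> \<psi>) = Neg (Neg (Disj (N_ty \<phi>) (N_ty \<psi>)))"
| "N_ty (Impl \<phi> \<psi>) = Impl (N_ty \<phi>) (N_ty \<psi>)"
| "N_ty (Exi A \<phi>) = Neg (Neg (Exi (N_ty A) (N_ty \<phi>)))"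
| "N_ty (Uni A \<phi>) = Uni (N_ty A) (N_ty \<phi>)"
| "N_ty (Eq A a b) = (if A = P1 then Eq P1 (fstP1 (N_tm a)) (fstP1 (N_tm b))
     else Eq (N_ty A) (N_tm a) (N_tm b))"
| "N_ty N0 = N0"
| "N_ty N1 = N1"
| "N_ty (List A) = List (N_ty A)"
| "N_ty (Sum A B) = Sum (N_ty A) (N_ty B)"
| "N_ty (Sig A B) = Sig (N_ty A) (N_ty B)"
| "N_ty (Pi A B) = Pi (N_ty A) (N_ty B)"
| "N_ty (Quot A R) = Quot (N_ty A) (N_ty R)"
| "N_ty P1 = P1N"
| "N_ty (FunP1 A) = FunP1N (N_ty A)"
| "N_tm (Var n) = Var n"
| "N_tm true = true"
| "N_tm (ElN0 L c) = ElN0 (N_ty L) (N_tm c)"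
| "N_tm Star = Star"
| "N_tm (ElN1 L c a) = ElN1 (N_ty L) (N_tm c) (N_tm a)"
| "N_tm (Nil A) = Nil (N_ty A)"
| "N_tm (Cons A l a) = Cons (N_ty A) (N_tm l) (N_tm a)"
| "N_tm (ElList A L c a m) = ElList (N_ty A) (N_ty L) (N_tm c) (N_tm a) (N_tm m)"
| "N_tm (Inl A B a) = Inl (N_ty A) (N_ty B) (N_tm a)"
| "N_tm (Inr A B b) = Inr (N_ty A) (N_ty B) (N_tm b)"
| "N_tm (ElSum A B L c m n) = ElSum (N_ty A) (N_ty B) (N_ty L) (N_tm c) (N_tm m) (N_tm n)"
| "N_tm (Pair A B a b) = Pair (N_ty A) (N_ty B) (N_tm a) (N_tm b)"
| "N_tm (ElSig A B L d m) = ElSig (N_ty A) (N_ty B) (N_ty L) (N_tm d) (N_tm m)"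
| "N_tm (Lam A B b) = Lam (N_ty A) (N_ty B) (N_tm b)"
| "N_tm (Ap A B f a) = Ap (N_ty A) (N_ty B) (N_tm f) (N_tm a)"
| "N_tm (Cls A R a) = Cls (N_ty A) (N_ty R) (N_tm a)"
| "N_tm (ElQ A R L p m) = ElQ (N_ty A) (N_ty R) (N_ty L) (N_tm p) (N_tm m)"
| "N_tm (Code \<phi>) = Pair P1 (Stab (Dc (Var 0))) (Code (N_ty \<phi>)) true"
| "N_tm (LamP1 A b) = LamP1N (N_ty A) (N_tm b)"
| "N_tm (ApP1 A f a) = ApP1N (N_ty A) (N_tm f) (N_tm a)"

definition N_ctx :: "ty list \<Rightarrow> ty list" where
  "N_ctx \<Gamma> = map N_ty \<Gamma>"

end

theory Submission
  imports Defs
begin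

text \<open>
  The translation is a double-negation translation, and everything rests on one invariant: in emTT,
  every translated proposition is stable, and two elements of a translated collection are equal as
  soon as they are not not equal. Most rules of emTT with excluded middle become the same rule of
  emTT, because the translation commutes with substitution (\<open>N_sub_sub\<close>). The exceptions are the
  rules of disjunction and existence, excluded middle, and the rules that mention \<open>P(1)\<close>.

  A doubly negated disjunction or existential can still be eliminated towards a stable conclusion
  (\<open>nn_Disj_E\<close>, \<open>nn_Exi_E\<close>), and excluded middle becomes \<open>\<not>\<not>(\<phi> \<or> \<not>\<phi>)\<close>, which holds
  intuitionistically (\<open>nn_LEM\<close>). A translated truth value is a truth value together with a proof
  that its decoding is stable. Proofs are irrelevant, so such a pair is determined by its first
  component (\<open>P1N_ext\<close>); this turns each rule of \<open>P(1)\<close> and of \<open>A \<rightarrow> P(1)\<close> into the corresponding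
  rule for first components. The code of a translated proposition has a stable decoding because
  the proposition itself is stable, so here the invariant is needed already to type the translation.

  Stability of equality has one closure lemma per type former. Equality of pairs is equality of the
  components, and equality of functions is equality of the values. For sums and lists it reduces to
  equality of the arguments, the constructors being injective and disjoint; disjointness is seen by
  eliminating into \<open>P(1)\<close>. Quotients are effective, so equality of classes is an instance of the
  relation, which is a translated proposition. Equality of truth values is equivalence of their
  decodings, and on translated truth values these are stable. Reflection lets all of this be argued
  with judgemental equality, in an arbitrary context reached by a context morphism (\<open>stable_eq\<close>).

  Soundness and the invariant are then proved by one induction on derivations (\<open>N_sound\<close>). Two
  facts about the calculi themselves support it. Every derivable judgement has derivable
  presuppositions (\<open>presuppositions\<close>): congruence rules supply equations where the arguments
  about stability ask for typings. And judgemental equality of types is rigid: only \<open>P(1)\<close> is equal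
  to \<open>P(1)\<close> (\<open>P1_rigid\<close>), so that the case distinction in the translation of \<open>Eq\<close>, which is made on
  raw syntax, respects judgemental equality.
\<close>

section \<open>Substitution calculus\<close>

definition comp_sub :: "(nat \<Rightarrow> tm) \<Rightarrow> (nat \<Rightarrow> tm) \<Rightarrow> nat \<Rightarrow> tm" (infixr "\<odot>" 78) where
  "\<sigma> \<odot> \<tau> = (\<lambda>n. \<sigma> n \<star> \<tau>)"

lemma scons_0 [simp]: "(a \<cdot> \<sigma>) 0 = a" and scons_Suc [simp]: "(a \<cdot> \<sigma>) (Suc n) = \<sigma> n"
  by (simp_all add: scons_def)

lemma up_Var: "up (\<lambda>n. Var (r n)) = (\<lambda>n. Var (upr r n))"
  by (rule ext) (simp add: up_def scons_def upr_def split: nat.split)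

text \<open>
  Because \<open>up\<close> is defined through renaming, composition of substitutions is reached in stages:
  renamings are substitutions, then renaming followed by substitution (\<open>sub_ren\<close>), then substitution
  followed by renaming (\<open>ren_sub\<close>), and only then two substitutions (\<open>sub_sub\<close>).
\<close>
lemma ren_as_sub: "ren_ty r A = A \<bullet> (\<lambda>n. Var (r n))" "ren_tm r a = a \<star> (\<lambda>n. Var (r n))"
  by (induction A and a arbitrary: r and r) (simp_all add: up_Var)

lemma up_upr: "(\<lambda>n. up \<sigma> (upr r n)) = up (\<lambda>n. \<sigma> (r n))"
  by (rule ext) (simp add: up_def scons_def upr_def split: nat.split)

lemma sub_ren: "ren_ty r A \<bullet> \<sigma> = A \<bullet> (\<lambda>n. \<sigma> (r n))" "ren_tm r a \<star> \<sigma> = a \<star> (\<lambda>n. \<sigma> (r n))"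
  by (induction A and a arbitrary: r \<sigma> and r \<sigma>) (simp_all add: up_upr)

lemma ren_ren: "ren_ty s (ren_ty r A) = ren_ty (s \<circ> r) A" "ren_tm s (ren_tm r a) = ren_tm (s \<circ> r) a"
  by (simp_all only: ren_as_sub[of s] sub_ren) (simp_all add: ren_as_sub)

lemma ren_up: "(\<lambda>n. ren_tm (upr r) (up \<sigma> n)) = up (\<lambda>n. ren_tm r (\<sigma> n))"
  by (rule ext) (auto simp: up_def scons_def ren_ren upr_def comp_def split: nat.split)

lemma ren_sub: "ren_ty r (A \<bullet> \<sigma>) = A \<bullet> (\<lambda>n. ren_tm r (\<sigma> n))" "ren_tm r (a \<star> \<sigma>) = a \<star> (\<lambda>n. ren_tm r (\<sigma> n))"
  by (induction A and a arbitrary: r \<sigma> and r \<sigma>) (simp_all add: ren_up)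

lemma up_comp: "up \<sigma> \<odot> up \<tau> = up (\<sigma> \<odot> \<tau>)"
  by (rule ext)
    (auto simp: comp_sub_def up_def scons_def sub_ren ren_sub split: nat.split)

lemma sub_sub: "A \<bullet> \<sigma> \<bullet> \<tau> = A \<bullet> (\<sigma> \<odot> \<tau>)" "a \<star> \<sigma> \<star> \<tau> = a \<star> (\<sigma> \<odot> \<tau>)"
proof (induction A and a arbitrary: \<sigma> \<tau> and \<sigma> \<tau>)
  case (Var n)
  then show ?case by (simp add: comp_sub_def)
qed (simp_all add: up_comp)

lemma wk_0 [simp]: "wk 0 = Var"
  by (rule ext) (simp add: wk_def)

lemma up_Var_id: "up Var = Var"
  by (rule ext) (simp add: up_def scons_def split: nat.split)

lemma sub_id [simp]: "A \<bullet> Var = A" "a \<star> Var = a"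
  by (induction A and a) (simp_all add: up_Var_id)

lemma up_conv: "up \<sigma> = Var 0 \<cdot> (\<sigma> \<odot> wk (Suc 0))"
  by (simp add: up_def comp_sub_def ren_as_sub wk_def)

lemma comp_scons: "(a \<cdot> \<sigma>) \<odot> \<tau> = (a \<star> \<tau>) \<cdot> (\<sigma> \<odot> \<tau>)"
  by (rule ext) (simp add: comp_sub_def scons_def split: nat.split)

lemma comp_assoc: "(\<sigma> \<odot> \<tau>) \<odot> \<rho> = \<sigma> \<odot> (\<tau> \<odot> \<rho>)"
  by (rule ext) (simp add: comp_sub_def sub_sub)

lemma wk_scons: "wk (Suc k) \<odot> (a \<cdot> \<sigma>) = wk k \<odot> \<sigma>"
  by (rule ext) (simp add: comp_sub_def wk_def scons_def)

lemma comp_id: "Var \<odot> \<sigma> = \<sigma>" "\<sigma> \<odot> Var = \<sigma>"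
  by (simp_all add: comp_sub_def)

lemma wk_wk: "wk j \<odot> wk k = wk (j + k)" "wk j \<odot> (wk k \<odot> \<sigma>) = wk (j + k) \<odot> \<sigma>"
  by (simp_all add: comp_sub_def wk_def ac_simps)

lemma Var_wk: "Var k \<cdot> wk (Suc k) = wk k"
  by (rule ext) (simp add: wk_def scons_def split: nat.split)

lemma comp_app: "(\<sigma> \<odot> \<tau>) n = \<sigma> n \<star> \<tau>"
  by (simp add: comp_sub_def)

lemma wk_app: "wk k n = Var (n + k)"
  by (simp add: wk_def)

lemma defined_sub [simp]:
  "Neg \<phi> \<bullet> \<sigma> = Neg (\<phi> \<bullet> \<sigma>)" "Top \<bullet> \<sigma> = Top" "Iff \<phi> \<psi> \<bullet> \<sigma> = Iff (\<phi> \<bullet> \<sigma>) (\<psi> \<bullet> \<sigma>)"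
  "Dc U \<bullet> \<sigma> = Dc (U \<star> \<sigma>)" "Stab \<phi> \<bullet> \<sigma> = Stab (\<phi> \<bullet> \<sigma>)"
  by (simp_all add: Neg_def Top_def Iff_def Dc_def Stab_def)

text \<open>
  The rewrite rules of the sigma calculus. They bring a substitution to the normal form
  \<open>a\<^sub>1 \<cdot> \<dots> \<cdot> a\<^sub>n \<cdot> (wk k \<odot> \<sigma>)\<close>, which decides the equations between substituted expressions
  that arise from instantiating rules. Numerals are turned into successors so that \<open>wk_scons\<close> and
  \<open>Var_wk\<close> apply.
\<close>
lemmas sigma = sub_sub up_conv comp_scons comp_assoc wk_scons comp_id wk_wk Var_wk
  Var_wk[of 0, simplified] comp_app wk_app numeral_eq_Suc One_nat_def

inductive_cases ctx_ext_inv: "T \<turnstile> A # \<Gamma> ctx"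

text \<open>
  What follows holds for both calculi alike, so the calculus is fixed and left out of the
  notation; \<open>\<Gamma> \<tturnstile> \<phi>\<close> is the judgement that \<open>\<phi>\<close> is true.
\<close>
context
  fixes T :: calculus
begin

abbreviation (input) has_kind ("_ \<turnstile> _ type _" [51, 51, 51] 50) where
  "\<Gamma> \<turnstile> A type K \<equiv> T \<parallel> \<Gamma> \<turnstile> A type K"

abbreviation (input) has_type ("_ \<turnstile> _ \<Colon> _" [51, 51, 51] 50) where
  "\<Gamma> \<turnstile> a \<Colon> A \<equiv> T \<parallel> \<Gamma> \<turnstile> a \<Colon> A"

abbreviation (input) equal_ty ("_ \<turnstile> _ \<doteq> _ type _" [51, 51, 51, 51] 50) where
  "\<Gamma> \<turnstile> A \<doteq> B type K \<equiv> T \<parallel> \<Gamma> \<turnstile> A \<doteq> B type K"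

abbreviation (input) equal_tm ("_ \<turnstile> _ \<doteq> _ \<Colon> _" [51, 51, 51, 51] 50) where
  "\<Gamma> \<turnstile> a \<doteq> b \<Colon> A \<equiv> T \<parallel> \<Gamma> \<turnstile> a \<doteq> b \<Colon> A"

abbreviation (input) holds ("_ \<tturnstile> _" [51, 51] 50) where
  "\<Gamma> \<tturnstile> \<phi> \<equiv> T \<parallel> \<Gamma> \<turnstile> true \<Colon> \<phi>"

section \<open>Context morphisms\<close>

text \<open>
  The substitutions along which the four substitution rules operate. Hypothetical arguments are
  mostly carried out below at an arbitrary \<open>mor \<Theta> \<sigma> \<Gamma>\<close> instead of under explicit extra
  variables, which avoids computing with weakenings.
\<close>
definition mor :: "ty list \<Rightarrow> (nat \<Rightarrow> tm) \<Rightarrow> ty list \<Rightarrow> bool" where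
  "mor \<Gamma> \<sigma> \<Delta> \<longleftrightarrow> T \<turnstile> \<Gamma> ctx \<and> (\<forall>i<length \<Delta>. \<Gamma> \<turnstile> \<sigma> i \<Colon> (\<Delta> ! i) \<bullet> wk (Suc i) \<bullet> \<sigma>)"

lemma mor_ctx: "mor \<Gamma> \<sigma> \<Delta> \<Longrightarrow> T \<turnstile> \<Gamma> ctx"
  by (simp add: mor_def)

lemma mor_ty: "\<lbrakk>\<Delta> \<turnstile> A type K; mor \<Gamma> \<sigma> \<Delta>\<rbrakk> \<Longrightarrow> \<Gamma> \<turnstile> A \<bullet> \<sigma> type K"
  unfolding mor_def by (blast intro: sub_ty)

lemma mor_tm: "\<lbrakk>\<Delta> \<turnstile> a \<Colon> A; mor \<Gamma> \<sigma> \<Delta>\<rbrakk> \<Longrightarrow> \<Gamma> \<turnstile> a \<star> \<sigma> \<Colon> A \<bullet> \<sigma>"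
  unfolding mor_def by (blast intro: sub_tm)

lemma mor_eq_ty:  "\<lbrakk>\<Delta> \<turnstile> A \<doteq> B type K; mor \<Gamma> \<sigma> \<Delta>\<rbrakk> \<Longrightarrow> \<Gamma> \<turnstile> A \<bullet> \<sigma> \<doteq> B \<bullet> \<sigma> type K"
  unfolding mor_def by (blast intro: sub_eq_ty tm_refl)

lemma mor_eq_tm: "\<lbrakk>\<Delta> \<turnstile> a \<doteq> b \<Colon> A; mor \<Gamma> \<sigma> \<Delta>\<rbrakk> \<Longrightarrow> \<Gamma> \<turnstile> a \<star> \<sigma> \<doteq> b \<star> \<sigma> \<Colon> A \<bullet> \<sigma>"
  unfolding mor_def by (blast intro: sub_eq_tm tm_refl)

lemma mor_wk:
  assumes "T \<turnstile> \<Theta> @ \<Gamma> ctx"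
  shows "mor (\<Theta> @ \<Gamma>) (wk (length \<Theta>)) \<Gamma>"
  unfolding mor_def
proof (intro conjI allI impI)
  fix i assume "i < length \<Gamma>"
  then have "\<Theta> @ \<Gamma> \<turnstile> Var (length \<Theta> + i) \<Colon> (\<Theta> @ \<Gamma>) ! (length \<Theta> + i) \<bullet> wk (Suc (length \<Theta> + i))"
    by (intro var assms) simp
  then show "\<Theta> @ \<Gamma> \<turnstile> wk (length \<Theta>) i \<Colon> \<Gamma> ! i \<bullet> wk (Suc i) \<bullet> wk (length \<Theta>)"
    by (simp add: sigma nth_append ac_simps)
qed (rule assms)

lemma mor_wk1: "T \<turnstile> A # \<Gamma> ctx \<Longrightarrow> mor (A # \<Gamma>) (wk 1) \<Gamma>"
  using mor_wk[of "[A]" \<Gamma>] by simp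

lemma mor_wk2: "T \<turnstile> B # A # \<Gamma> ctx \<Longrightarrow> mor (B # A # \<Gamma>) (wk 2) \<Gamma>"
  using mor_wk[of "[B, A]" \<Gamma>] by (simp add: numeral_2_eq_2)

lemma mor_wk3: "T \<turnstile> C # B # A # \<Gamma> ctx \<Longrightarrow> mor (C # B # A # \<Gamma>) (wk 3) \<Gamma>"
  using mor_wk[of "[C, B, A]" \<Gamma>] by (simp add: numeral_3_eq_3)

lemma mor_id: "T \<turnstile> \<Gamma> ctx \<Longrightarrow> mor \<Gamma> Var \<Gamma>"
  using mor_wk[of "[]" \<Gamma>] by simp

lemma mor_scons:
  assumes "mor \<Gamma> \<sigma> \<Delta>" "\<Gamma> \<turnstile> a \<Colon> A \<bullet> \<sigma>"
  shows "mor \<Gamma> (a \<cdot> \<sigma>) (A # \<Delta>)"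
  unfolding mor_def
proof (intro conjI allI impI)
  show "T \<turnstile> \<Gamma> ctx" using assms(1) by (rule mor_ctx)
  fix i assume "i < length (A # \<Delta>)"
  then show "\<Gamma> \<turnstile> (a \<cdot> \<sigma>) i \<Colon> (A # \<Delta>) ! i \<bullet> wk (Suc i) \<bullet> (a \<cdot> \<sigma>)"
    using assms by (cases i) (simp_all add: sigma mor_def)
qed

lemma mor_comp:
  assumes "mor \<Gamma> \<sigma> \<Delta>" "mor \<Theta> \<tau> \<Gamma>"
  shows "mor \<Theta> (\<sigma> \<odot> \<tau>) \<Delta>"
  using assms mor_tm[OF _ assms(2)] unfolding mor_def by (fastforce simp: sigma)

lemma var0: "T \<turnstile> A # \<Gamma> ctx \<Longrightarrow> A # \<Gamma> \<turnstile> Var 0 \<Colon> A \<bullet> wk 1"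
  using var[of T "A # \<Gamma>" 0] by simp

lemma mor_up:
  assumes "mor \<Gamma> \<sigma> \<Delta>" "\<Gamma> \<turnstile> A \<bullet> \<sigma> type Col"
  shows "mor (A \<bullet> \<sigma> # \<Gamma>) (up \<sigma>) (A # \<Delta>)"
proof -
  have c: "T \<turnstile> A \<bullet> \<sigma> # \<Gamma> ctx" by (rule ctx_ext) fact
  from mor_scons[OF mor_comp[OF assms(1) mor_wk1[OF c]], of "Var 0" A] var0[OF c]
  show ?thesis by (simp add: sigma)
qed

lemma mor_inst: "\<lbrakk>T \<turnstile> \<Gamma> ctx; \<Gamma> \<turnstile> a \<Colon> A\<rbrakk> \<Longrightarrow> mor \<Gamma> (a \<cdot> Var) (A # \<Gamma>)"
  by (rule mor_scons) (auto intro: mor_id)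

text \<open>
  The simplifier would turn the indices \<open>1\<close> into \<open>Suc 0\<close>, and the rules would no longer match.
\<close>
declare One_nat_def [simp del]

section \<open>Weakening, instantiation and context conversion\<close>

lemma ctx_of:
  "T \<turnstile> \<Gamma> ctx \<Longrightarrow> True"
  "\<Gamma> \<turnstile> A type K \<Longrightarrow> T \<turnstile> \<Gamma> ctx"
  "\<Gamma> \<turnstile> a \<Colon> A \<Longrightarrow> T \<turnstile> \<Gamma> ctx"
  "\<Gamma> \<turnstile> A \<doteq> B type K \<Longrightarrow> T \<turnstile> \<Gamma> ctx"
  "\<Gamma> \<turnstile> a \<doteq> b \<Colon> A \<Longrightarrow> T \<turnstile> \<Gamma> ctx"
  by (induction rule: ctx_ok_is_ty_is_tm_eq_ty_eq_tm.inducts) simp_all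


lemma ctx_head: "T \<turnstile> A # \<Gamma> ctx \<Longrightarrow> \<Gamma> \<turnstile> A type Col"
  by (erule ctx_ext_inv)

lemma ctx_tail: "T \<turnstile> A # \<Gamma> ctx \<Longrightarrow> T \<turnstile> \<Gamma> ctx"
  by (blast dest: ctx_head ctx_of(2))

lemma ctx_drop: "T \<turnstile> \<Gamma> ctx \<Longrightarrow> T \<turnstile> drop n \<Gamma> ctx"
proof (induction n arbitrary: \<Gamma>)
  case (Suc n)
  then show ?case by (cases \<Gamma>) (auto dest: ctx_tail)
qed simp

lemma ctx_nth:
  assumes "T \<turnstile> \<Gamma> ctx" "i < length \<Gamma>"
  shows "\<Gamma> \<turnstile> \<Gamma> ! i \<bullet> wk (Suc i) type Col"
proof -
  have "\<Gamma> ! i # drop (Suc i) \<Gamma> = drop i \<Gamma>" using assms(2) by (rule Cons_nth_drop_Suc)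
  then have "drop (Suc i) \<Gamma> \<turnstile> \<Gamma> ! i type Col"
    using ctx_drop[OF assms(1), of i] by (metis ctx_head)
  moreover have "mor (take (Suc i) \<Gamma> @ drop (Suc i) \<Gamma>) (wk (length (take (Suc i) \<Gamma>))) (drop (Suc i) \<Gamma>)"
    by (rule mor_wk) (simp add: assms)
  ultimately show ?thesis
    using mor_ty[of "drop (Suc i) \<Gamma>"] assms(2) by simp
qed

lemma ty_Col: "\<Gamma> \<turnstile> A type K \<Longrightarrow> \<Gamma> \<turnstile> A type Col"
  by (cases K) (auto intro: incl_ty incl.intros)

lemma eq_ty_Col: "\<Gamma> \<turnstile> A \<doteq> B type K \<Longrightarrow> \<Gamma> \<turnstile> A \<doteq> B type Col"
  by (cases K) (auto intro: incl_eq_ty incl.intros)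

lemma ctx_cons: "\<Gamma> \<turnstile> A type K \<Longrightarrow> T \<turnstile> A # \<Gamma> ctx"
  by (rule ctx_ext, erule ty_Col)

lemma wk1_ty: "\<lbrakk>\<Gamma> \<turnstile> A type K; \<Gamma> \<turnstile> B type K'\<rbrakk> \<Longrightarrow> B # \<Gamma> \<turnstile> A \<bullet> wk 1 type K"
  by (blast intro: mor_ty mor_wk1 ctx_cons)

lemma wk1_tm: "\<lbrakk>\<Gamma> \<turnstile> a \<Colon> A; \<Gamma> \<turnstile> B type K'\<rbrakk> \<Longrightarrow> B # \<Gamma> \<turnstile> a \<star> wk 1 \<Colon> A \<bullet> wk 1"
  by (blast intro: mor_tm mor_wk1 ctx_cons)

lemma hyp0: "\<Gamma> \<turnstile> A type K \<Longrightarrow> A # \<Gamma> \<turnstile> Var 0 \<Colon> A \<bullet> wk 1"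
  by (blast intro: var0 ctx_cons)

lemma inst_ty: "\<lbrakk>A # \<Gamma> \<turnstile> B type K; \<Gamma> \<turnstile> a \<Colon> A\<rbrakk> \<Longrightarrow> \<Gamma> \<turnstile> B \<bullet> (a \<cdot> Var) type K"
  by (rule mor_ty[OF _ mor_inst[OF ctx_of(3)]])

lemma inst_tm: "\<lbrakk>A # \<Gamma> \<turnstile> b \<Colon> B; \<Gamma> \<turnstile> a \<Colon> A\<rbrakk> \<Longrightarrow> \<Gamma> \<turnstile> b \<star> (a \<cdot> Var) \<Colon> B \<bullet> (a \<cdot> Var)"
  by (rule mor_tm[OF _ mor_inst[OF ctx_of(3)]])

text \<open>
  The rule \<open>sub_eq_ty\<close> for two morphisms that differ only in the most recent variable. This is how
  a type depending on a term follows a change of that term.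
\<close>
lemma inst_eq_ty:
  assumes "D # \<Gamma> \<turnstile> L \<doteq> L' type K" "mor \<Theta> \<sigma> \<Gamma>"
    "\<Theta> \<turnstile> t \<doteq> t' \<Colon> D \<bullet> \<sigma>" "\<Theta> \<turnstile> t \<Colon> D \<bullet> \<sigma>" "\<Theta> \<turnstile> t' \<Colon> D \<bullet> \<sigma>"
  shows "\<Theta> \<turnstile> L \<bullet> (t \<cdot> \<sigma>) \<doteq> L' \<bullet> (t' \<cdot> \<sigma>) type K"
proof (rule sub_eq_ty[OF assms(1)])
  show "T \<turnstile> \<Theta> ctx" using assms(2) by (rule mor_ctx)
  show "\<forall>i<length (D # \<Gamma>). \<Theta> \<turnstile> (t \<cdot> \<sigma>) i \<Colon> (D # \<Gamma>) ! i \<bullet> wk (Suc i) \<bullet> (t \<cdot> \<sigma>)"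
    using mor_scons[OF assms(2,4)] unfolding mor_def by (rule conjunct2)
  show "\<forall>i<length (D # \<Gamma>). \<Theta> \<turnstile> (t' \<cdot> \<sigma>) i \<Colon> (D # \<Gamma>) ! i \<bullet> wk (Suc i) \<bullet> (t' \<cdot> \<sigma>)"
    using mor_scons[OF assms(2,5)] unfolding mor_def by (rule conjunct2)
  show "\<forall>i<length (D # \<Gamma>). \<Theta> \<turnstile> (t \<cdot> \<sigma>) i \<doteq> (t' \<cdot> \<sigma>) i \<Colon> (D # \<Gamma>) ! i \<bullet> wk (Suc i) \<bullet> (t \<cdot> \<sigma>)"
  proof (intro allI impI)
    fix i assume "i < length (D # \<Gamma>)"
    then show "\<Theta> \<turnstile> (t \<cdot> \<sigma>) i \<doteq> (t' \<cdot> \<sigma>) i \<Colon> (D # \<Gamma>) ! i \<bullet> wk (Suc i) \<bullet> (t \<cdot> \<sigma>)"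
      using assms(2,3) by (cases i) (auto simp: sigma mor_def intro: tm_refl)
  qed
qed

lemma inst_eq_ty_Var:
  assumes "D # \<Gamma> \<turnstile> L \<doteq> L' type K"
    "\<Gamma> \<turnstile> t \<doteq> t' \<Colon> D" "\<Gamma> \<turnstile> t \<Colon> D" "\<Gamma> \<turnstile> t' \<Colon> D"
  shows "\<Gamma> \<turnstile> L \<bullet> (t \<cdot> Var) \<doteq> L' \<bullet> (t' \<cdot> Var) type K"
  using inst_eq_ty[OF assms(1) mor_id[OF ctx_of(3)[OF assms(3)]]] assms by simp

text \<open>
  Conversion of the types in a context is substitution along the identity: by the conversion rule
  the variables of the converted context inhabit the original types.
\<close>
lemma ctx_conv:
  assumes "mor \<Gamma>' Var \<Gamma>" "\<Gamma> \<turnstile> A \<doteq> A' type K" "\<Gamma> \<turnstile> A type K" "\<Gamma> \<turnstile> A' type K"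
  shows "mor (A' # \<Gamma>') Var (A # \<Gamma>)"
proof -
  have c: "T \<turnstile> A' # \<Gamma>' ctx" using mor_ty[OF assms(4,1)] by (auto intro: ctx_cons)
  have m: "mor (A' # \<Gamma>') (wk 1) \<Gamma>"
    using mor_comp[OF assms(1) mor_wk1[OF c]] by (simp add: sigma)
  have "A' # \<Gamma>' \<turnstile> Var 0 \<Colon> A \<bullet> wk 1"
    using conv[OF var0[OF c]] mor_eq_ty[OF ty_sym[OF eq_ty_Col[OF assms(2)]] m] by blast
  from mor_scons[OF m this] show ?thesis by (simp add: sigma)
qed

lemma ctx_conv1:
  assumes "\<Gamma> \<turnstile> A \<doteq> A' type K" "\<Gamma> \<turnstile> A type K" "\<Gamma> \<turnstile> A' type K"
  shows "mor (A' # \<Gamma>) Var (A # \<Gamma>)"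
  using assms ctx_conv mor_id ctx_of(2) by blast

lemma mor_Var_ty: "\<lbrakk>mor \<Gamma>' Var \<Gamma>; \<Gamma> \<turnstile> A type K\<rbrakk> \<Longrightarrow> \<Gamma>' \<turnstile> A type K"
  and mor_Var_tm: "\<lbrakk>mor \<Gamma>' Var \<Gamma>; \<Gamma> \<turnstile> a \<Colon> A\<rbrakk> \<Longrightarrow> \<Gamma>' \<turnstile> a \<Colon> A"
  and mor_Var_eq_tm: "\<lbrakk>mor \<Gamma>' Var \<Gamma>; \<Gamma> \<turnstile> a \<doteq> b \<Colon> A\<rbrakk> \<Longrightarrow> \<Gamma>' \<turnstile> a \<doteq> b \<Colon> A"
  using mor_ty[of \<Gamma> A K \<Gamma>' Var] mor_tm[of \<Gamma> a A \<Gamma>' Var]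
    mor_eq_tm[of \<Gamma> a b A \<Gamma>' Var] by simp_all

lemma mor_up2:
  assumes m: "mor \<Theta> \<sigma> \<Gamma>" and A: "\<Gamma> \<turnstile> A type K"
  shows "mor (A \<bullet> \<sigma> \<bullet> wk 1 # A \<bullet> \<sigma> # \<Theta>) (up (up \<sigma>)) (A \<bullet> wk 1 # A # \<Gamma>)"
proof -
  have a: "\<Theta> \<turnstile> A \<bullet> \<sigma> type Col" using mor_ty[OF A m] by (rule ty_Col)
  have e: "A \<bullet> wk 1 \<bullet> up \<sigma> = A \<bullet> \<sigma> \<bullet> wk 1" by (simp add: sigma)
  show ?thesis using mor_up[OF mor_up[OF m a], of "A \<bullet> wk 1", unfolded e, OF wk1_ty[OF a a]] .
qed

text \<open>
  Effectivity of quotients concludes that an instance of \<open>R\<close> is true knowing only that \<open>Quot A R\<close>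
  is a set, so its presupposition is read off the derivation of the latter. Substitution keeps the
  head constructor, hence the only nontrivial case is a substitution instance of another quotient.
\<close>
lemma Quot_inv:
  "T \<turnstile> \<Gamma> ctx \<Longrightarrow> True"
  "\<Gamma> \<turnstile> Q type K \<Longrightarrow> (\<And>A R. Q = Quot A R \<Longrightarrow> \<Gamma> \<turnstile> A type Set \<and> A \<bullet> wk 1 # A # \<Gamma> \<turnstile> R type PropS)"
  "\<Gamma> \<turnstile> a \<Colon> A \<Longrightarrow> True"
  "\<Gamma> \<turnstile> A \<doteq> B type K \<Longrightarrow> True"
  "\<Gamma> \<turnstile> a \<doteq> b \<Colon> A \<Longrightarrow> True"
proof (induction rule: ctx_ok_is_ty_is_tm_eq_ty_eq_tm.inducts)
  case (sub_ty \<Delta> Q K \<Gamma> \<sigma> A' R')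
  then obtain A R where Q: "Q = Quot A R" and [simp]: "A' = A \<bullet> \<sigma>" "R' = R \<bullet> up (up \<sigma>)"
    by (cases Q) auto
  have m: "mor \<Gamma> \<sigma> \<Delta>" using sub_ty by (simp add: mor_def)
  from sub_ty(2)[OF Q] have A: "\<Delta> \<turnstile> A type Set" and R: "A \<bullet> wk 1 # A # \<Delta> \<turnstile> R type PropS" by auto
  have A': "\<Gamma> \<turnstile> A \<bullet> \<sigma> type Set" using A m by (rule mor_ty)
  from A' mor_ty[OF R mor_up2[OF m A]] show ?case by simp
qed simp_all

section \<open>Right-hand sides of congruence rules\<close>

text \<open>
  The right-hand side of a congruence rule is annotated with the primed types, and its branches
  have to be typed in contexts and at motive instances formed from these. The lemmas \<open>right_\<dots>\<close>
  move the branches there by conversion of contexts and types, apply the introduction or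
  elimination rule, and convert the resulting type back.
\<close>

lemma right_ElN1:
  assumes "N1 # \<Gamma> \<turnstile> L \<doteq> L' type Col" "N1 # \<Gamma> \<turnstile> L' type Col"
    "\<Gamma> \<turnstile> c \<doteq> c' \<Colon> N1" "\<Gamma> \<turnstile> c \<Colon> N1" "\<Gamma> \<turnstile> c' \<Colon> N1"
    "\<Gamma> \<turnstile> a' \<Colon> L \<bullet> (Star \<cdot> Var)"
  shows "\<Gamma> \<turnstile> ElN1 L' c' a' \<Colon> L \<bullet> (c \<cdot> Var)"
proof -
  have s: "\<Gamma> \<turnstile> Star \<Colon> N1" using assms(3) by (intro I_N1 ctx_of)
  have "\<Gamma> \<turnstile> a' \<Colon> L' \<bullet> (Star \<cdot> Var)"
    using conv[OF assms(6) inst_eq_ty_Var[OF assms(1) tm_refl[OF s] s s]] .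
  from conv[OF E_N1[OF assms(2,5) this] ty_sym[OF inst_eq_ty_Var[OF assms(1,3,4,5)]]] show ?thesis .
qed

lemma wk_ctx1: "\<Gamma> \<turnstile> A type K \<Longrightarrow> mor (A # \<Gamma>) (wk 1) \<Gamma>"
  by (blast intro: mor_wk1 ctx_cons)

lemma wk_ctx2: "A # \<Gamma> \<turnstile> B type K \<Longrightarrow> mor (B # A # \<Gamma>) (wk 2) \<Gamma>"
  by (blast intro: mor_wk2 ctx_cons)

lemma wk_ctx3: "B # A # \<Gamma> \<turnstile> C type K \<Longrightarrow> mor (C # B # A # \<Gamma>) (wk 3) \<Gamma>"
  by (blast intro: mor_wk3 ctx_cons)

lemma list_ctx:
  assumes "\<Gamma> \<turnstile> A type Set" "List A # \<Gamma> \<turnstile> L type Col"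
  shows "A \<bullet> wk 1 # List A # \<Gamma> \<turnstile> L \<bullet> (Var 1 \<cdot> wk 2) type Col"
    "List A # \<Gamma> \<turnstile> A \<bullet> wk 1 type Set"
    "mor (L \<bullet> (Var 1 \<cdot> wk 2) # A \<bullet> wk 1 # List A # \<Gamma>) (wk 3) \<Gamma>"
    "L \<bullet> (Var 1 \<cdot> wk 2) # A \<bullet> wk 1 # List A # \<Gamma> \<turnstile> Var 2 \<Colon> List (A \<bullet> wk 3)"
    "L \<bullet> (Var 1 \<cdot> wk 2) # A \<bullet> wk 1 # List A # \<Gamma> \<turnstile> Var 1 \<Colon> A \<bullet> wk 3"
proof -
  let ?\<Delta> = "L \<bullet> (Var 1 \<cdot> wk 2) # A \<bullet> wk 1 # List A # \<Gamma>"
  have l: "\<Gamma> \<turnstile> List A type Set" using assms(1) by (rule F_List)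
  show a: "List A # \<Gamma> \<turnstile> A \<bullet> wk 1 type Set" by (rule wk1_ty[OF assms(1) l])
  have m: "mor (A \<bullet> wk 1 # List A # \<Gamma>) (wk 2) \<Gamma>" by (rule wk_ctx2[OF a])
  have "A \<bullet> wk 1 # List A # \<Gamma> \<turnstile> Var 1 \<Colon> List A \<bullet> wk 2"
    using wk1_tm[OF hyp0[OF l] a] by (simp add: sigma)
  then show p: "A \<bullet> wk 1 # List A # \<Gamma> \<turnstile> L \<bullet> (Var 1 \<cdot> wk 2) type Col"
    by (intro mor_ty[OF assms(2)] mor_scons m)
  show "mor ?\<Delta> (wk 3) \<Gamma>" by (rule wk_ctx3[OF p])
  note c = ctx_cons[OF p]
  show "?\<Delta> \<turnstile> Var 2 \<Colon> List (A \<bullet> wk 3)"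
    "?\<Delta> \<turnstile> Var 1 \<Colon> A \<bullet> wk 3"
    using var[OF c, of 2] var[OF c, of 1] by (simp_all add: sigma)
qed

lemma right_ElList:
  assumes A: "\<Gamma> \<turnstile> A \<doteq> A' type Set" "\<Gamma> \<turnstile> A type Set" "\<Gamma> \<turnstile> A' type Set"
    and L: "List A # \<Gamma> \<turnstile> L \<doteq> L' type Col" "List A # \<Gamma> \<turnstile> L type Col" "List A # \<Gamma> \<turnstile> L' type Col"
    and c: "\<Gamma> \<turnstile> c \<doteq> c' \<Colon> List A" "\<Gamma> \<turnstile> c \<Colon> List A" "\<Gamma> \<turnstile> c' \<Colon> List A"
    and a: "\<Gamma> \<turnstile> a' \<Colon> L \<bullet> (Nil A \<cdot> Var)"
    and m: "L \<bullet> (Var 1 \<cdot> wk 2) # A \<bullet> wk 1 # List A # \<Gamma> \<turnstile> m' \<Colon> L \<bullet> (Cons (A \<bullet> wk 3) (Var 2) (Var 1) \<cdot> wk 3)"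
  shows "\<Gamma> \<turnstile> ElList A' L' c' a' m' \<Colon> L \<bullet> (c \<cdot> Var)"
proof -
  let ?\<Delta> = "L \<bullet> (Var 1 \<cdot> wk 2) # A \<bullet> wk 1 # List A # \<Gamma>"
  let ?c = "Cons (A \<bullet> wk 3) (Var 2) (Var 1)"
  let ?c' = "Cons (A' \<bullet> wk 3) (Var 2) (Var 1)"
  note ll = C_List[OF A(1)] F_List[OF A(2)] F_List[OF A(3)]
  note lc = list_ctx[OF A(2) L(2)]
  have x: "?\<Delta> \<turnstile> ?c \<doteq> ?c' \<Colon> List A \<bullet> wk 3"
    "?\<Delta> \<turnstile> ?c  \<Colon> List A \<bullet> wk 3"
    using lc mor_ty[OF A(2) lc(3)] mor_eq_ty[OF A(1) lc(3)] by (auto intro!: C_Cons I_Cons tm_refl)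
  have y: "?\<Delta> \<turnstile> ?c'  \<Colon> List A \<bullet> wk 3"
    unfolding sub_ty.simps
    using lc mor_ty[OF A(3) lc(3)] eq_ty_Col[OF mor_eq_ty[OF A(1) lc(3)]] eq_ty_Col[OF mor_eq_ty[OF ll(1) lc(3)]]
    by (auto intro!: I_Cons intro: conv ty_sym)
  note m1 = ctx_conv1[OF ll]
  note m2 = ctx_conv[OF m1 mor_eq_ty[OF A(1) wk_ctx1[OF ll(2)]] mor_ty[OF A(2) wk_ctx1[OF ll(2)]] mor_ty[OF A(3) wk_ctx1[OF ll(2)]]]
  have v: "A \<bullet> wk 1 # List A # \<Gamma> \<turnstile> Var 1 \<Colon> List A \<bullet> wk 2"
    using wk1_tm[OF hyp0[OF ll(2)] lc(2)] by (simp add: sigma)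
  note m3 = ctx_conv[OF m2 inst_eq_ty[OF L(1) wk_ctx2[OF lc(2)] tm_refl[OF v] v v] lc(1)
    mor_ty[OF L(3) mor_scons[OF wk_ctx2[OF lc(2)] v]]]
  have m': "L' \<bullet> (Var 1 \<cdot> wk 2) # A' \<bullet> wk 1 # List A' # \<Gamma> \<turnstile> m' \<Colon> L' \<bullet> (?c' \<cdot> wk 3)"
    by (rule mor_Var_tm[OF m3 conv[OF m inst_eq_ty[OF L(1) lc(3) x y]]])
  have n: "\<Gamma> \<turnstile> Nil A' \<Colon> List A" by (rule conv[OF I_Nil[OF A(3)] ty_sym[OF eq_ty_Col[OF ll(1)]]])
  have "\<Gamma> \<turnstile> ElList A' L' c' a' m' \<Colon> L' \<bullet> (c' \<cdot> Var)"
    by (rule E_List[OF A(3) mor_Var_ty[OF m1 L(3)] conv[OF c(3) eq_ty_Col[OF ll(1)]]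
        conv[OF a inst_eq_ty_Var[OF L(1) C_Nil[OF A(1)] I_Nil[OF A(2)] n]] m'])
  then show ?thesis by (rule conv[OF _ ty_sym[OF inst_eq_ty_Var[OF L(1) c]]])
qed

lemma right_Inl:
  assumes A: "\<Gamma> \<turnstile> A \<doteq> A' type Set" "\<Gamma> \<turnstile> A' type Set"
    and B: "\<Gamma> \<turnstile> B \<doteq> B' type Set" "\<Gamma> \<turnstile> B' type Set"
    and a: "\<Gamma> \<turnstile> a \<Colon> A"
  shows "\<Gamma> \<turnstile> Inl A' B' a \<Colon> Sum A B"
  by (rule conv[OF I_Inl[OF A(2) B(2) conv[OF a eq_ty_Col[OF A(1)]]] ty_sym[OF eq_ty_Col[OF C_Sum[OF A(1) B(1)]]]])

lemma right_Inr:
  assumes A: "\<Gamma> \<turnstile> A \<doteq> A' type Set" "\<Gamma> \<turnstile> A' type Set"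
    and B: "\<Gamma> \<turnstile> B \<doteq> B' type Set" "\<Gamma> \<turnstile> B' type Set"
    and b: "\<Gamma> \<turnstile> b \<Colon> B"
  shows "\<Gamma> \<turnstile> Inr A' B' b \<Colon> Sum A B"
  by (rule conv[OF I_Inr[OF A(2) B(2) conv[OF b eq_ty_Col[OF B(1)]]] ty_sym[OF eq_ty_Col[OF C_Sum[OF A(1) B(1)]]]])

lemma right_ElSum:
  assumes A: "\<Gamma> \<turnstile> A \<doteq> A' type Set" "\<Gamma> \<turnstile> A type Set" "\<Gamma> \<turnstile> A' type Set"
    and B: "\<Gamma> \<turnstile> B \<doteq> B' type Set" "\<Gamma> \<turnstile> B type Set" "\<Gamma> \<turnstile> B' type Set"
    and L: "Sum A B # \<Gamma> \<turnstile> L \<doteq> L' type Col" "Sum A B # \<Gamma> \<turnstile> L' type Col"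
    and c: "\<Gamma> \<turnstile> c \<doteq> c' \<Colon> Sum A B" "\<Gamma> \<turnstile> c \<Colon> Sum A B" "\<Gamma> \<turnstile> c' \<Colon> Sum A B"
    and m: "A # \<Gamma> \<turnstile> m' \<Colon> L \<bullet> (Inl (A \<bullet> wk 1) (B \<bullet> wk 1) (Var 0) \<cdot> wk 1)"
    and n: "B # \<Gamma> \<turnstile> n' \<Colon> L \<bullet> (Inr (A \<bullet> wk 1) (B \<bullet> wk 1) (Var 0) \<cdot> wk 1)"
  shows "\<Gamma> \<turnstile> ElSum A' B' L' c' m' n' \<Colon> L \<bullet> (c \<cdot> Var)"
proof -
  let ?l = "Inl (A \<bullet> wk 1) (B \<bullet> wk 1) (Var 0)"
  let ?l' = "Inl (A' \<bullet> wk 1) (B' \<bullet> wk 1) (Var 0)"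
  let ?r = "Inr (A \<bullet> wk 1) (B \<bullet> wk 1) (Var 0)"
  let ?r' = "Inr (A' \<bullet> wk 1) (B' \<bullet> wk 1) (Var 0)"
  note ss = C_Sum[OF A(1) B(1)] F_Sum[OF A(2) B(2)] F_Sum[OF A(3) B(3)]
  have 1: "A # \<Gamma> \<turnstile> ?l \<doteq> ?l' \<Colon> Sum A B \<bullet> wk 1"
    "A # \<Gamma> \<turnstile> ?l \<Colon> Sum A B \<bullet> wk 1"
    "A # \<Gamma> \<turnstile> ?l' \<Colon> Sum A B \<bullet> wk 1"
    unfolding sub_ty.simps
    by (intro C_Inl I_Inl right_Inl tm_refl hyp0[OF A(2)] mor_ty[OF _ wk_ctx1[OF A(2)]] mor_eq_ty[OF _ wk_ctx1[OF A(2)]] A B)+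
  have 2: "B # \<Gamma> \<turnstile> ?r \<doteq> ?r' \<Colon> Sum A B \<bullet> wk 1"
    "B # \<Gamma> \<turnstile> ?r \<Colon> Sum A B \<bullet> wk 1"
    "B # \<Gamma> \<turnstile> ?r' \<Colon> Sum A B \<bullet> wk 1"
    unfolding sub_ty.simps
    by (intro C_Inr I_Inr right_Inr tm_refl hyp0[OF B(2)] mor_ty[OF _ wk_ctx1[OF B(2)]] mor_eq_ty[OF _ wk_ctx1[OF B(2)]] A B)+
  have "\<Gamma> \<turnstile> ElSum A' B' L' c' m' n' \<Colon> L' \<bullet> (c' \<cdot> Var)"
    by (rule E_Sum[OF A(3) B(3) mor_Var_ty[OF ctx_conv1[OF ss] L(2)] conv[OF c(3) eq_ty_Col[OF ss(1)]]
       mor_Var_tm[OF ctx_conv1[OF A] conv[OF m inst_eq_ty[OF L(1) wk_ctx1[OF A(2)] 1]]]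
       mor_Var_tm[OF ctx_conv1[OF B] conv[OF n inst_eq_ty[OF L(1) wk_ctx1[OF B(2)] 2]]]])
  then show ?thesis by (rule conv[OF _ ty_sym[OF inst_eq_ty_Var[OF L(1) c]]])
qed

lemma right_Pair:
  assumes A: "\<Gamma> \<turnstile> A \<doteq> A' type Col" "\<Gamma> \<turnstile> A type Col" "\<Gamma> \<turnstile> A' type Col"
    and B: "A # \<Gamma> \<turnstile> B \<doteq> B' type Col" "A # \<Gamma> \<turnstile> B' type Col"
    and a: "\<Gamma> \<turnstile> a \<doteq> a' \<Colon> A" "\<Gamma> \<turnstile> a \<Colon> A" "\<Gamma> \<turnstile> a' \<Colon> A"
    and b: "\<Gamma> \<turnstile> b' \<Colon> B \<bullet> (a \<cdot> Var)"
  shows "\<Gamma> \<turnstile> Pair A' B' a' b' \<Colon> Sig A B"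
  by (rule conv[OF I_Sig[OF A(3) mor_Var_ty[OF ctx_conv1[OF A] B(2)] conv[OF a(3) A(1)]
    conv[OF b inst_eq_ty_Var[OF B(1) a]]] ty_sym[OF C_Sig[OF _ A(1) B(1)]]]) simp

lemma sig_ctx:
  assumes "\<Gamma> \<turnstile> A type Col" "A # \<Gamma> \<turnstile> B type Col"
  shows "mor (B # A # \<Gamma>) (wk 2) \<Gamma>" "mor (A \<bullet> wk 2 # B # A # \<Gamma>) (up (wk 2)) (A # \<Gamma>)"
   "B # A # \<Gamma> \<turnstile> Var 1 \<Colon> A \<bullet> wk 2" "B # A # \<Gamma> \<turnstile> Var 0 \<Colon> B \<bullet> up (wk 2) \<bullet> (Var 1 \<cdot> Var)"
proof -
  note c = ctx_cons[OF assms(2)]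
  show m: "mor (B # A # \<Gamma>) (wk 2) \<Gamma>" by (rule wk_ctx2[OF assms(2)])
  show "mor (A \<bullet> wk 2 # B # A # \<Gamma>) (up (wk 2)) (A # \<Gamma>)" by (rule mor_up[OF m mor_ty[OF assms(1) m]])
  show "B # A # \<Gamma> \<turnstile> Var 1 \<Colon> A \<bullet> wk 2" using var[OF c, of 1] by (simp add: sigma)
  show "B # A # \<Gamma> \<turnstile> Var 0 \<Colon> B \<bullet> up (wk 2) \<bullet> (Var 1 \<cdot> Var)" using var0[OF c] by (simp add: sigma)
qed

lemma right_ElSig:
  assumes A: "\<Gamma> \<turnstile> A \<doteq> A' type Col" "\<Gamma> \<turnstile> A type Col" "\<Gamma> \<turnstile> A' type Col"
    and B: "A # \<Gamma> \<turnstile> B \<doteq> B' type Col" "A # \<Gamma> \<turnstile> B type Col" "A # \<Gamma> \<turnstile> B' type Col"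
    and L: "Sig A B # \<Gamma> \<turnstile> L \<doteq> L' type Col" "Sig A B # \<Gamma> \<turnstile> L' type Col"
    and d: "\<Gamma> \<turnstile> d \<doteq> d' \<Colon> Sig A B" "\<Gamma> \<turnstile> d \<Colon> Sig A B" "\<Gamma> \<turnstile> d' \<Colon> Sig A B"
    and m: "B # A # \<Gamma> \<turnstile> m' \<Colon> L \<bullet> (Pair (A \<bullet> wk 2) (B \<bullet> up (wk 2)) (Var 1) (Var 0) \<cdot> wk 2)"
  shows "\<Gamma> \<turnstile> ElSig A' B' L' d' m' \<Colon> L \<bullet> (d \<cdot> Var)"
proof -
  let ?p = "Pair (A \<bullet> wk 2) (B \<bullet> up (wk 2)) (Var 1) (Var 0)"
  let ?p' = "Pair (A' \<bullet> wk 2) (B' \<bullet> up (wk 2)) (Var 1) (Var 0)"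
  have k: "Col \<in> {Set, Col}" by simp
  have ss: "\<Gamma> \<turnstile> Sig A B \<doteq> Sig A' B' type Col" "\<Gamma> \<turnstile> Sig A B type Col" "\<Gamma> \<turnstile> Sig A' B' type Col"
    using C_Sig[OF k A(1) B(1)] F_Sig[OF k A(2) B(2)] F_Sig[OF k A(3) mor_Var_ty[OF ctx_conv1[OF A] B(3)]] .
  note sc = sig_ctx[OF A(2) B(2)]
  have 1: "B # A # \<Gamma> \<turnstile> ?p \<doteq> ?p' \<Colon> Sig A B \<bullet> wk 2"
    "B # A # \<Gamma> \<turnstile> ?p \<Colon> Sig A B \<bullet> wk 2"
    "B # A # \<Gamma> \<turnstile> ?p' \<Colon> Sig A B \<bullet> wk 2"
    unfolding sub_ty.simps
    by (intro C_Pair I_Sig right_Pair[where a = "Var 1"] tm_refl sc(3,4) mor_ty[OF _ sc(1)] mor_eq_ty[OF _ sc(1)]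
      mor_ty[OF _ sc(2)] mor_eq_ty[OF _ sc(2)] A B)+
  have "\<Gamma> \<turnstile> ElSig A' B' L' d' m' \<Colon> L' \<bullet> (d' \<cdot> Var)"
    by (rule E_Sig[OF A(3) mor_Var_ty[OF ctx_conv1[OF A] B(3)] mor_Var_ty[OF ctx_conv1[OF ss] L(2)]
      conv[OF d(3) ss(1)] mor_Var_tm[OF ctx_conv[OF ctx_conv1[OF A] B] conv[OF m inst_eq_ty[OF L(1) sc(1) 1]]]])
  then show ?thesis by (rule conv[OF _ ty_sym[OF inst_eq_ty_Var[OF L(1) d]]])
qed

lemma right_Lam:
  assumes A: "\<Gamma> \<turnstile> A \<doteq> A' type Set" "\<Gamma> \<turnstile> A type Set" "\<Gamma> \<turnstile> A' type Set"
    and B: "A # \<Gamma> \<turnstile> B \<doteq> B' type Set" "A # \<Gamma> \<turnstile> B' type Set"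
    and b: "A # \<Gamma> \<turnstile> b' \<Colon> B"
  shows "\<Gamma> \<turnstile> Lam A' B' b' \<Colon> Pi A B"
  by (rule conv[OF I_Pi[OF A(3) mor_Var_ty[OF ctx_conv1[OF A] B(2)] mor_Var_tm[OF ctx_conv1[OF A] conv[OF b eq_ty_Col[OF B(1)]]]]
    ty_sym[OF eq_ty_Col[OF C_Pi[OF A(1) B(1)]]]])

lemma right_Ap:
  assumes A: "\<Gamma> \<turnstile> A \<doteq> A' type Set" "\<Gamma> \<turnstile> A type Set" "\<Gamma> \<turnstile> A' type Set"
    and B: "A # \<Gamma> \<turnstile> B \<doteq> B' type Set" "A # \<Gamma> \<turnstile> B' type Set"
    and f: "\<Gamma> \<turnstile> f' \<Colon> Pi A B"
    and a: "\<Gamma> \<turnstile> a \<doteq> a' \<Colon> A" "\<Gamma> \<turnstile> a \<Colon> A" "\<Gamma> \<turnstile> a' \<Colon> A"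
  shows "\<Gamma> \<turnstile> Ap A' B' f' a' \<Colon> B \<bullet> (a \<cdot> Var)"
  by (rule conv[OF E_Pi[OF A(3) mor_Var_ty[OF ctx_conv1[OF A] B(2)] conv[OF f eq_ty_Col[OF C_Pi[OF A(1) B(1)]]]
     conv[OF a(3) eq_ty_Col[OF A(1)]]] ty_sym[OF eq_ty_Col[OF inst_eq_ty_Var[OF B(1) a]]]])

lemma right_Cls:
  assumes "\<Gamma> \<turnstile> A \<doteq> A' type Set" "A \<bullet> wk 1 # A # \<Gamma> \<turnstile> R \<doteq> R' type PropS"
     "\<Gamma> \<turnstile> Quot A R type Set" "\<Gamma> \<turnstile> Quot A' R' type Set" "\<Gamma> \<turnstile> a \<Colon> A"
  shows "\<Gamma> \<turnstile> Cls A' R' a \<Colon> Quot A R"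
  by (rule conv[OF I_Quot[OF assms(4) conv[OF assms(5) eq_ty_Col[OF assms(1)]]] ty_sym[OF eq_ty_Col[OF C_Quot[OF assms(1-4)]]]])

lemma quot_ctx:
  assumes Q: "\<Gamma> \<turnstile> Quot A R type Set"
  shows "\<Gamma> \<turnstile> A type Set" "A # \<Gamma> \<turnstile> A \<bullet> wk 1 type Set" "A \<bullet> wk 1 # A # \<Gamma> \<turnstile> R type PropS"
   "mor (R # A \<bullet> wk 1 # A # \<Gamma>) (wk 3) \<Gamma>" "R # A \<bullet> wk 1 # A # \<Gamma> \<turnstile> Var 2 \<Colon> A \<bullet> wk 3"
   "R # A \<bullet> wk 1 # A # \<Gamma> \<turnstile> Var 1 \<Colon> A \<bullet> wk 3"
   "R # A \<bullet> wk 1 # A # \<Gamma> \<turnstile> Var 0 \<Colon> rel (R \<bullet> up (up (wk 3))) 0 (Var 2) (Var 1)"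
proof -
  let ?\<Delta> = "R # A \<bullet> wk 1 # A # \<Gamma>"
  from Quot_inv(2)[OF Q refl] show A: "\<Gamma> \<turnstile> A type Set" and R: "A \<bullet> wk 1 # A # \<Gamma> \<turnstile> R type PropS" by auto
  show "A # \<Gamma> \<turnstile> A \<bullet> wk 1 type Set" by (rule wk1_ty[OF A A])
  note c = ctx_cons[OF R]
  show "mor ?\<Delta> (wk 3) \<Gamma>" by (rule wk_ctx3[OF R])
  show "?\<Delta> \<turnstile> Var 2 \<Colon> A \<bullet> wk 3"
   "?\<Delta> \<turnstile> Var 1 \<Colon> A \<bullet> wk 3"
   "?\<Delta> \<turnstile> Var 0 \<Colon> rel (R \<bullet> up (up (wk 3))) 0 (Var 2) (Var 1)"
    using var[OF c, of 2] var[OF c, of 1] var[OF c, of 0] by (simp_all add: sigma)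
qed

text \<open>
  The compatibility premise speaks of \<open>m\<close> only. For \<open>m'\<close> it is obtained by passing from \<open>m'\<close> to
  \<open>m\<close> at each of the two representatives; the types at which the two passages take place agree
  because related representatives have equal classes.
\<close>
lemma right_ElQ:
  assumes A: "\<Gamma> \<turnstile> A \<doteq> A' type Set" "\<Gamma> \<turnstile> A' type Set"
    and R: "A \<bullet> wk 1 # A # \<Gamma> \<turnstile> R \<doteq> R' type PropS" "A \<bullet> wk 1 # A # \<Gamma> \<turnstile> R' type PropS"
    and Q: "\<Gamma> \<turnstile> Quot A R type Set" "\<Gamma> \<turnstile> Quot A' R' type Set"
    and L: "Quot A R # \<Gamma> \<turnstile> L \<doteq> L' type Col" "Quot A R # \<Gamma> \<turnstile> L' type Col"
    and p: "\<Gamma> \<turnstile> p \<doteq> p' \<Colon> Quot A R" "\<Gamma> \<turnstile> p \<Colon> Quot A R" "\<Gamma> \<turnstile> p' \<Colon> Quot A R"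
    and m: "A # \<Gamma> \<turnstile> m \<doteq> m' \<Colon> L \<bullet> (Cls (A \<bullet> wk 1) (R \<bullet> up (up (wk 1))) (Var 0) \<cdot> wk 1)"
      "A # \<Gamma> \<turnstile> m' \<Colon> L \<bullet> (Cls (A \<bullet> wk 1) (R \<bullet> up (up (wk 1))) (Var 0) \<cdot> wk 1)"
    and r: "R # A \<bullet> wk 1 # A # \<Gamma> \<turnstile> m \<star> (Var 2 \<cdot> wk 3) \<doteq> m \<star> (Var 1 \<cdot> wk 3) \<Colon> L \<bullet> (Cls (A \<bullet> wk 3) (R \<bullet> up (up (wk 3))) (Var 2) \<cdot> wk 3)"
  shows "\<Gamma> \<turnstile> ElQ A' R' L' p' m' \<Colon> L \<bullet> (p \<cdot> Var)"
proof -
  let ?\<Delta> = "R # A \<bullet> wk 1 # A # \<Gamma>"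
  let ?q = "Cls (A \<bullet> wk 3) (R \<bullet> up (up (wk 3))) (Var 2)"
  let ?q1 = "Cls (A \<bullet> wk 3) (R \<bullet> up (up (wk 3))) (Var 1)"
  note qc = quot_ctx[OF Q(1)]
  have QQ: "\<Gamma> \<turnstile> Quot A R \<doteq> Quot A' R' type Set" by (rule C_Quot[OF A(1) R(1) Q])
  have cls: "\<Theta> \<turnstile> Cls (A \<bullet> \<sigma>) (R \<bullet> up (up \<sigma>)) a \<doteq> Cls (A' \<bullet> \<sigma>) (R' \<bullet> up (up \<sigma>)) a \<Colon> Quot A R \<bullet> \<sigma>"
      "\<Theta> \<turnstile> Cls (A \<bullet> \<sigma>) (R \<bullet> up (up \<sigma>)) a \<Colon> Quot A R \<bullet> \<sigma>"
      "\<Theta> \<turnstile> Cls (A' \<bullet> \<sigma>) (R' \<bullet> up (up \<sigma>)) a \<Colon> Quot A R \<bullet> \<sigma>"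
    if s: "mor \<Theta> \<sigma> \<Gamma>" and a: "\<Theta> \<turnstile> a \<Colon> A \<bullet> \<sigma>" for \<Theta> \<sigma> a
    unfolding sub_ty.simps
    by (intro C_Cls I_Quot right_Cls a tm_refl mor_eq_ty[OF A(1) s] mor_eq_ty[OF R(1) mor_up2[OF s qc(1)]]
       mor_ty[OF Q(1) s, unfolded sub_ty.simps] mor_ty[OF Q(2) s, unfolded sub_ty.simps])+
  note w1 = wk_ctx1[OF qc(1)]
  have m': "A' # \<Gamma> \<turnstile> m' \<Colon> L' \<bullet> (Cls (A' \<bullet> wk 1) (R' \<bullet> up (up (wk 1))) (Var 0) \<cdot> wk 1)"
    by (rule mor_Var_tm[OF ctx_conv1[OF A(1) qc(1) A(2)] conv[OF m(2) inst_eq_ty[OF L(1) w1 cls[OF w1 hyp0[OF qc(1)]]]]])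
  note c1 = ctx_conv1[OF A(1) qc(1) A(2)]
  note c2 = ctx_conv[OF c1 mor_eq_ty[OF A(1) w1] qc(2) mor_ty[OF A(2) w1]]
  note c3 = ctx_conv[OF c2 R(1) qc(3) R(2)]
  have e2: "?\<Delta> \<turnstile> m \<star> (Var 2 \<cdot> wk 3) \<doteq> m' \<star> (Var 2 \<cdot> wk 3) \<Colon> L \<bullet> (?q \<cdot> wk 3)"
    using mor_eq_tm[OF m(1) mor_scons[OF qc(4,5)]] by (simp add: sigma)
  have e1: "?\<Delta> \<turnstile> m \<star> (Var 1 \<cdot> wk 3) \<doteq> m' \<star> (Var 1 \<cdot> wk 3) \<Colon> L \<bullet> (?q1 \<cdot> wk 3)"
    using mor_eq_tm[OF m(1) mor_scons[OF qc(4,6)]] by (simp add: sigma)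
  have t: "?\<Delta> \<tturnstile> rel (R \<bullet> up (up (wk 3))) 0 (Var 2) (Var 1)"
  proof (rule true_I[OF _ qc(7)])
    have "mor ?\<Delta> (Var 1 \<cdot> Var 2 \<cdot> wk 3) (A \<bullet> wk 1 # A # \<Gamma>)"
      using qc by (intro mor_scons) (simp_all add: sigma)
    from mor_ty[OF qc(3) this]
    show "?\<Delta> \<turnstile> rel (R \<bullet> up (up (wk 3))) 0 (Var 2) (Var 1) type Prop"
      by (simp add: sigma) (auto intro: incl_ty incl.intros)
  qed
  have q12: "?\<Delta> \<turnstile> ?q1 \<doteq> ?q \<Colon> Quot A R \<bullet> wk 3"
    unfolding sub_ty.simps
    by (rule tm_sym[OF eq_Quot[OF mor_ty[OF Q(1) qc(4), unfolded sub_ty.simps] qc(5,6) t]])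
  have L1: "?\<Delta> \<turnstile> L \<bullet> (?q1 \<cdot> wk 3) \<doteq> L' \<bullet> (?q \<cdot> wk 3) type Col"
    by (rule inst_eq_ty[OF L(1) qc(4) q12 cls(2)[OF qc(4,6)] cls(2)[OF qc(4,5)]])
  note L2 = inst_eq_ty[OF L(1) qc(4) tm_refl[OF cls(2)[OF qc(4,5)]] cls(2)[OF qc(4,5)] cls(2)[OF qc(4,5)]]
  have "?\<Delta> \<turnstile> m' \<star> (Var 2 \<cdot> wk 3) \<doteq> m' \<star> (Var 1 \<cdot> wk 3) \<Colon> L' \<bullet> (?q \<cdot> wk 3)"
    by (rule tm_trans[OF tm_sym[OF conv_eq[OF e2 L2]] tm_trans[OF conv_eq[OF r L2] conv_eq[OF e1 L1]]])
  then have "?\<Delta> \<turnstile> m' \<star> (Var 2 \<cdot> wk 3) \<doteq> m' \<star> (Var 1 \<cdot> wk 3) \<Colon> L \<bullet> (?q \<cdot> wk 3)"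
    by (rule conv_eq[OF _ ty_sym[OF L2]])
  then have r': "R' # A' \<bullet> wk 1 # A' # \<Gamma> \<turnstile> m' \<star> (Var 2 \<cdot> wk 3) \<doteq> m' \<star> (Var 1 \<cdot> wk 3) \<Colon> L' \<bullet> (Cls (A' \<bullet> wk 3) (R' \<bullet> up (up (wk 3))) (Var 2) \<cdot> wk 3)"
    by (rule mor_Var_eq_tm[OF c3 conv_eq[OF _ inst_eq_ty[OF L(1) qc(4) cls[OF qc(4,5)]]]])
  have "\<Gamma> \<turnstile> ElQ A' R' L' p' m' \<Colon> L' \<bullet> (p' \<cdot> Var)"
    by (rule E_Quot[OF Q(2) mor_Var_ty[OF ctx_conv1[OF QQ Q] L(2)] conv[OF p(3) eq_ty_Col[OF QQ]] m' r'])
  then show ?thesis by (rule conv[OF _ ty_sym[OF inst_eq_ty_Var[OF L(1) p]]])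
qed


section \<open>Presuppositions\<close>

lemma prop_ty: "\<lbrakk>K \<in> {PropS, Prop}; \<Gamma> \<turnstile> A type K\<rbrakk> \<Longrightarrow> \<Gamma> \<turnstile> A type Prop"
  by (auto intro: incl_ty incl.intros)

lemma rel_mor:
  assumes "T \<turnstile> \<Gamma> ctx" "\<Gamma> \<turnstile> a \<Colon> A" "\<Gamma> \<turnstile> b \<Colon> A"
  shows "mor \<Gamma> (b \<cdot> a \<cdot> Var) (A \<bullet> wk 1 # A # \<Gamma>)"
  using assms by (intro mor_scons mor_id) (simp_all add: sigma)

lemma F_Top: "T \<turnstile> \<Gamma> ctx \<Longrightarrow> \<Gamma> \<turnstile> Top type PropS"
  unfolding Top_def Neg_def by (intro F_Impl F_Falsum) simp_all

lemma Dc_PropS: "\<Gamma> \<turnstile> U \<Colon> P1 \<Longrightarrow> \<Gamma> \<turnstile> Dc U type PropS"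
  unfolding Dc_def by (intro F_Dc tm_refl I_P1 F_Top ctx_of(3))

lemma eta_Pi_left:
  assumes "\<Gamma> \<turnstile> A type Set" "A # \<Gamma> \<turnstile> B type Set" "\<Gamma> \<turnstile> f \<Colon> Pi A B"
  shows "\<Gamma> \<turnstile> Lam A B (Ap (A \<bullet> wk 1) (B \<bullet> up (wk 1)) (f \<star> wk 1) (Var 0)) \<Colon> Pi A B"
proof (rule I_Pi[OF assms(1,2)])
  note w = wk_ctx1[OF assms(1)]
  note a = mor_ty[OF assms(1) w]
  note b = mor_ty[OF assms(2) mor_up[OF w ty_Col[OF a]]]
  show "A # \<Gamma> \<turnstile> Ap (A \<bullet> wk 1) (B \<bullet> up (wk 1)) (f \<star> wk 1) (Var 0) \<Colon> B"
    using E_Pi[OF a b mor_tm[OF assms(3) w, unfolded sub_ty.simps] hyp0[OF assms(1)]] by (simp add: sigma)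
qed

lemma eta_FunP1_left:
  assumes "\<Gamma> \<turnstile> A type Set" "\<Gamma> \<turnstile> f \<Colon> FunP1 A"
  shows "\<Gamma> \<turnstile> LamP1 A (ApP1 (A \<bullet> wk 1) (f \<star> wk 1) (Var 0)) \<Colon> FunP1 A"
proof (rule I_FunP1[OF assms(1)])
  note w = wk_ctx1[OF assms(1)]
  show "A # \<Gamma> \<turnstile> ApP1 (A \<bullet> wk 1) (f \<star> wk 1) (Var 0) \<Colon> P1"
    by (rule E_FunP1[OF mor_ty[OF assms(1) w] mor_tm[OF assms(2) w, unfolded sub_ty.simps] hyp0[OF assms(1)]])
qed

text \<open>
  The right-hand side of a congruence has been treated above; what remains is to read the
  presuppositions off the other rules. The types of conclusions come from the formation rules, and
  the two sides of a computation rule from the elimination rule and from substitution.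
\<close>
lemma presuppositions:
  "T \<turnstile> \<Gamma> ctx \<Longrightarrow> True"
  "\<Gamma> \<turnstile> A type K \<Longrightarrow> True"
  "\<Gamma> \<turnstile> a \<Colon> A \<Longrightarrow> \<Gamma> \<turnstile> A type Col"
  "\<Gamma> \<turnstile> A \<doteq> B type K \<Longrightarrow> \<Gamma> \<turnstile> A type K \<and> \<Gamma> \<turnstile> B type K"
  "\<Gamma> \<turnstile> a \<doteq> b \<Colon> A \<Longrightarrow> \<Gamma> \<turnstile> a \<Colon> A \<and> \<Gamma> \<turnstile> b \<Colon> A \<and> \<Gamma> \<turnstile> A type Col"
proof (induction rule: ctx_ok_is_ty_is_tm_eq_ty_eq_tm.inducts)
  case (var \<Gamma> i)
  then show ?case by (intro ctx_nth)
next
  case (sub_tm \<Delta> a A \<Gamma> \<sigma>)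
  then show ?case by (intro mor_ty[of \<Delta>]) (auto simp: mor_def)
next
  case (sub_eq_ty \<Delta> A B K \<Gamma> \<sigma> \<tau>)
  then show ?case by (auto intro!: mor_ty[of \<Delta>] simp: mor_def)
next
  case (sub_eq_tm \<Delta> a b A \<Gamma> \<sigma> \<tau>)
  have s: "mor \<Gamma> \<sigma> \<Delta>" and t: "mor \<Gamma> \<tau> \<Delta>" using sub_eq_tm by (auto simp: mor_def)
  have "\<Gamma> \<turnstile> A \<bullet> \<sigma> \<doteq> A \<bullet> \<tau> type Col"
    using sub_eq_tm by (intro ctx_ok_is_ty_is_tm_eq_ty_eq_tm.sub_eq_ty[of T \<Delta>] ty_refl) auto
  then show ?case using sub_eq_tm mor_tm[OF _ s] mor_tm[OF _ t] mor_ty[OF _ s] by (meson conv ty_sym)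
next
  case (eff_Quot \<Gamma> A R a b)
  then show ?case using quot_ctx(3)[of \<Gamma> A R] mor_ty[OF _ rel_mor[of \<Gamma> a A b]]
    by (auto intro: ty_Col ctx_of)
next
  case (eff_P1 \<Gamma> \<phi> \<psi>)
  then show ?case unfolding Iff_def by (intro ty_Col[of \<Gamma> _ PropS] F_Conj F_Impl) auto
next
  case conv_eq
  then show ?case by (auto intro: ctx_ok_is_ty_is_tm_eq_ty_eq_tm.conv)
next
  case incl_eq_ty
  then show ?case by (auto intro: ctx_ok_is_ty_is_tm_eq_ty_eq_tm.incl_ty)
next
  case C_Conj
  then show ?case by (auto intro: F_Conj)
next
  case C_Disj
  then show ?case by (auto intro: F_Disj)
next
  case C_Impl
  then show ?case by (auto intro: F_Impl)
next
  case C_Eq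
  then show ?case by (blast intro: F_Eq ctx_ok_is_ty_is_tm_eq_ty_eq_tm.conv eq_ty_Col)
next
  case C_Dc
  then show ?case by (blast intro: F_Dc tm_trans tm_sym)
next
  case I_Conj
  then show ?case by (intro ty_Col[OF F_Conj[of Prop]]) auto
next
  case I1_Disj
  then show ?case by (intro ty_Col[OF F_Disj[of Prop]]) auto
next
  case I2_Disj
  then show ?case by (intro ty_Col[OF F_Disj[of Prop]]) auto
next
  case I_Impl
  then show ?case by (intro ty_Col[OF F_Impl[of Prop]]) auto
next
  case LEM
  then show ?case unfolding Neg_def by (intro ty_Col[OF F_Disj[of Prop]] F_Impl[of Prop] prop_ty[OF _ F_Falsum] ctx_of(2)) auto
next
  case I_Exi
  then show ?case by (auto intro!: ty_Col[OF F_Exi[of Prop Col]] prop_over.intros)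
next
  case I_Uni
  then show ?case by (auto intro!: ty_Col[OF F_Uni[of Prop Col]] prop_over.intros)
next
  case I_Eq
  then show ?case by (auto intro!: ty_Col[OF F_Eq[of Prop Col]] prop_over.intros)
next
  case C_ElN0
  then show ?case by (blast intro: E_N0 inst_ty inst_eq_ty_Var ty_sym ctx_ok_is_ty_is_tm_eq_ty_eq_tm.conv)
next
  case C_Nil
  then show ?case by (blast intro: ty_Col F_List I_Nil ctx_ok_is_ty_is_tm_eq_ty_eq_tm.conv eq_ty_Col C_List ty_sym)
next
  case C_Cons
  then show ?case by (meson ty_Col F_List I_Cons ctx_ok_is_ty_is_tm_eq_ty_eq_tm.conv eq_ty_Col C_List ty_sym)
next
  case I_Sig
  then show ?case by (simp add: F_Sig)
next
  case C_LamP1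
  then show ?case by (blast intro: F_FunP1 I_FunP1 mor_Var_tm[OF ctx_conv1] ctx_ok_is_ty_is_tm_eq_ty_eq_tm.conv ty_sym C_FunP1)
next
  case C_ApP1
  then show ?case by (blast intro: F_P1 ctx_of(2) E_FunP1 ctx_ok_is_ty_is_tm_eq_ty_eq_tm.conv C_FunP1 eq_ty_Col)
next
  case (B2_List \<Gamma> A L l b a m)
  \<comment> \<open>each premise of a rule is followed by its induction hypothesis, so premises have odd numbers\<close>
  note el = E_List[OF B2_List(1,3) _ B2_List(9,11)]
  have "mor \<Gamma> (ElList A L l a m \<cdot> b \<cdot> l \<cdot> Var) (L \<bullet> (Var 1 \<cdot> wk 2) # A \<bullet> wk 1 # List A # \<Gamma>)"
    using el[OF B2_List(5)] B2_List by (intro mor_scons mor_id) (auto simp: sigma intro: ctx_of)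
  from mor_tm[OF B2_List(11) this] el[OF I_Cons[OF B2_List(1,5,7)]]
  show ?case using B2_List by (auto simp: sigma intro: inst_ty I_Cons)
next
  case (B1_Sum \<Gamma> A B L a m n)
  note el = E_Sum[OF B1_Sum(1,3,5) I_Inl[OF B1_Sum(1,3,7)] B1_Sum(9,11)]
  from inst_tm[OF B1_Sum(9,7)] el
  show ?case using B1_Sum by (auto simp: sigma intro: inst_ty I_Inl)
next
  case (B2_Sum \<Gamma> A B L b m n)
  note el = E_Sum[OF B2_Sum(1,3,5) I_Inr[OF B2_Sum(1,3,7)] B2_Sum(9,11)]
  from inst_tm[OF B2_Sum(11,7)] el
  show ?case using B2_Sum by (auto simp: sigma intro: inst_ty I_Inr)
next
  case (B_Sig \<Gamma> A B L a b m)
  note pr = I_Sig[OF B_Sig(1,3,7,9)]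
  note el = E_Sig[OF B_Sig(1,3,5) pr B_Sig(11)]
  have "mor \<Gamma> (b \<cdot> a \<cdot> Var) (B # A # \<Gamma>)"
    using B_Sig by (intro mor_scons mor_id) (auto simp: sigma intro: ctx_of)
  from mor_tm[OF B_Sig(11) this] el
  show ?case using B_Sig by (auto simp: sigma intro: inst_ty pr)
next
  case (B_Quot \<Gamma> A R L a m)
  note cl = I_Quot[OF B_Quot(1,5)]
  from inst_tm[OF B_Quot(7,5)] E_Quot[OF B_Quot(1,3) cl B_Quot(7,9)]
  show ?case using B_Quot by (auto simp: sigma intro: inst_ty cl)
next
  case (B_FunP1 \<Gamma> A b a)
  show ?case using inst_tm[OF B_FunP1(3,5)] E_FunP1[OF B_FunP1(1) I_FunP1[OF B_FunP1(1,3)] B_FunP1(5)]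
    by (auto intro: F_P1 ctx_of)
qed (blast intro: E_List E_N1 E_Pi E_Quot E_Sig E_Sum Dc_PropS F_Exi F_FunP1 F_List F_N1 F_P1 F_Pi F_Sig F_Sum F_Uni I_Inl I_Inr I_N1 I_Nil I_P1 I_Pi I_Quot I_Sig eta_FunP1_left eta_Pi_left inst_tm inst_ty mor_Var_ty[OF ctx_conv1] right_Ap right_Cls right_ElList right_ElN1 right_ElQ right_ElSig right_ElSum right_Inl right_Inr right_Lam right_Pair ty_Col ctx_of(2,3))+

section \<open>Logic\<close>

lemmas tm_ty = presuppositions(3)
lemmas eq_ty_l = presuppositions(4)[THEN conjunct1]
lemmas eq_ty_r = presuppositions(4)[THEN conjunct2]
lemmas eq_tm_l = presuppositions(5)[THEN conjunct1]
lemmas eq_tm_r = presuppositions(5)[THEN conjunct2, THEN conjunct1]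
lemmas eq_tm_ty = presuppositions(5)[THEN conjunct2, THEN conjunct2]

lemma mor_true: "\<lbrakk>\<Gamma> \<tturnstile> \<phi>; mor \<Theta> \<sigma> \<Gamma>\<rbrakk> \<Longrightarrow> \<Theta> \<tturnstile> \<phi> \<bullet> \<sigma>"
  using mor_tm[of \<Gamma> true \<phi>] by simp

lemma wk_true: "\<lbrakk>\<Gamma> \<tturnstile> \<phi>; \<Gamma> \<turnstile> A type K\<rbrakk> \<Longrightarrow> A # \<Gamma> \<tturnstile> \<phi> \<bullet> wk 1"
  by (blast intro: mor_true wk_ctx1)

lemma hyp_true: "\<Gamma> \<turnstile> \<phi> type Prop \<Longrightarrow> \<phi> # \<Gamma> \<tturnstile> \<phi> \<bullet> wk 1"
  by (blast intro: true_I hyp0 wk1_ty)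

lemma PropS_Prop: "\<Gamma> \<turnstile> \<phi> type PropS \<Longrightarrow> \<Gamma> \<turnstile> \<phi> type Prop"
  by (rule prop_ty[of PropS]) simp_all

lemma F_Eq_Prop: "\<lbrakk>\<Gamma> \<turnstile> a \<Colon> A; \<Gamma> \<turnstile> b \<Colon> A\<rbrakk> \<Longrightarrow> \<Gamma> \<turnstile> Eq A a b type Prop"
  by (blast intro: F_Eq prop_over.intros tm_ty)

text \<open>
  Together with reflection, this makes propositional and judgemental equality interchangeable.
\<close>
lemma eq_true:
  assumes "\<Gamma> \<turnstile> a \<doteq> b \<Colon> A" shows "\<Gamma> \<tturnstile> Eq A a b"
proof (rule conv[OF I_Eq[OF eq_tm_ty[OF assms] eq_tm_l[OF assms]] eq_ty_Col[of _ _ _ Prop]])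
  show "\<Gamma> \<turnstile> Eq A a a \<doteq> Eq A a b type Prop"
    using assms by (blast intro: C_Eq prop_over.intros tm_refl ty_refl eq_tm_ty eq_tm_l)
qed

lemma eq_reflect: "\<lbrakk>\<Gamma> \<tturnstile> Eq A a b; \<Gamma> \<turnstile> a \<Colon> A; \<Gamma> \<turnstile> b \<Colon> A\<rbrakk> \<Longrightarrow> \<Gamma> \<turnstile> a \<doteq> b \<Colon> A"
  by (blast intro: E_Eq tm_ty)

lemma F_Neg: "\<lbrakk>K \<in> {PropS, Prop}; \<Gamma> \<turnstile> \<phi> type K\<rbrakk> \<Longrightarrow> \<Gamma> \<turnstile> Neg \<phi> type K"
  unfolding Neg_def by (rule F_Impl) (auto intro: F_Falsum ctx_of PropS_Prop)

lemma F_Stab: "\<lbrakk>K \<in> {PropS, Prop}; \<Gamma> \<turnstile> \<phi> type K\<rbrakk> \<Longrightarrow> \<Gamma> \<turnstile> Stab \<phi> type K"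
  unfolding Stab_def by (intro F_Impl F_Neg)

lemma F_Neg_Prop: "\<Gamma> \<turnstile> \<phi> type Prop \<Longrightarrow> \<Gamma> \<turnstile> Neg \<phi> type Prop"
  and F_Stab_Prop: "\<Gamma> \<turnstile> \<phi> type Prop \<Longrightarrow> \<Gamma> \<turnstile> Stab \<phi> type Prop"
  by (simp_all add: F_Neg F_Stab)

lemma F_Falsum_Prop: "T \<turnstile> \<Gamma> ctx \<Longrightarrow> \<Gamma> \<turnstile> Falsum type Prop"
  by (rule PropS_Prop[OF F_Falsum])

lemma Neg_I: "\<lbrakk>\<Gamma> \<turnstile> \<phi> type Prop; \<phi> # \<Gamma> \<tturnstile> Falsum\<rbrakk> \<Longrightarrow> \<Gamma> \<tturnstile> Neg \<phi>"
  unfolding Neg_def by (rule I_Impl) (auto intro: F_Falsum_Prop ctx_of)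

lemma Neg_E: "\<lbrakk>\<Gamma> \<turnstile> \<phi> type Prop; \<Gamma> \<tturnstile> Neg \<phi>; \<Gamma> \<tturnstile> \<phi>\<rbrakk> \<Longrightarrow> \<Gamma> \<tturnstile> Falsum"
  unfolding Neg_def by (rule E_Impl[of T \<Gamma> \<phi>]) (auto intro: F_Falsum_Prop ctx_of)

lemma nn_I:
  assumes "\<Gamma> \<turnstile> \<phi> type Prop" "\<Gamma> \<tturnstile> \<phi>"
  shows "\<Gamma> \<tturnstile> Neg (Neg \<phi>)"
proof -
  note n = F_Neg_Prop[OF assms(1)]
  show ?thesis using hyp_true[OF n] by (intro Neg_I[OF n] Neg_E[OF wk1_ty[OF assms(1) n] _ wk_true[OF assms(2) n]]) simp
qed

text \<open>
  Double negation is a monad: a hypothesis may be used without its double negation as long as the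
  conclusion is doubly negated.
\<close>
lemma nn_bind:
  assumes "\<Gamma> \<turnstile> \<phi> type Prop" "\<Gamma> \<turnstile> \<psi> type Prop"
    "\<Gamma> \<tturnstile> Neg (Neg \<phi>)" "\<phi> # \<Gamma> \<tturnstile> Neg (Neg (\<psi> \<bullet> wk 1))"
  shows "\<Gamma> \<tturnstile> Neg (Neg \<psi>)"
proof -
  note n = F_Neg_Prop[OF assms(2)]
  note w = wk_ctx1[OF n]
  note p = mor_ty[OF assms(1) w]
  have "\<phi> \<bullet> wk 1 # Neg \<psi> # \<Gamma> \<tturnstile> Neg (Neg (\<psi> \<bullet> wk 2))"
    using mor_true[OF assms(4) mor_up[OF w ty_Col[OF p]]] by (simp add: sigma)
  moreover have "\<phi> \<bullet> wk 1 # Neg \<psi> # \<Gamma> \<tturnstile> Neg (\<psi> \<bullet> wk 2)"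
    using wk_true[OF hyp_true[OF n] p] by (simp add: sigma)
  moreover have "\<phi> \<bullet> wk 1 # Neg \<psi> # \<Gamma> \<turnstile> Neg (\<psi> \<bullet> wk 2) type Prop"
    using wk1_ty[OF wk1_ty[OF n n] p] by (simp add: sigma)
  ultimately have "Neg \<psi> # \<Gamma> \<tturnstile> Neg (\<phi> \<bullet> wk 1)"
    by (intro Neg_I p) (rule Neg_E)
  then show ?thesis
    using F_Neg_Prop[OF p] wk_true[OF assms(3) n] by (auto intro: Neg_I[OF n] Neg_E)
qed

lemma nn_mono:
  assumes "\<Gamma> \<turnstile> \<phi> type Prop" "\<Gamma> \<turnstile> \<psi> type Prop"
    "\<Gamma> \<tturnstile> Neg (Neg \<phi>)" "\<phi> # \<Gamma> \<tturnstile> \<psi> \<bullet> wk 1"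
  shows "\<Gamma> \<tturnstile> Neg (Neg \<psi>)"
  by (rule nn_bind[OF assms(1-3) nn_I[OF wk1_ty[OF assms(2,1)] assms(4)]])

lemma Stab_E:
  assumes "\<Gamma> \<turnstile> \<phi> type Prop" "\<Gamma> \<tturnstile> Stab \<phi>" "\<Gamma> \<tturnstile> Neg (Neg \<phi>)"
  shows "\<Gamma> \<tturnstile> \<phi>"
  using E_Impl[OF F_Neg_Prop[OF F_Neg_Prop[OF assms(1)]] assms(1)] assms(2,3) by (simp add: Stab_def)

text \<open>
  Stability stated as a closure condition at all context morphisms; the weakening that introduces
  the hypothesis \<open>\<not>\<not>\<phi>\<close> is the instance that matters.
\<close>
lemma Stab_I:
  assumes "\<Gamma> \<turnstile> \<phi> type Prop"
    "\<And>\<Theta> \<sigma>. \<lbrakk>mor \<Theta> \<sigma> \<Gamma>; \<Theta> \<tturnstile> Neg (Neg (\<phi> \<bullet> \<sigma>))\<rbrakk> \<Longrightarrow> \<Theta> \<tturnstile> \<phi> \<bullet> \<sigma>"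
  shows "\<Gamma> \<tturnstile> Stab \<phi>"
proof -
  note n = F_Neg_Prop[OF F_Neg_Prop[OF assms(1)]]
  show ?thesis
    unfolding Stab_def using assms(2)[OF wk_ctx1[OF n]] hyp_true[OF n] by (intro I_Impl n assms(1)) simp
qed

lemma Falsum_of_nn: "\<Gamma> \<tturnstile> Neg (Neg Falsum) \<Longrightarrow> \<Gamma> \<tturnstile> Falsum"
  using Neg_E[of \<Gamma> "Neg Falsum"] Neg_I[of \<Gamma> Falsum] hyp_true[of \<Gamma> Falsum] F_Neg_Prop[of \<Gamma> Falsum] F_Falsum_Prop ctx_of(3)
  by fastforce

lemma Stab_Falsum: "T \<turnstile> \<Gamma> ctx \<Longrightarrow> \<Gamma> \<tturnstile> Stab Falsum"
  by (rule Stab_I) (auto intro: F_Falsum_Prop Falsum_of_nn)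

lemma Stab_Conj:
  assumes "\<Gamma> \<turnstile> \<phi> type Prop" "\<Gamma> \<turnstile> \<psi> type Prop" "\<Gamma> \<tturnstile> Stab \<phi>" "\<Gamma> \<tturnstile> Stab \<psi>"
  shows "\<Gamma> \<tturnstile> Stab (Conj \<phi> \<psi>)"
proof (rule Stab_I)
  show "\<Gamma> \<turnstile> Conj \<phi> \<psi> type Prop" using assms by (simp add: F_Conj)
  fix \<Theta> \<sigma> assume s: "mor \<Theta> \<sigma> \<Gamma>" and nn: "\<Theta> \<tturnstile> Neg (Neg (Conj \<phi> \<psi> \<bullet> \<sigma>))"
  note 1 = mor_ty[OF assms(1) s] and 2 = mor_ty[OF assms(2) s]
  have 3: "\<Theta> \<turnstile> Conj \<phi> \<psi> \<bullet> \<sigma> type Prop" using 1 2 by (simp add: F_Conj)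
  note h = hyp_true[OF 3, unfolded sub_ty.simps]
  note w1 = wk1_ty[OF 1 3, unfolded sub_ty.simps] and w2 = wk1_ty[OF 2 3, unfolded sub_ty.simps]
  have "\<Theta> \<tturnstile> Neg (Neg (\<phi> \<bullet> \<sigma>))" "\<Theta> \<tturnstile> Neg (Neg (\<psi> \<bullet> \<sigma>))"
    using nn_mono[OF 3 1 nn] nn_mono[OF 3 2 nn] E1_Conj[OF w1 w2 h] E2_Conj[OF w1 w2 h] by auto
  with Stab_E[OF 1] Stab_E[OF 2] mor_true[OF assms(3) s] mor_true[OF assms(4) s]
  show "\<Theta> \<tturnstile> Conj \<phi> \<psi> \<bullet> \<sigma>" by (simp add: I_Conj 1 2)
qed

lemma Stab_Impl:
  assumes "\<Gamma> \<turnstile> \<phi> type Prop" "\<Gamma> \<turnstile> \<psi> type Prop" "\<Gamma> \<tturnstile> Stab \<psi>"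
  shows "\<Gamma> \<tturnstile> Stab (Impl \<phi> \<psi>)"
proof (rule Stab_I)
  show "\<Gamma> \<turnstile> Impl \<phi> \<psi> type Prop" using assms by (simp add: F_Impl)
  fix \<Theta> \<sigma> assume s: "mor \<Theta> \<sigma> \<Gamma>" and nn: "\<Theta> \<tturnstile> Neg (Neg (Impl \<phi> \<psi> \<bullet> \<sigma>))"
  let ?\<phi> = "\<phi> \<bullet> \<sigma> \<bullet> wk 1"
  let ?\<psi> = "\<psi> \<bullet> \<sigma> \<bullet> wk 1"
  note 1 = mor_ty[OF assms(1) s] and 2 = mor_ty[OF assms(2) s]
  note w = wk_ctx1[OF 1]
  note p = mor_ty[OF 1 w] and q = mor_ty[OF 2 w]
  have i: "\<phi> \<bullet> \<sigma> # \<Theta> \<turnstile> Impl ?\<phi> ?\<psi> type Prop" using p q by (simp add: F_Impl)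
  have "\<phi> \<bullet> \<sigma> # \<Theta> \<tturnstile> Neg (Neg ?\<psi>)"
  proof (rule nn_mono[OF i q])
    show "\<phi> \<bullet> \<sigma> # \<Theta> \<tturnstile> Neg (Neg (Impl ?\<phi> ?\<psi>))"
      using mor_true[OF nn w] by simp
    show "Impl ?\<phi> ?\<psi> # \<phi> \<bullet> \<sigma> # \<Theta> \<tturnstile> ?\<psi> \<bullet> wk 1"
      using E_Impl[OF wk1_ty[OF p i] wk1_ty[OF q i] _ wk_true[OF hyp_true[OF 1] i]] hyp_true[OF i] by simp
  qed
  with mor_true[OF mor_true[OF assms(3) s] w] have "\<phi> \<bullet> \<sigma> # \<Theta> \<tturnstile> ?\<psi>"
    by (simp add: Stab_E[OF q])
  then show "\<Theta> \<tturnstile> Impl \<phi> \<psi> \<bullet> \<sigma>" by (simp add: I_Impl 1 2)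
qed

lemma Stab_Neg: "\<Gamma> \<turnstile> \<phi> type Prop \<Longrightarrow> \<Gamma> \<tturnstile> Stab (Neg \<phi>)"
  unfolding Neg_def by (blast intro: Stab_Impl F_Falsum_Prop Stab_Falsum ctx_of)

lemma Stab_Uni:
  assumes "\<Gamma> \<turnstile> A type Col" "A # \<Gamma> \<turnstile> \<phi> type Prop" "A # \<Gamma> \<tturnstile> Stab \<phi>"
  shows "\<Gamma> \<tturnstile> Stab (Uni A \<phi>)"
proof (rule Stab_I)
  have F: "\<Gamma> \<turnstile> Uni A \<phi> type Prop" if "\<Gamma> \<turnstile> A type Col" "A # \<Gamma> \<turnstile> \<phi> type Prop" for \<Gamma> A \<phi>
    using that by (auto intro: F_Uni prop_over.intros)
  show "\<Gamma> \<turnstile> Uni A \<phi> type Prop" using assms by (auto intro: F)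
  fix \<Theta> \<sigma> assume s: "mor \<Theta> \<sigma> \<Gamma>" and nn: "\<Theta> \<tturnstile> Neg (Neg (Uni A \<phi> \<bullet> \<sigma>))"
  note 1 = mor_ty[OF assms(1) s]
  note u = mor_up[OF s 1]
  note 2 = mor_ty[OF assms(2) u]
  note w = wk_ctx1[OF 1]
  have i: "A \<bullet> \<sigma> # \<Theta> \<turnstile> Uni A \<phi> \<bullet> \<sigma> \<bullet> wk 1 type Prop"
    by (rule mor_ty[OF mor_ty[OF F[OF assms(1,2)] s] w])
  have "A \<bullet> \<sigma> # \<Theta> \<tturnstile> Neg (Neg (\<phi> \<bullet> up \<sigma>))"
  proof (rule nn_mono[OF i 2])
    show "A \<bullet> \<sigma> # \<Theta> \<tturnstile> Neg (Neg (Uni A \<phi> \<bullet> \<sigma> \<bullet> wk 1))"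
      using mor_true[OF nn w] by simp
    have m: "mor (Uni A \<phi> \<bullet> \<sigma> \<bullet> wk 1 # A \<bullet> \<sigma> # \<Theta>) (wk 1) (A \<bullet> \<sigma> # \<Theta>)" by (rule wk_ctx1[OF i])
    note m2 = mor_comp[OF w m]
    have "Uni A \<phi> \<bullet> \<sigma> \<bullet> wk 1 # A \<bullet> \<sigma> # \<Theta> \<tturnstile> \<phi> \<bullet> up \<sigma> \<bullet> up (wk 1 \<odot> wk 1) \<bullet> (Var 1 \<cdot> Var)"
      using mor_tm[OF hyp0[OF 1] m] hyp_true[OF i] mor_up[OF m2 mor_ty[OF 1 m2]]
      by (intro E_Uni[of _ _ "A \<bullet> \<sigma> \<bullet> (wk 1 \<odot> wk 1)"] mor_ty[OF 1 m2] mor_ty[OF 2]) (simp_all add: sigma)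
    then show "Uni A \<phi> \<bullet> \<sigma> \<bullet> wk 1 # A \<bullet> \<sigma> # \<Theta> \<tturnstile> \<phi> \<bullet> up \<sigma> \<bullet> wk 1"
      by (simp add: sigma)
  qed
  with mor_true[OF assms(3) u] have "A \<bullet> \<sigma> # \<Theta> \<tturnstile> \<phi> \<bullet> up \<sigma>" by (simp add: Stab_E[OF 2])
  then show "\<Theta> \<tturnstile> Uni A \<phi> \<bullet> \<sigma>" by (simp add: I_Uni 1 2)
qed

text \<open>
  Under a doubly negated equation the equation may be used judgementally, by reflection, to derive
  the double negation of any consequence.
\<close>
lemma nn_eq_map:
  assumes "\<Gamma> \<tturnstile> Neg (Neg (Eq A a b))" "\<Gamma> \<turnstile> a \<Colon> A" "\<Gamma> \<turnstile> b \<Colon> A" "\<Gamma> \<turnstile> \<phi> type Prop"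
    "\<And>\<Theta> \<sigma>. \<lbrakk>mor \<Theta> \<sigma> \<Gamma>; \<Theta> \<turnstile> a \<star> \<sigma> \<doteq> b \<star> \<sigma> \<Colon> A \<bullet> \<sigma>\<rbrakk> \<Longrightarrow> \<Theta> \<tturnstile> \<phi> \<bullet> \<sigma>"
  shows "\<Gamma> \<tturnstile> Neg (Neg \<phi>)"
proof -
  note e = F_Eq_Prop[OF assms(2,3)]
  note w = wk_ctx1[OF e]
  have "Eq A a b # \<Gamma> \<turnstile> a \<star> wk 1 \<doteq> b \<star> wk 1 \<Colon> A \<bullet> wk 1"
    using hyp_true[OF e] mor_tm[OF assms(2) w] mor_tm[OF assms(3) w] by (simp add: eq_reflect)
  from nn_mono[OF e assms(4) assms(1) assms(5)[OF w this]] show ?thesis .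
qed

section \<open>Projections of dependent sums\<close>

definition pfst :: "ty \<Rightarrow> ty \<Rightarrow> tm \<Rightarrow> tm" where
  "pfst A B d = ElSig A B (A \<bullet> wk 1) d (Var 1)"

text \<open>
  The type of the second projection depends on the first projection of the argument, which is
  therefore part of the motive.
\<close>
definition psnd :: "ty \<Rightarrow> ty \<Rightarrow> tm \<Rightarrow> tm" where
  "psnd A B d = ElSig A B (B \<bullet> (pfst (A \<bullet> wk 1) (B \<bullet> up (wk 1)) (Var 0) \<cdot> wk 1)) d (Var 0)"

lemma pfst_sub: "pfst A B d \<star> \<sigma> = pfst (A \<bullet> \<sigma>) (B \<bullet> up \<sigma>) (d \<star> \<sigma>)"
  by (simp add: pfst_def sigma)

lemma psnd_sub: "psnd A B d \<star> \<sigma> = psnd (A \<bullet> \<sigma>) (B \<bullet> up \<sigma>) (d \<star> \<sigma>)"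
  by (simp add: psnd_def pfst_def sigma)

lemma wk_A: "\<lbrakk>\<Gamma> \<turnstile> A type Col; A # \<Gamma> \<turnstile> B type Col; mor \<Theta> \<sigma> \<Gamma>\<rbrakk> \<Longrightarrow> \<Theta> \<turnstile> A \<bullet> \<sigma> type Col"
  and wk_B: "\<lbrakk>\<Gamma> \<turnstile> A type Col; A # \<Gamma> \<turnstile> B type Col; mor \<Theta> \<sigma> \<Gamma>\<rbrakk> \<Longrightarrow> A \<bullet> \<sigma> # \<Theta> \<turnstile> B \<bullet> up \<sigma> type Col"
  by (blast intro: mor_ty mor_up)+

lemma F_Sig_Col: "\<lbrakk>\<Gamma> \<turnstile> A type Col; A # \<Gamma> \<turnstile> B type Col\<rbrakk> \<Longrightarrow> \<Gamma> \<turnstile> Sig A B type Col"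
  by (simp add: F_Sig)

context
  fixes \<Gamma> A B
  assumes A: "\<Gamma> \<turnstile> A type Col" and B: "A # \<Gamma> \<turnstile> B type Col"
begin

lemma pfst_motive: "Sig A B # \<Gamma> \<turnstile> A \<bullet> wk 1 type Col"
  by (rule wk1_ty[OF A F_Sig_Col[OF A B]])

lemma pfst_branch: "B # A # \<Gamma> \<turnstile> Var 1 \<Colon> A \<bullet> wk 1 \<bullet> (Pair (A \<bullet> wk 2) (B \<bullet> up (wk 2)) (Var 1) (Var 0) \<cdot> wk 2)"
  using sig_ctx(3)[OF A B] by (simp add: sigma)

lemma pfst_tm: "\<Gamma> \<turnstile> d \<Colon> Sig A B \<Longrightarrow> \<Gamma> \<turnstile> pfst A B d \<Colon> A"
  using E_Sig[OF A B pfst_motive _ pfst_branch, of d] by (simp add: pfst_def sigma)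

lemma pfst_cong: "\<Gamma> \<turnstile> d \<doteq> d' \<Colon> Sig A B \<Longrightarrow> \<Gamma> \<turnstile> pfst A B d \<doteq> pfst A B d' \<Colon> A"
  using C_ElSig[OF ty_refl[OF A] ty_refl[OF B] ty_refl[OF pfst_motive] _ tm_refl[OF pfst_branch], of d d'] by (simp add: pfst_def sigma)

lemma pfst_Pair: "\<lbrakk>\<Gamma> \<turnstile> a \<Colon> A; \<Gamma> \<turnstile> b \<Colon> B \<bullet> (a \<cdot> Var)\<rbrakk> \<Longrightarrow> \<Gamma> \<turnstile> pfst A B (Pair A B a b) \<doteq> a \<Colon> A"
  using B_Sig[OF A B pfst_motive _ _ pfst_branch, of a b] by (simp add: pfst_def sigma)

end

context
  fixes \<Gamma> A B
  assumes A: "\<Gamma> \<turnstile> A type Col" and B: "A # \<Gamma> \<turnstile> B type Col"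
begin

lemma psnd_motive: "Sig A B # \<Gamma> \<turnstile> B \<bullet> (pfst (A \<bullet> wk 1) (B \<bullet> up (wk 1)) (Var 0) \<cdot> wk 1) type Col"
proof -
  note w = wk_ctx1[OF F_Sig_Col[OF A B]]
  show ?thesis
    by (rule mor_ty[OF B mor_scons[OF w pfst_tm[OF wk_A[OF A B w] wk_B[OF A B w] hyp0[OF F_Sig_Col[OF A B], unfolded sub_ty.simps]]]])
qed

text \<open>
  At a pair the motive is \<open>B\<close> at the first projection of the pair, which beta identifies with the
  first component.
\<close>
lemma psnd_branch:
  "B # A # \<Gamma> \<turnstile> Var 0 \<Colon> B \<bullet> (pfst (A \<bullet> wk 1) (B \<bullet> up (wk 1)) (Var 0) \<cdot> wk 1) \<bullet> (Pair (A \<bullet> wk 2) (B \<bullet> up (wk 2)) (Var 1) (Var 0) \<cdot> wk 2)"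
proof -
  note s = sig_ctx[OF A B]
  note f = pfst_Pair[OF wk_A[OF A B s(1)] wk_B[OF A B s(1)] s(3,4)]
  have "B # A # \<Gamma> \<turnstile> Var 0 \<Colon> B \<bullet> (Var 1 \<cdot> wk 2)" using s(4) by (simp add: sigma)
  from conv[OF this inst_eq_ty[OF ty_refl[OF B] s(1) tm_sym[OF f] s(3) eq_tm_l[OF f]]]
  show ?thesis by (simp add: pfst_sub sigma)
qed

lemma psnd_tm: "\<Gamma> \<turnstile> d \<Colon> Sig A B \<Longrightarrow> \<Gamma> \<turnstile> psnd A B d \<Colon> B \<bullet> (pfst A B d \<cdot> Var)"
  using E_Sig[OF A B psnd_motive _ psnd_branch, of d] by (simp add: psnd_def pfst_sub sigma)

lemma psnd_cong: "\<Gamma> \<turnstile> d \<doteq> d' \<Colon> Sig A B \<Longrightarrow> \<Gamma> \<turnstile> psnd A B d \<doteq> psnd A B d' \<Colon> B \<bullet> (pfst A B d \<cdot> Var)"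
  using C_ElSig[OF ty_refl[OF A] ty_refl[OF B] ty_refl[OF psnd_motive] _ tm_refl[OF psnd_branch], of d d'] by (simp add: psnd_def pfst_sub sigma)

lemma psnd_Pair:
  assumes "\<Gamma> \<turnstile> a \<Colon> A" "\<Gamma> \<turnstile> b \<Colon> B \<bullet> (a \<cdot> Var)"
  shows "\<Gamma> \<turnstile> psnd A B (Pair A B a b) \<doteq> b \<Colon> B \<bullet> (a \<cdot> Var)"
proof -
  note f = pfst_Pair[OF A B assms]
  note e = inst_eq_ty_Var[OF ty_refl[OF B] f eq_tm_l[OF f] assms(1)]
  have "\<Gamma> \<turnstile> psnd A B (Pair A B a b) \<doteq> b \<Colon> B \<bullet> (pfst A B (Pair A B a b) \<cdot> Var)"
    using B_Sig[OF A B psnd_motive assms psnd_branch] by (simp add: psnd_def pfst_sub sigma)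
  from conv_eq[OF this e] show ?thesis .
qed

lemma Pair_cong:
  assumes "\<Gamma> \<turnstile> a \<doteq> a' \<Colon> A" "\<Gamma> \<turnstile> b \<doteq> b' \<Colon> B \<bullet> (a \<cdot> Var)"
  shows "\<Gamma> \<turnstile> Pair A B a b \<doteq> Pair A B a' b' \<Colon> Sig A B"
  by (rule C_Pair[OF ty_refl[OF A] ty_refl[OF B] assms])

end

text \<open>
  Eliminate into the proposition that \<open>z\<close> equals the pair of its projections, and reflect.
\<close>
lemma Pair_eta:
  assumes A: "\<Gamma> \<turnstile> A type Col" and B: "A # \<Gamma> \<turnstile> B type Col" and d: "\<Gamma> \<turnstile> d \<Colon> Sig A B"
  shows "\<Gamma> \<turnstile> d \<doteq> Pair A B (pfst A B d) (psnd A B d) \<Colon> Sig A B"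
proof -
  have re: "\<Gamma> \<turnstile> Pair A B (pfst A B d) (psnd A B d) \<Colon> Sig A B"
    if "\<Gamma> \<turnstile> A type Col" "A # \<Gamma> \<turnstile> B type Col" "\<Gamma> \<turnstile> d \<Colon> Sig A B" for \<Gamma> A B d
    by (rule I_Sig[OF that(1,2) pfst_tm[OF that] psnd_tm[OF that]])
  let ?L = "Eq (Sig A B \<bullet> wk 1) (Var 0) (Pair (A \<bullet> wk 1) (B \<bullet> up (wk 1)) (pfst (A \<bullet> wk 1) (B \<bullet> up (wk 1)) (Var 0)) (psnd (A \<bullet> wk 1) (B \<bullet> up (wk 1)) (Var 0)))"
  note S = F_Sig_Col[OF A B]
  note w = wk_ctx1[OF S]
  have L: "Sig A B # \<Gamma> \<turnstile> ?L type Prop"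
    unfolding sub_ty.simps
    by (intro F_Eq_Prop re wk_A[OF A B w] wk_B[OF A B w] hyp0[OF S, unfolded sub_ty.simps])
  note s = sig_ctx[OF A B]
  note a = wk_A[OF A B s(1)] and b = wk_B[OF A B s(1)]
  let ?p = "Pair (A \<bullet> wk 2) (B \<bullet> up (wk 2)) (Var 1) (Var 0)"
  have "B # A # \<Gamma> \<turnstile> Pair (A \<bullet> wk 2) (B \<bullet> up (wk 2)) (pfst (A \<bullet> wk 2) (B \<bullet> up (wk 2)) ?p) (psnd (A \<bullet> wk 2) (B \<bullet> up (wk 2)) ?p) \<doteq> ?p \<Colon> Sig A B \<bullet> wk 2"
    unfolding sub_ty.simps
    using psnd_Pair[OF a b s(3,4)] pfst_Pair[OF a b s(3,4)] inst_eq_ty_Var[OF ty_refl[OF b], of "pfst (A \<bullet> wk 2) (B \<bullet> up (wk 2)) ?p" "Var 1"]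
    by (intro Pair_cong[OF a b]) (meson conv_eq ty_sym eq_tm_l eq_tm_r)+
  then have "B # A # \<Gamma> \<tturnstile> ?L \<bullet> (?p \<cdot> wk 2)"
    using eq_true[OF tm_sym] by (simp add: sigma pfst_sub psnd_sub)
  from E_Sig[OF A B ty_Col[OF L] d this]
  have "\<Gamma> \<tturnstile> ?L \<bullet> (d \<cdot> Var)" using true_I[OF inst_ty[OF L d]] by blast
  then have "\<Gamma> \<tturnstile> Eq (Sig A B) d (Pair A B (pfst A B d) (psnd A B d))"
    by (simp add: sigma pfst_sub psnd_sub)
  then show ?thesis using d re[OF A B d] by (rule eq_reflect)
qed

lemma Sig_ext:
  assumes A: "\<Gamma> \<turnstile> A type Col" and B: "A # \<Gamma> \<turnstile> B type Col"
    and d: "\<Gamma> \<turnstile> d \<Colon> Sig A B" "\<Gamma> \<turnstile> d' \<Colon> Sig A B"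
    and "\<Gamma> \<turnstile> pfst A B d \<doteq> pfst A B d' \<Colon> A" "\<Gamma> \<turnstile> psnd A B d \<doteq> psnd A B d' \<Colon> B \<bullet> (pfst A B d \<cdot> Var)"
  shows "\<Gamma> \<turnstile> d \<doteq> d' \<Colon> Sig A B"
  using Pair_eta[OF A B d(1)] Pair_eta[OF A B d(2)] Pair_cong[OF A B assms(5,6)] by (blast intro: tm_sym tm_trans)

text \<open>
  The second components are proofs of the same proposition, so the first components decide.
\<close>
lemma Sig_ext_prop:
  assumes A: "\<Gamma> \<turnstile> A type Col" and B: "A # \<Gamma> \<turnstile> B type Prop"
    and d: "\<Gamma> \<turnstile> d \<Colon> Sig A B" "\<Gamma> \<turnstile> d' \<Colon> Sig A B"
    and e: "\<Gamma> \<turnstile> pfst A B d \<doteq> pfst A B d' \<Colon> A"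
  shows "\<Gamma> \<turnstile> d \<doteq> d' \<Colon> Sig A B"
proof (rule Sig_ext[OF A ty_Col[OF B] d e])
  note f = pfst_tm[OF A ty_Col[OF B]] and s = psnd_tm[OF A ty_Col[OF B]]
  show "\<Gamma> \<turnstile> psnd A B d \<doteq> psnd A B d' \<Colon> B \<bullet> (pfst A B d \<cdot> Var)"
    by (rule proof_irr[OF inst_ty[OF B f[OF d(1)]] s[OF d(1)]
      conv[OF s[OF d(2)] ty_sym[OF inst_eq_ty_Var[OF ty_refl[OF ty_Col[OF B]] e f[OF d(1)] f[OF d(2)]]]]])
qed

section \<open>Stable equality of propositions, pairs and functions\<close>

text \<open>
  Not not equal elements are equal, in every context with a morphism to \<open>\<Gamma>\<close>. The quantification
  makes the notion stable under substitution by definition, and taking for the context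
  \<open>\<Gamma>\<close> extended by two variables of type \<open>A\<close> gives back the formula with free variables.
\<close>
definition stable_eq :: "ty list \<Rightarrow> ty \<Rightarrow> bool" where
  "stable_eq \<Gamma> A \<longleftrightarrow> (\<forall>\<Theta> \<sigma> a b. mor \<Theta> \<sigma> \<Gamma> \<longrightarrow> \<Theta> \<turnstile> a \<Colon> A \<bullet> \<sigma> \<longrightarrow> \<Theta> \<turnstile> b \<Colon> A \<bullet> \<sigma> \<longrightarrow>
     \<Theta> \<tturnstile> Stab (Eq (A \<bullet> \<sigma>) a b))"

lemma Stab_Eq_I:
  assumes "\<Gamma> \<turnstile> a \<Colon> A" "\<Gamma> \<turnstile> b \<Colon> A"
    "\<And>\<Theta> \<sigma>. \<lbrakk>mor \<Theta> \<sigma> \<Gamma>; \<Theta> \<tturnstile> Neg (Neg (Eq (A \<bullet> \<sigma>) (a \<star> \<sigma>) (b \<star> \<sigma>)))\<rbrakk> \<Longrightarrow> \<Theta> \<turnstile> a \<star> \<sigma> \<doteq> b \<star> \<sigma> \<Colon> A \<bullet> \<sigma>"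
  shows "\<Gamma> \<tturnstile> Stab (Eq A a b)"
  using assms by (intro Stab_I F_Eq_Prop) (auto intro: eq_true)

lemma Stab_Eq_E:
  assumes "\<Gamma> \<tturnstile> Stab (Eq A a b)" "\<Gamma> \<turnstile> a \<Colon> A" "\<Gamma> \<turnstile> b \<Colon> A"  "\<Gamma> \<tturnstile> Neg (Neg (Eq A a b))"
  shows "\<Gamma> \<turnstile> a \<doteq> b \<Colon> A"
  by (rule eq_reflect[OF Stab_E[OF F_Eq_Prop[OF assms(2,3)] assms(1,4)] assms(2,3)])

lemma stable_eq_I:
  assumes "\<And>\<Theta> \<sigma> a b. \<lbrakk>mor \<Theta> \<sigma> \<Gamma>; \<Theta> \<turnstile> a \<Colon> A \<bullet> \<sigma>; \<Theta> \<turnstile> b \<Colon> A \<bullet> \<sigma>;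
    \<Theta> \<tturnstile> Neg (Neg (Eq (A \<bullet> \<sigma>) a b))\<rbrakk> \<Longrightarrow> \<Theta> \<turnstile> a \<doteq> b \<Colon> A \<bullet> \<sigma>"
  shows "stable_eq \<Gamma> A"
  unfolding stable_eq_def
proof (intro allI impI)
  fix \<Theta> \<sigma> a b assume *: "mor \<Theta> \<sigma> \<Gamma>" "\<Theta> \<turnstile> a \<Colon> A \<bullet> \<sigma>" "\<Theta> \<turnstile> b \<Colon> A \<bullet> \<sigma>"
  show "\<Theta> \<tturnstile> Stab (Eq (A \<bullet> \<sigma>) a b)"
  proof (rule Stab_Eq_I[OF *(2,3)])
    fix \<Xi> \<tau> assume t: "mor \<Xi> \<tau> \<Theta>" and "\<Xi> \<tturnstile> Neg (Neg (Eq (A \<bullet> \<sigma> \<bullet> \<tau>) (a \<star> \<tau>) (b \<star> \<tau>)))"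
    then show "\<Xi> \<turnstile> a \<star> \<tau> \<doteq> b \<star> \<tau> \<Colon> A \<bullet> \<sigma> \<bullet> \<tau>"
      using assms[OF mor_comp[OF *(1) t]] mor_tm[OF *(2) t] mor_tm[OF *(3) t] by (simp add: sub_sub)
  qed
qed

lemma stable_eq_D: "\<lbrakk>stable_eq \<Gamma> A; \<Gamma> \<turnstile> a \<Colon> A; \<Gamma> \<turnstile> b \<Colon> A\<rbrakk> \<Longrightarrow> \<Gamma> \<tturnstile> Stab (Eq A a b)"
  unfolding stable_eq_def using mor_id[of \<Gamma>] ctx_of(3)[of \<Gamma> a A] by (metis sub_id(1))

lemma stable_eq_E: "\<lbrakk>stable_eq \<Gamma> A; \<Gamma> \<turnstile> a \<Colon> A; \<Gamma> \<turnstile> b \<Colon> A; \<Gamma> \<tturnstile> Neg (Neg (Eq A a b))\<rbrakk> \<Longrightarrow> \<Gamma> \<turnstile> a \<doteq> b \<Colon> A"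
  by (rule Stab_Eq_E[OF stable_eq_D])

lemma stable_eq_mor: "\<lbrakk>stable_eq \<Gamma> A; mor \<Theta> \<sigma> \<Gamma>\<rbrakk> \<Longrightarrow> stable_eq \<Theta> (A \<bullet> \<sigma>)"
  unfolding stable_eq_def by (metis mor_comp sub_sub(1))

text \<open>
  An equation at \<open>B\<close> is an equation at \<open>A\<close>, by reflection and conversion.
\<close>
lemma stable_eq_conv:
  assumes "stable_eq \<Gamma> A" "\<Gamma> \<turnstile> A \<doteq> B type K"
  shows "stable_eq \<Gamma> B"
proof (rule stable_eq_I)
  fix \<Theta> \<sigma> a b assume *: "mor \<Theta> \<sigma> \<Gamma>" "\<Theta> \<turnstile> a \<Colon> B \<bullet> \<sigma>" "\<Theta> \<turnstile> b \<Colon> B \<bullet> \<sigma>" "\<Theta> \<tturnstile> Neg (Neg (Eq (B \<bullet> \<sigma>) a b))"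
  note e = eq_ty_Col[OF mor_eq_ty[OF assms(2) *(1)]]
  note a = conv[OF *(2) ty_sym[OF e]] and b = conv[OF *(3) ty_sym[OF e]]
  have "\<Theta> \<tturnstile> Neg (Neg (Eq (A \<bullet> \<sigma>) a b))"
  proof (rule nn_mono[OF F_Eq_Prop[OF *(2,3)] F_Eq_Prop[OF a b] *(4)])
    note f = F_Eq_Prop[OF *(2,3)]
    note w = wk_ctx1[OF f]
    have "Eq (B \<bullet> \<sigma>) a b # \<Theta> \<turnstile> a \<star> wk 1 \<doteq> b \<star> wk 1 \<Colon> B \<bullet> \<sigma> \<bullet> wk 1"
      by (rule eq_reflect[OF hyp_true[OF f, unfolded sub_ty.simps] mor_tm[OF *(2) w] mor_tm[OF *(3) w]])
    from eq_true[OF conv_eq[OF this ty_sym[OF mor_eq_ty[OF e w]]]]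
    show "Eq (B \<bullet> \<sigma>) a b # \<Theta> \<tturnstile> Eq (A \<bullet> \<sigma>) a b \<bullet> wk 1" by simp
  qed
  from conv_eq[OF stable_eq_E[OF stable_eq_mor[OF assms(1) *(1)] a b this] e]
  show "\<Theta> \<turnstile> a \<doteq> b \<Colon> B \<bullet> \<sigma>" .
qed

lemma Falsum_eq: "\<lbrakk>\<Gamma> \<tturnstile> Falsum; \<Gamma> \<turnstile> a \<Colon> A; \<Gamma> \<turnstile> b \<Colon> A\<rbrakk> \<Longrightarrow> \<Gamma> \<turnstile> a \<doteq> b \<Colon> A"
  by (rule eq_reflect[OF E_Falsum[OF _ F_Eq_Prop]])

lemma stable_eq_prop: "\<Gamma> \<turnstile> \<phi> type Prop \<Longrightarrow> stable_eq \<Gamma> \<phi>"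
  by (rule stable_eq_I) (blast intro: proof_irr mor_ty)

text \<open>
  Every element of the empty set yields falsum.
\<close>
lemma stable_eq_N0: "stable_eq \<Gamma> N0"
proof (rule stable_eq_I)
  fix \<Theta> \<sigma> a b assume *: "\<Theta> \<turnstile> a \<Colon> N0 \<bullet> \<sigma>" "\<Theta> \<turnstile> b \<Colon> N0 \<bullet> \<sigma>"
  note c = ctx_of(3)[OF *(1)]
  have "N0 # \<Theta> \<turnstile> Falsum type Col" by (rule ty_Col[OF F_Falsum[OF ctx_cons[OF F_N0[OF c]]]])
  from E_N0[OF this *(1)[unfolded sub_ty.simps]] have "\<Theta> \<tturnstile> Falsum"
    using true_I[OF F_Falsum_Prop[OF c]] by simp
  then show "\<Theta> \<turnstile> a \<doteq> b \<Colon> N0 \<bullet> \<sigma>" using * by (rule Falsum_eq)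
qed

lemma N1_eta: assumes a: "\<Gamma> \<turnstile> a \<Colon> N1" shows "\<Gamma> \<turnstile> a \<doteq> Star \<Colon> N1"
proof -
  note c = ctx_of(3)[OF a]
  note n = F_N1[OF c]
  have L: "N1 # \<Gamma> \<turnstile> Eq N1 (Var 0) Star type Prop"
    using hyp0[OF n] I_N1[OF ctx_cons[OF n]] by (intro F_Eq_Prop) simp_all
  have "\<Gamma> \<turnstile> ElN1 (Eq N1 (Var 0) Star) a true \<Colon> Eq N1 (Var 0) Star \<bullet> (a \<cdot> Var)"
    using eq_true[OF tm_refl[OF I_N1[OF c]]] by (intro E_N1 ty_Col[OF L] a) simp
  from true_I[OF inst_ty[OF L a] this] show ?thesis using a I_N1[OF c] by (intro eq_reflect) simp_all
qed

lemma stable_eq_N1: "stable_eq \<Gamma> N1"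
  by (rule stable_eq_I) (simp, metis N1_eta tm_sym tm_trans)

text \<open>
  First components are not not equal, hence equal. Only then do the second components have a
  common type, an instance of \<open>B\<close> at one element, where stability of \<open>B\<close> applies.
\<close>
lemma stable_eq_Sig:
  assumes "\<Gamma> \<turnstile> A type Col" "A # \<Gamma> \<turnstile> B type Col" "stable_eq \<Gamma> A" "stable_eq (A # \<Gamma>) B"
  shows "stable_eq \<Gamma> (Sig A B)"
proof (rule stable_eq_I)
  fix \<Theta> \<sigma> d d' assume s: "mor \<Theta> \<sigma> \<Gamma>" and
    "\<Theta> \<turnstile> d \<Colon> Sig A B \<bullet> \<sigma>" "\<Theta> \<turnstile> d' \<Colon> Sig A B \<bullet> \<sigma>" "\<Theta> \<tturnstile> Neg (Neg (Eq (Sig A B \<bullet> \<sigma>) d d'))"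
  moreover define A' where "A' = A \<bullet> \<sigma>"
  moreover define B' where "B' = B \<bullet> up \<sigma>"
  ultimately have d: "\<Theta> \<turnstile> d \<Colon> Sig A' B'" "\<Theta> \<turnstile> d' \<Colon> Sig A' B'" and nn: "\<Theta> \<tturnstile> Neg (Neg (Eq (Sig A' B') d d'))"
    by simp_all
  have A: "\<Theta> \<turnstile> A' type Col" "stable_eq \<Theta> A'" unfolding A'_def by (rule mor_ty stable_eq_mor assms s)+
  note u = mor_up[OF s A(1)[unfolded A'_def], folded A'_def]
  have B: "A' # \<Theta> \<turnstile> B' type Col" "stable_eq (A' # \<Theta>) B'" unfolding B'_def by (rule mor_ty[OF _ u] stable_eq_mor[OF _ u] assms)+
  note f = pfst_tm[OF A(1) B(1)] and g = psnd_tm[OF A(1) B(1)]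
  have "\<Theta> \<tturnstile> Neg (Neg (Eq A' (pfst A' B' d) (pfst A' B' d')))"
  proof (rule nn_eq_map[OF nn d F_Eq_Prop[OF f[OF d(1)] f[OF d(2)]]])
    fix \<Xi> \<tau> assume t: "mor \<Xi> \<tau> \<Theta>" and e: "\<Xi> \<turnstile> d \<star> \<tau> \<doteq> d' \<star> \<tau> \<Colon> Sig A' B' \<bullet> \<tau>"
    show "\<Xi> \<tturnstile> Eq A' (pfst A' B' d) (pfst A' B' d') \<bullet> \<tau>"
      using pfst_cong[OF wk_A[OF A(1) B(1) t] wk_B[OF A(1) B(1) t]] e by (simp add: eq_true pfst_sub)
  qed
  from stable_eq_E[OF A(2) f[OF d(1)] f[OF d(2)] this]
  have e1: "\<Theta> \<turnstile> pfst A' B' d \<doteq> pfst A' B' d' \<Colon> A'" .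
  have g': "\<Theta> \<turnstile> psnd A' B' d' \<Colon> B' \<bullet> (pfst A' B' d \<cdot> Var)"
    by (rule conv[OF g[OF d(2)] ty_sym[OF inst_eq_ty_Var[OF ty_refl[OF B(1)] e1 f[OF d(1)] f[OF d(2)]]]])
  have "\<Theta> \<tturnstile> Neg (Neg (Eq (B' \<bullet> (pfst A' B' d \<cdot> Var)) (psnd A' B' d) (psnd A' B' d')))"
  proof (rule nn_eq_map[OF nn d F_Eq_Prop[OF g[OF d(1)] g']])
    fix \<Xi> \<tau> assume t: "mor \<Xi> \<tau> \<Theta>" and e: "\<Xi> \<turnstile> d \<star> \<tau> \<doteq> d' \<star> \<tau> \<Colon> Sig A' B' \<bullet> \<tau>"
    show "\<Xi> \<tturnstile> Eq (B' \<bullet> (pfst A' B' d \<cdot> Var)) (psnd A' B' d) (psnd A' B' d') \<bullet> \<tau>"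
      using eq_true[OF psnd_cong[OF wk_A[OF A(1) B(1) t] wk_B[OF A(1) B(1) t]]] e by (simp add: psnd_sub pfst_sub sigma)
  qed
  from stable_eq_E[OF stable_eq_mor[OF B(2) mor_inst[OF ctx_of(3)[OF d(1)] f[OF d(1)]]] g[OF d(1)] g' this]
  have "\<Theta> \<turnstile> d \<doteq> d' \<Colon> Sig A' B'"
    by (rule Sig_ext[OF A(1) B(1) d e1])
  then show "\<Theta> \<turnstile> d \<doteq> d' \<Colon> Sig A B \<bullet> \<sigma>" by (simp add: A'_def B'_def)
qed

lemma Pi_ext:
  assumes "\<Gamma> \<turnstile> A type Set" "A # \<Gamma> \<turnstile> B type Set" "\<Gamma> \<turnstile> f \<Colon> Pi A B" "\<Gamma> \<turnstile> g \<Colon> Pi A B"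
    "A # \<Gamma> \<turnstile> Ap (A \<bullet> wk 1) (B \<bullet> up (wk 1)) (f \<star> wk 1) (Var 0) \<doteq> Ap (A \<bullet> wk 1) (B \<bullet> up (wk 1)) (g \<star> wk 1) (Var 0) \<Colon> B"
  shows "\<Gamma> \<turnstile> f \<doteq> g \<Colon> Pi A B"
  using eta_Pi[OF assms(1,2,3)] eta_Pi[OF assms(1,2,4)] C_Lam[OF ty_refl[OF assms(1)] ty_refl[OF assms(2)] assms(5)]
  by (blast intro: tm_trans tm_sym)

text \<open>
  By eta, functions are equal when their values at a fresh variable are.
\<close>
lemma stable_eq_Pi:
  assumes "\<Gamma> \<turnstile> A type Set" "A # \<Gamma> \<turnstile> B type Set" "stable_eq (A # \<Gamma>) B"
  shows "stable_eq \<Gamma> (Pi A B)"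
proof (rule stable_eq_I)
  fix \<Theta> \<sigma> f g assume s: "mor \<Theta> \<sigma> \<Gamma>" and
    "\<Theta> \<turnstile> f \<Colon> Pi A B \<bullet> \<sigma>" "\<Theta> \<turnstile> g \<Colon> Pi A B \<bullet> \<sigma>" "\<Theta> \<tturnstile> Neg (Neg (Eq (Pi A B \<bullet> \<sigma>) f g))"
  moreover define A' where "A' = A \<bullet> \<sigma>"
  moreover define B' where "B' = B \<bullet> up \<sigma>"
  ultimately have d: "\<Theta> \<turnstile> f \<Colon> Pi A' B'" "\<Theta> \<turnstile> g \<Colon> Pi A' B'" and nn: "\<Theta> \<tturnstile> Neg (Neg (Eq (Pi A' B') f g))"
    by simp_all
  have A: "\<Theta> \<turnstile> A' type Set" unfolding A'_def by (rule mor_ty assms s)+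
  note u = mor_up[OF s A(1)[unfolded A'_def, THEN ty_Col], folded A'_def]
  have B: "A' # \<Theta> \<turnstile> B' type Set" "stable_eq (A' # \<Theta>) B'" unfolding B'_def by (rule mor_ty[OF _ u] stable_eq_mor[OF _ u] assms)+
  note w = wk_ctx1[OF A]
  have ap: "A' # \<Theta> \<turnstile> Ap (A' \<bullet> wk 1) (B' \<bullet> up (wk 1)) (f \<star> wk 1) (Var 0) \<Colon> B'" if "\<Theta> \<turnstile> f \<Colon> Pi A' B'" for f
    using E_Pi[OF mor_ty[OF A w] mor_ty[OF B(1) mor_up[OF w ty_Col[OF mor_ty[OF A w]]]] mor_tm[OF that w, unfolded sub_ty.simps] hyp0[OF A]]
    by (simp add: sigma)
  let ?F = "Ap (A' \<bullet> wk 1) (B' \<bullet> up (wk 1)) (f \<star> wk 1) (Var 0)"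
  let ?G = "Ap (A' \<bullet> wk 1) (B' \<bullet> up (wk 1)) (g \<star> wk 1) (Var 0)"
  have "A' # \<Theta> \<tturnstile> Neg (Neg (Eq B' ?F ?G))"
  proof (rule nn_eq_map[OF _ mor_tm[OF d(1) w] mor_tm[OF d(2) w] F_Eq_Prop[OF ap[OF d(1)] ap[OF d(2)]]])
    show "A' # \<Theta> \<tturnstile> Neg (Neg (Eq (Pi A' B' \<bullet> wk 1) (f \<star> wk 1) (g \<star> wk 1)))"
      using mor_true[OF nn w] by simp
    fix \<Xi> \<tau> assume t: "mor \<Xi> \<tau> (A' # \<Theta>)" and e: "\<Xi> \<turnstile> f \<star> wk 1 \<star> \<tau> \<doteq> g \<star> wk 1 \<star> \<tau> \<Colon> Pi A' B' \<bullet> wk 1 \<bullet> \<tau>"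
    note wt = mor_comp[OF w t]
    have "\<Xi> \<tturnstile> Eq (B' \<bullet> up (wk 1 \<odot> \<tau>) \<bullet> (\<tau> 0 \<cdot> Var)) (Ap (A' \<bullet> (wk 1 \<odot> \<tau>)) (B' \<bullet> up (wk 1 \<odot> \<tau>)) (f \<star> wk 1 \<star> \<tau>) (\<tau> 0)) (Ap (A' \<bullet> (wk 1 \<odot> \<tau>)) (B' \<bullet> up (wk 1 \<odot> \<tau>)) (g \<star> wk 1 \<star> \<tau>) (\<tau> 0))"
      using e mor_tm[OF hyp0[OF A] t] mor_up[OF wt ty_Col[OF mor_ty[OF A wt]]]
      by (intro eq_true C_Ap ty_refl mor_ty[OF A wt] mor_ty[OF B(1)] tm_refl) (simp_all add: sub_sub up_comp)
    moreover have "\<tau> 0 \<cdot> (wk (Suc 0) \<odot> \<tau>) = \<tau>"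
      by (rule ext) (simp add: scons_def comp_sub_def wk_def split: nat.split)
    ultimately show "\<Xi> \<tturnstile> Eq B' ?F ?G \<bullet> \<tau>"
      by (simp add: sigma)
  qed
  from stable_eq_E[OF B(2) ap[OF d(1)] ap[OF d(2)] this]
  have "\<Theta> \<turnstile> f \<doteq> g \<Colon> Pi A' B'" by (rule Pi_ext[OF A B(1) d])
  then show "\<Theta> \<turnstile> f \<doteq> g \<Colon> Pi A B \<bullet> \<sigma>" by (simp add: A'_def B'_def)
qed

section \<open>Stable equality of quotients\<close>

text \<open>
  A true proposition about a quotient may be checked on representatives: the branch of the
  eliminator is \<open>true\<close>, for which compatibility with the relation is reflexivity.
\<close>
lemma Quot_cases:
  assumes Q: "\<Gamma> \<turnstile> Quot A R type Set" and \<phi>: "Quot A R # \<Gamma> \<turnstile> \<phi> type Prop"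
   and p: "\<Gamma> \<turnstile> p \<Colon> Quot A R"
   and c: "\<And>\<Theta> \<sigma> a. \<lbrakk>mor \<Theta> \<sigma> \<Gamma>; \<Theta> \<turnstile> a \<Colon> A \<bullet> \<sigma>\<rbrakk> \<Longrightarrow> \<Theta> \<tturnstile> \<phi> \<bullet> (Cls (A \<bullet> \<sigma>) (R \<bullet> up (up \<sigma>)) a \<cdot> \<sigma>)"
  shows "\<Gamma> \<tturnstile> \<phi> \<bullet> (p \<cdot> Var)"
proof (rule true_I[OF inst_ty[OF \<phi> p]])
  note q = quot_ctx[OF Q]
  show "\<Gamma> \<turnstile> ElQ A R \<phi> p true \<Colon> \<phi> \<bullet> (p \<cdot> Var)"
    using c[OF wk_ctx1[OF q(1)] hyp0[OF q(1)]] c[OF q(4,5)]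
    by (intro E_Quot Q ty_Col[OF \<phi>] p) (simp_all add: tm_refl)
qed

text \<open>
  By effectivity, not not equal classes have not not related representatives.
\<close>
lemma stable_Cls:
  assumes Q: "\<Gamma> \<turnstile> Quot A R type Set" and R: "A \<bullet> wk 1 # A # \<Gamma> \<tturnstile> Stab R"
    and ab: "\<Gamma> \<turnstile> a \<Colon> A" "\<Gamma> \<turnstile> b \<Colon> A"
    and nn: "\<Gamma> \<tturnstile> Neg (Neg (Eq (Quot A R) (Cls A R a) (Cls A R b)))"
  shows "\<Gamma> \<turnstile> Cls A R a \<doteq> Cls A R b \<Colon> Quot A R"
proof -
  note m = rel_mor[OF ctx_of(3)[OF ab(1)] ab]
  note r = PropS_Prop[OF mor_ty[OF quot_ctx(3)[OF Q] m]]
  have "\<Gamma> \<tturnstile> Neg (Neg (rel R 0 a b))"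
    unfolding wk_0
  proof (rule nn_eq_map[OF nn I_Quot[OF Q ab(1)] I_Quot[OF Q ab(2)] r])
    fix \<Theta> \<sigma> assume s: "mor \<Theta> \<sigma> \<Gamma>" and e: "\<Theta> \<turnstile> Cls A R a \<star> \<sigma> \<doteq> Cls A R b \<star> \<sigma> \<Colon> Quot A R \<bullet> \<sigma>"
    from eff_Quot[OF mor_ty[OF Q s, unfolded sub_ty.simps] mor_tm[OF ab(1) s] mor_tm[OF ab(2) s]] e
    show "\<Theta> \<tturnstile> R \<bullet> (b \<cdot> a \<cdot> Var) \<bullet> \<sigma>" by (simp add: sigma)
  qed
  then have "\<Gamma> \<tturnstile> rel R 0 a b" using Stab_E[OF r] mor_true[OF R m] by simp
  then show ?thesis by (rule eq_Quot[OF Q ab])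
qed

text \<open>
  Both elements are replaced by representatives, one after the other, by \<open>Quot_cases\<close>.
\<close>
lemma stable_eq_Quot:
  assumes "\<Gamma> \<turnstile> Quot A R type Set" "A \<bullet> wk 1 # A # \<Gamma> \<tturnstile> Stab R"
  shows "stable_eq \<Gamma> (Quot A R)"
proof -
  have Cls2: "\<Gamma> \<tturnstile> Stab (Eq (Quot A R) (Cls A R a) (Cls A R b))"
    if Q: "\<Gamma> \<turnstile> Quot A R type Set" and R: "A \<bullet> wk 1 # A # \<Gamma> \<tturnstile> Stab R"
      and ab: "\<Gamma> \<turnstile> a \<Colon> A" "\<Gamma> \<turnstile> b \<Colon> A" for \<Gamma> A R a b
  proof (rule Stab_Eq_I[OF I_Quot[OF Q ab(1)] I_Quot[OF Q ab(2)]])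
    fix \<Theta> \<sigma> assume s: "mor \<Theta> \<sigma> \<Gamma>" and nn: "\<Theta> \<tturnstile> Neg (Neg (Eq (Quot A R \<bullet> \<sigma>) (Cls A R a \<star> \<sigma>) (Cls A R b \<star> \<sigma>)))"
    from stable_Cls[OF mor_ty[OF Q s, unfolded sub_ty.simps] _ mor_tm[OF ab(1) s] mor_tm[OF ab(2) s]] nn
      mor_true[OF R mor_up2[OF s quot_ctx(1)[OF Q]]]
    show "\<Theta> \<turnstile> Cls A R a \<star> \<sigma> \<doteq> Cls A R b \<star> \<sigma> \<Colon> Quot A R \<bullet> \<sigma>" by simp
  qed
  have Cls1: "\<Gamma> \<tturnstile> Stab (Eq (Quot A R) (Cls A R a) p)"
    if Q: "\<Gamma> \<turnstile> Quot A R type Set" and R: "A \<bullet> wk 1 # A # \<Gamma> \<tturnstile> Stab R"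
      and a: "\<Gamma> \<turnstile> a \<Colon> A" and p: "\<Gamma> \<turnstile> p \<Colon> Quot A R" for \<Gamma> A R a p
  proof -
    let ?\<phi> = "Stab (Eq (Quot A R \<bullet> wk 1) (Cls A R a \<star> wk 1) (Var 0))"
    have "\<Gamma> \<tturnstile> ?\<phi> \<bullet> (p \<cdot> Var)"
    proof (rule Quot_cases[OF Q _ p])
      show "Quot A R # \<Gamma> \<turnstile> ?\<phi> type Prop"
        by (intro F_Stab_Prop F_Eq_Prop mor_tm[OF I_Quot[OF Q a] wk_ctx1[OF Q]] hyp0[OF Q])
      fix \<Theta> \<sigma> b assume s: "mor \<Theta> \<sigma> \<Gamma>" and "\<Theta> \<turnstile> b \<Colon> A \<bullet> \<sigma>"
      then show "\<Theta> \<tturnstile> ?\<phi> \<bullet> (Cls (A \<bullet> \<sigma>) (R \<bullet> up (up \<sigma>)) b \<cdot> \<sigma>)"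
        using Cls2[OF mor_ty[OF Q s, unfolded sub_ty.simps] _ mor_tm[OF a s]] mor_true[OF R mor_up2[OF s quot_ctx(1)[OF Q]]]
        by (simp add: sigma)
    qed
    then show ?thesis by (simp add: sigma)
  qed
  show ?thesis
    unfolding stable_eq_def
  proof (intro allI impI)
    fix \<Theta> \<sigma> p q assume s: "mor \<Theta> \<sigma> \<Gamma>" and "\<Theta> \<turnstile> p \<Colon> Quot A R \<bullet> \<sigma>" "\<Theta> \<turnstile> q \<Colon> Quot A R \<bullet> \<sigma>"
    moreover define A' where "A' = A \<bullet> \<sigma>"
    moreover define R' where "R' = R \<bullet> up (up \<sigma>)"
    ultimately have p: "\<Theta> \<turnstile> p \<Colon> Quot A' R'" and q: "\<Theta> \<turnstile> q \<Colon> Quot A' R'" by simp_all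
    have Q: "\<Theta> \<turnstile> Quot A' R' type Set" and R: "A' \<bullet> wk 1 # A' # \<Theta> \<tturnstile> Stab R'"
      using mor_ty[OF assms(1) s] mor_true[OF assms(2) mor_up2[OF s quot_ctx(1)[OF assms(1)]]] by (simp_all add: A'_def R'_def)
    let ?\<phi> = "Stab (Eq (Quot A' R' \<bullet> wk 1) (Var 0) (q \<star> wk 1))"
    have "\<Theta> \<tturnstile> ?\<phi> \<bullet> (p \<cdot> Var)"
    proof (rule Quot_cases[OF Q _ p])
      show "Quot A' R' # \<Theta> \<turnstile> ?\<phi> type Prop"
        by (intro F_Stab_Prop F_Eq_Prop mor_tm[OF q wk_ctx1[OF Q]] hyp0[OF Q])
      fix \<Xi> \<tau> b assume t: "mor \<Xi> \<tau> \<Theta>" and "\<Xi> \<turnstile> b \<Colon> A' \<bullet> \<tau>"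
      then show "\<Xi> \<tturnstile> ?\<phi> \<bullet> (Cls (A' \<bullet> \<tau>) (R' \<bullet> up (up \<tau>)) b \<cdot> \<tau>)"
        using Cls1[OF mor_ty[OF Q t, unfolded sub_ty.simps] _ _ mor_tm[OF q t, unfolded sub_ty.simps]]
          mor_true[OF R mor_up2[OF t quot_ctx(1)[OF Q]]]
        by (simp add: sigma)
    qed
    then show "\<Theta> \<tturnstile> Stab (Eq (Quot A R \<bullet> \<sigma>) p q)" by (simp add: sigma A'_def R'_def)
  qed
qed

section \<open>Power collection of the singleton\<close>

lemma Top_true: "T \<turnstile> \<Gamma> ctx \<Longrightarrow> \<Gamma> \<tturnstile> Top"
  unfolding Top_def using hyp_true[OF F_Falsum_Prop] by (auto intro: Neg_I F_Falsum_Prop)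

lemma Impl_wk: "\<lbrakk>\<Gamma> \<turnstile> \<phi> type Prop; \<Gamma> \<turnstile> \<psi> type Prop; \<Gamma> \<tturnstile> \<psi>\<rbrakk> \<Longrightarrow> \<Gamma> \<tturnstile> Impl \<phi> \<psi>"
  by (blast intro: I_Impl wk_true)

lemma F_Impl_Prop: "\<lbrakk>\<Gamma> \<turnstile> \<phi> type Prop; \<Gamma> \<turnstile> \<psi> type Prop\<rbrakk> \<Longrightarrow> \<Gamma> \<turnstile> Impl \<phi> \<psi> type Prop"
  by (simp add: F_Impl)

text \<open>
  A true proposition is equivalent to \<open>\<top>\<close>, so its code is \<open>[\<top>]\<close>.
\<close>
lemma Dc_I:
  assumes "\<Gamma> \<turnstile> \<phi> type PropS" "\<Gamma> \<tturnstile> \<phi>"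
  shows "\<Gamma> \<tturnstile> Dc (Code \<phi>)"
proof -
  note c = ctx_of(3)[OF assms(2)]
  note p = PropS_Prop[OF assms(1)] and t = PropS_Prop[OF F_Top[OF c]]
  show ?thesis
    unfolding Dc_def
    by (rule eq_true[OF eq_P1[OF assms(1) F_Top[OF c] I_Conj[OF F_Impl_Prop[OF p t] F_Impl_Prop[OF t p] Impl_wk[OF p t Top_true[OF c]] Impl_wk[OF t p assms(2)],
      folded Iff_def]]])
qed

lemma Code_eq_E:
  assumes "\<Gamma> \<turnstile> \<phi> type PropS" "\<Gamma> \<turnstile> \<psi> type PropS" "\<Gamma> \<turnstile> Code \<phi> \<doteq> Code \<psi> \<Colon> P1"  "\<Gamma> \<tturnstile> \<psi>"
  shows "\<Gamma> \<tturnstile> \<phi>"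
proof -
  note p = PropS_Prop[OF assms(1)] PropS_Prop[OF assms(2)]
  show ?thesis
    by (rule E_Impl[OF p(2,1) E2_Conj[OF F_Impl_Prop[OF p] F_Impl_Prop[OF p(2,1)] eff_P1[OF assms(1-3), unfolded Iff_def]] assms(4)])
qed

lemma Dc_E:
  assumes "\<Gamma> \<turnstile> \<phi> type PropS" "\<Gamma> \<tturnstile> Dc (Code \<phi>)"
  shows "\<Gamma> \<tturnstile> \<phi>"
proof -
  note c = ctx_of(3)[OF assms(2)]
  show ?thesis
    by (rule Code_eq_E[OF assms(1) F_Top[OF c] eq_reflect[OF assms(2)[unfolded Dc_def] I_P1[OF assms(1)] I_P1[OF F_Top[OF c]]] Top_true[OF c]])
qed

text \<open>
  This makes \<open>P(1)\<close> a target for eliminators that tell constructors apart.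
\<close>
lemma Code_Top_Falsum:
  assumes "\<Gamma> \<turnstile> Code Top \<doteq> Code Falsum \<Colon> P1" shows "\<Gamma> \<tturnstile> Falsum"
proof -
  note c = ctx_of(5)[OF assms]
  show ?thesis by (rule Code_eq_E[OF F_Falsum[OF c] F_Top[OF c] tm_sym[OF assms] Top_true[OF c]])
qed

lemma Dc_eq:
  assumes "\<Gamma> \<turnstile> U \<doteq> V \<Colon> P1" "\<Gamma> \<tturnstile> Dc U" shows "\<Gamma> \<tturnstile> Dc V"
proof -
  note c = ctx_of(3)[OF assms(2)]
  note e = eq_reflect[OF assms(2)[unfolded Dc_def] eq_tm_l[OF assms(1)] I_P1[OF F_Top[OF c]]]
  show ?thesis unfolding Dc_def by (rule eq_true[OF tm_trans[OF tm_sym[OF assms(1)] e]])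
qed

lemma Dc_Prop: "\<Gamma> \<turnstile> U \<Colon> P1 \<Longrightarrow> \<Gamma> \<turnstile> Dc U type Prop"
  by (rule PropS_Prop[OF Dc_PropS])

lemma Dc_cong_ty: "\<Gamma> \<turnstile> U \<doteq> V \<Colon> P1 \<Longrightarrow> \<Gamma> \<turnstile> Dc U \<doteq> Dc V type PropS"
  unfolding Dc_def by (intro C_Dc) (auto intro!: tm_refl I_P1 F_Top ctx_of(5))

lemma Neg_cong: "\<lbrakk>K \<in> {PropS, Prop}; \<Gamma> \<turnstile> \<phi> \<doteq> \<psi> type K\<rbrakk> \<Longrightarrow> \<Gamma> \<turnstile> Neg \<phi> \<doteq> Neg \<psi> type K"
  unfolding Neg_def by (rule C_Impl) (auto intro!: ty_refl F_Falsum F_Falsum_Prop ctx_of(4))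

lemma Stab_cong: "\<lbrakk>K \<in> {PropS, Prop}; \<Gamma> \<turnstile> \<phi> \<doteq> \<psi> type K\<rbrakk> \<Longrightarrow> \<Gamma> \<turnstile> Stab \<phi> \<doteq> Stab \<psi> type K"
  unfolding Stab_def by (intro C_Impl Neg_cong)

lemma Stab_conv: "\<lbrakk>K \<in> {PropS, Prop}; \<Gamma> \<turnstile> \<phi> \<doteq> \<psi> type K; \<Gamma> \<tturnstile> Stab \<phi>\<rbrakk> \<Longrightarrow> \<Gamma> \<tturnstile> Stab \<psi>"
  by (rule conv[OF _ eq_ty_Col[OF Stab_cong]])

lemma Stab_Dc_eq: "\<lbrakk>\<Gamma> \<turnstile> U \<doteq> V \<Colon> P1; \<Gamma> \<tturnstile> Stab (Dc U)\<rbrakk> \<Longrightarrow> \<Gamma> \<tturnstile> Stab (Dc V)"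
  by (rule Stab_conv[OF _ Dc_cong_ty]) simp_all

lemma Stab_Dc_Code:
  assumes "\<Gamma> \<turnstile> \<phi> type PropS" "\<Gamma> \<tturnstile> Stab \<phi>"
  shows "\<Gamma> \<tturnstile> Stab (Dc (Code \<phi>))"
proof (rule Stab_I)
  show "\<Gamma> \<turnstile> Dc (Code \<phi>) type Prop" by (rule Dc_Prop[OF I_P1[OF assms(1)]])
  fix \<Theta> \<sigma> assume s: "mor \<Theta> \<sigma> \<Gamma>" and nn: "\<Theta> \<tturnstile> Neg (Neg (Dc (Code \<phi>) \<bullet> \<sigma>))"
  note p = mor_ty[OF assms(1) s]
  note d = Dc_Prop[OF I_P1[OF p]]
  have "\<Theta> \<tturnstile> Neg (Neg (\<phi> \<bullet> \<sigma>))"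
    using Dc_E[OF wk1_ty[OF p d]] hyp_true[OF d] nn by (intro nn_mono[OF d PropS_Prop[OF p]]) simp_all
  with Stab_E[OF PropS_Prop[OF p]] mor_true[OF assms(2) s] Dc_I[OF p]
  show "\<Theta> \<tturnstile> Dc (Code \<phi>) \<bullet> \<sigma>" by simp
qed

text \<open>
  Each truth value is the code of its decoding, so equivalent decodings give equal truth values.
\<close>
lemma P1_ext:
  assumes U: "\<Gamma> \<turnstile> U \<Colon> P1" and V: "\<Gamma> \<turnstile> V \<Colon> P1"
    and "Dc U # \<Gamma> \<tturnstile> Dc V \<bullet> wk 1" "Dc V # \<Gamma> \<tturnstile> Dc U \<bullet> wk 1"
  shows "\<Gamma> \<turnstile> U \<doteq> V \<Colon> P1"
proof -
  note u = Dc_Prop[OF U] and v = Dc_Prop[OF V]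
  have "\<Gamma> \<tturnstile> Iff (Dc U) (Dc V)"
    unfolding Iff_def by (intro I_Conj F_Impl_Prop I_Impl u v assms)
  from eq_P1[OF Dc_PropS[OF U] Dc_PropS[OF V] this] show ?thesis
    using eta_P1[OF U] eta_P1[OF V] by (blast intro: tm_trans tm_sym)
qed

text \<open>
  Although \<open>P(1)\<close> itself need not have stable equality, truth values with stable decodings do:
  from \<open>\<not>\<not>(U = V)\<close> each decoding implies the double negation of the other.
\<close>
lemma P1_stable:
  assumes U: "\<Gamma> \<turnstile> U \<Colon> P1" and V: "\<Gamma> \<turnstile> V \<Colon> P1"
    and "\<Gamma> \<tturnstile> Stab (Dc U)" "\<Gamma> \<tturnstile> Stab (Dc V)" "\<Gamma> \<tturnstile> Neg (Neg (Eq P1 U V))"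
  shows "\<Gamma> \<turnstile> U \<doteq> V \<Colon> P1"
proof -
  have imp: "Dc U # \<Gamma> \<tturnstile> Dc V \<bullet> wk 1"
    if U: "\<Gamma> \<turnstile> U \<Colon> P1" and V: "\<Gamma> \<turnstile> V \<Colon> P1" and s: "\<Gamma> \<tturnstile> Stab (Dc V)"
      and nn: "\<Gamma> \<tturnstile> Neg (Neg (Eq P1 U V))" for U V
  proof -
    note u = Dc_Prop[OF U]
    note w = wk_ctx1[OF u]
    note v = mor_ty[OF Dc_Prop[OF V] w]
    have "Dc U # \<Gamma> \<tturnstile> Neg (Neg (Dc V \<bullet> wk 1))"
    proof (rule nn_eq_map[OF _ mor_tm[OF U w] mor_tm[OF V w] v])
      show "Dc U # \<Gamma> \<tturnstile> Neg (Neg (Eq (P1 \<bullet> wk 1) (U \<star> wk 1) (V \<star> wk 1)))"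
        using mor_true[OF nn w] by simp
      fix \<Theta> \<sigma> assume s: "mor \<Theta> \<sigma> (Dc U # \<Gamma>)" and "\<Theta> \<turnstile> U \<star> wk 1 \<star> \<sigma> \<doteq> V \<star> wk 1 \<star> \<sigma> \<Colon> P1 \<bullet> wk 1 \<bullet> \<sigma>"
      with Dc_eq mor_true[OF hyp_true[OF u] s]
      show "\<Theta> \<tturnstile> Dc V \<bullet> wk 1 \<bullet> \<sigma>" by simp
    qed
    then show ?thesis using Stab_E[OF v] mor_true[OF s w] by simp
  qed
  have "\<Gamma> \<tturnstile> Neg (Neg (Eq P1 V U))"
    by (rule nn_eq_map[OF assms(5) U V F_Eq_Prop[OF V U]]) (simp add: eq_true tm_sym)
  with assms show ?thesis by (intro P1_ext imp)
qed

section \<open>Stable truth values\<close>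

lemma StabDc_PropS: "T \<turnstile> \<Gamma> ctx \<Longrightarrow> P1 # \<Gamma> \<turnstile> Stab (Dc (Var 0)) type PropS"
  using hyp0[OF F_P1] by (intro F_Stab Dc_PropS) simp_all

lemma StabDc_Prop: "T \<turnstile> \<Gamma> ctx \<Longrightarrow> P1 # \<Gamma> \<turnstile> Stab (Dc (Var 0)) type Prop"
  by (rule PropS_Prop[OF StabDc_PropS])

lemma StabDc_Col: "T \<turnstile> \<Gamma> ctx \<Longrightarrow> P1 # \<Gamma> \<turnstile> Stab (Dc (Var 0)) type Col"
  by (rule ty_Col[OF StabDc_PropS])

lemma F_P1N: "T \<turnstile> \<Gamma> ctx \<Longrightarrow> \<Gamma> \<turnstile> P1N type Col"
  unfolding P1N_def by (intro F_Sig_Col F_P1 StabDc_Col)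

lemma fstP1_pfst: "fstP1 u = pfst P1 (Stab (Dc (Var 0))) u"
  by (simp add: fstP1_def pfst_def)

lemma fstP1_tm: "\<Gamma> \<turnstile> u \<Colon> P1N \<Longrightarrow> \<Gamma> \<turnstile> fstP1 u \<Colon> P1"
  unfolding fstP1_pfst P1N_def by (intro pfst_tm F_P1 StabDc_Col ctx_of(3))

lemma fstP1_cong: "\<Gamma> \<turnstile> u \<doteq> v \<Colon> P1N \<Longrightarrow> \<Gamma> \<turnstile> fstP1 u \<doteq> fstP1 v \<Colon> P1"
  unfolding fstP1_pfst P1N_def by (intro pfst_cong F_P1 StabDc_Col ctx_of(5))

lemma P1N_sub [simp]: "P1N \<bullet> \<sigma> = P1N"
  by (simp add: P1N_def up_def)

lemma fstP1_sub [simp]: "fstP1 u \<star> \<sigma> = fstP1 (u \<star> \<sigma>)"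
  by (simp add: fstP1_def sigma)

abbreviation pairP1 :: "tm \<Rightarrow> tm" where
  "pairP1 U \<equiv> Pair P1 (Stab (Dc (Var 0))) U true"

lemma pairP1_tm: "\<lbrakk>\<Gamma> \<turnstile> U \<Colon> P1; \<Gamma> \<tturnstile> Stab (Dc U)\<rbrakk> \<Longrightarrow> \<Gamma> \<turnstile> pairP1 U \<Colon> P1N"
  unfolding P1N_def by (intro I_Sig F_P1 StabDc_Col ctx_of(3)) simp_all

lemma fstP1_pair: "\<lbrakk>\<Gamma> \<turnstile> U \<Colon> P1; \<Gamma> \<tturnstile> Stab (Dc U)\<rbrakk> \<Longrightarrow> \<Gamma> \<turnstile> fstP1 (pairP1 U) \<doteq> U \<Colon> P1"
  unfolding fstP1_pfst by (intro pfst_Pair F_P1 StabDc_Col ctx_of(3)) simp_all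

lemma fstP1_Stab:
  assumes "\<Gamma> \<turnstile> u \<Colon> P1N" shows "\<Gamma> \<tturnstile> Stab (Dc (fstP1 u))"
proof -
  note c = ctx_of(3)[OF assms]
  have "\<Gamma> \<turnstile> psnd P1 (Stab (Dc (Var 0))) u \<Colon> Stab (Dc (fstP1 u))"
    using psnd_tm[OF F_P1[OF c] StabDc_Col[OF c] assms[unfolded P1N_def]] by (simp add: fstP1_pfst)
  from true_I[OF F_Stab_Prop[OF Dc_Prop[OF fstP1_tm[OF assms]]] this] show ?thesis .
qed

text \<open>
  The reason why \<open>P1N\<close> behaves like a collection of truth values: stability is a proposition.
\<close>
lemma P1N_ext: "\<lbrakk>\<Gamma> \<turnstile> u \<Colon> P1N; \<Gamma> \<turnstile> v \<Colon> P1N; \<Gamma> \<turnstile> fstP1 u \<doteq> fstP1 v \<Colon> P1\<rbrakk> \<Longrightarrow> \<Gamma> \<turnstile> u \<doteq> v \<Colon> P1N"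
  unfolding fstP1_pfst P1N_def by (blast intro: Sig_ext_prop F_P1 StabDc_Prop ctx_of(3))

text \<open>
  The form in which equality on \<open>P(1)\<close> is translated.
\<close>
lemma Stab_Eq_fstP1:
  assumes "\<Gamma> \<turnstile> u \<Colon> P1N" "\<Gamma> \<turnstile> v \<Colon> P1N"
  shows "\<Gamma> \<tturnstile> Stab (Eq P1 (fstP1 u) (fstP1 v))"
proof (rule Stab_Eq_I[OF fstP1_tm[OF assms(1)] fstP1_tm[OF assms(2)]])
  fix \<Theta> \<sigma> assume s: "mor \<Theta> \<sigma> \<Gamma>" and "\<Theta> \<tturnstile> Neg (Neg (Eq (P1 \<bullet> \<sigma>) (fstP1 u \<star> \<sigma>) (fstP1 v \<star> \<sigma>)))"
  then show "\<Theta> \<turnstile> fstP1 u \<star> \<sigma> \<doteq> fstP1 v \<star> \<sigma> \<Colon> P1 \<bullet> \<sigma>"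
    using mor_tm[OF assms(1) s] mor_tm[OF assms(2) s] by (auto intro!: P1_stable fstP1_tm fstP1_Stab)
qed

lemma stable_eq_P1N: "stable_eq \<Gamma> P1N"
proof (rule stable_eq_I, unfold P1N_sub)
  fix \<Theta> \<sigma> u v assume u: "\<Theta> \<turnstile> u \<Colon> P1N" and v: "\<Theta> \<turnstile> v \<Colon> P1N" and nn: "\<Theta> \<tturnstile> Neg (Neg (Eq P1N u v))"
  have "\<Theta> \<tturnstile> Neg (Neg (Eq P1 (fstP1 u) (fstP1 v)))"
    by (rule nn_eq_map[OF nn u v F_Eq_Prop[OF fstP1_tm[OF u] fstP1_tm[OF v]]]) (simp add: eq_true fstP1_cong)
  from P1N_ext[OF u v Stab_Eq_E[OF Stab_Eq_fstP1[OF u v] fstP1_tm[OF u] fstP1_tm[OF v] this]]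
  show "\<Theta> \<turnstile> u \<doteq> v \<Colon> P1N" .
qed

section \<open>Families of stable truth values\<close>

lemma FunStab_sub: "FunStab A \<bullet> up \<sigma> = FunStab (A \<bullet> \<sigma>)"
  by (simp add: FunStab_def sigma)

lemma FunP1N_sub: "FunP1N A \<bullet> \<sigma> = FunP1N (A \<bullet> \<sigma>)"
  by (simp add: FunP1N_def FunStab_sub)

text \<open>
  The underlying function into \<open>P(1)\<close> of an element of \<open>FunP1N A\<close>, as it occurs in \<open>ApP1N\<close>.
\<close>
definition fstFun :: "ty \<Rightarrow> tm \<Rightarrow> tm" where
  "fstFun A f = ElSig (FunP1 A) (FunStab A) (FunP1 (A \<bullet> wk 1)) f (Var 1)"

lemma fstFun_pfst: "fstFun A f = pfst (FunP1 A) (FunStab A) f"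
  by (simp add: fstFun_def pfst_def)

lemma fstFun_sub: "fstFun A f \<star> \<sigma> = fstFun (A \<bullet> \<sigma>) (f \<star> \<sigma>)"
  by (simp add: fstFun_pfst pfst_sub FunStab_sub)

lemma ApP1N_fstFun: "ApP1N A f a = pairP1 (ApP1 A (fstFun A f) a)"
  by (simp add: ApP1N_def fstFun_def)

lemma ApP1N_sub: "ApP1N A f a \<star> \<sigma> = ApP1N (A \<bullet> \<sigma>) (f \<star> \<sigma>) (a \<star> \<sigma>)"
  by (simp add: ApP1N_fstFun fstFun_sub up_def)

lemma LamP1N_sub: "LamP1N A b \<star> \<sigma> = LamP1N (A \<bullet> \<sigma>) (b \<star> up \<sigma>)"
  by (simp add: LamP1N_def FunStab_sub)

lemma FunStab_body:
  assumes "\<Gamma> \<turnstile> A type Set"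
  shows "A \<bullet> wk 1 # FunP1 A # \<Gamma> \<turnstile> ApP1 (A \<bullet> wk 2) (Var 1) (Var 0) \<Colon> P1"
proof -
  note f = F_FunP1[OF assms]
  note a = wk1_ty[OF assms f]
  have "A \<bullet> wk 1 # FunP1 A # \<Gamma> \<turnstile> Var 1 \<Colon> FunP1 (A \<bullet> wk 2)" "A \<bullet> wk 1 # FunP1 A # \<Gamma> \<turnstile> Var 0 \<Colon> A \<bullet> wk 2"
     "A \<bullet> wk 1 # FunP1 A # \<Gamma> \<turnstile> A \<bullet> wk 2 type Set"
    using wk1_tm[OF hyp0[OF f] a] hyp0[OF a] wk1_ty[OF a a] by (simp_all add: sigma)
  then show ?thesis by (rule E_FunP1[rotated])
qed

lemma F_FunStab:
  assumes "\<Gamma> \<turnstile> A type Set"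
  shows "FunP1 A # \<Gamma> \<turnstile> FunStab A type PropS"
  unfolding FunStab_def
  by (rule F_Uni[OF _ wk1_ty[OF assms F_FunP1[OF assms]] F_Stab[OF _ Dc_PropS[OF FunStab_body[OF assms]]]])
    (simp_all add: prop_over.intros)

lemma F_FunStab_Prop: "\<Gamma> \<turnstile> A type Set \<Longrightarrow> FunP1 A # \<Gamma> \<turnstile> FunStab A type Prop"
  by (rule PropS_Prop[OF F_FunStab])

lemma F_FunStab_Col: "\<Gamma> \<turnstile> A type Set \<Longrightarrow> FunP1 A # \<Gamma> \<turnstile> FunStab A type Col"
  by (rule ty_Col[OF F_FunStab])

lemma F_FunP1N: "\<Gamma> \<turnstile> A type Set \<Longrightarrow> \<Gamma> \<turnstile> FunP1N A type Col"
  unfolding FunP1N_def by (intro F_Sig_Col F_FunP1 F_FunStab_Col)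

lemma fstFun_tm: "\<lbrakk>\<Gamma> \<turnstile> A type Set; \<Gamma> \<turnstile> f \<Colon> FunP1N A\<rbrakk> \<Longrightarrow> \<Gamma> \<turnstile> fstFun A f \<Colon> FunP1 A"
  unfolding fstFun_pfst FunP1N_def by (intro pfst_tm F_FunP1 F_FunStab_Col)

lemma FunP1N_ext:
  "\<lbrakk>\<Gamma> \<turnstile> A type Set; \<Gamma> \<turnstile> f \<Colon> FunP1N A; \<Gamma> \<turnstile> g \<Colon> FunP1N A; \<Gamma> \<turnstile> fstFun A f \<doteq> fstFun A g \<Colon> FunP1 A\<rbrakk>
    \<Longrightarrow> \<Gamma> \<turnstile> f \<doteq> g \<Colon> FunP1N A"
  unfolding fstFun_pfst FunP1N_def by (blast intro: Sig_ext_prop F_FunP1 F_FunStab_Prop)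

lemma FunStab_inst: "FunStab A \<bullet> (g \<cdot> Var) = Uni A (Stab (Dc (ApP1 (A \<bullet> wk 1) (g \<star> wk 1) (Var 0))))"
  by (simp add: FunStab_def sigma)

lemma fstFun_Stab:
  assumes A: "\<Gamma> \<turnstile> A type Set" and f: "\<Gamma> \<turnstile> f \<Colon> FunP1N A" and a: "\<Gamma> \<turnstile> a \<Colon> A"
  shows "\<Gamma> \<tturnstile> Stab (Dc (ApP1 A (fstFun A f) a))"
proof -
  note w = wk_ctx1[OF A]
  note g = fstFun_tm[OF A f]
  have "A # \<Gamma> \<turnstile> ApP1 (A \<bullet> wk 1) (fstFun A f \<star> wk 1) (Var 0) \<Colon> P1"
    by (rule E_FunP1[OF mor_ty[OF A w] mor_tm[OF g w, unfolded sub_ty.simps] hyp0[OF A]])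
  note p = F_Stab_Prop[OF Dc_Prop[OF this]]
  have "\<Gamma> \<turnstile> psnd (FunP1 A) (FunStab A) f \<Colon> FunStab A \<bullet> (fstFun A f \<cdot> Var)"
    using psnd_tm[OF F_FunP1[OF A] F_FunStab_Col[OF A] f[unfolded FunP1N_def]] by (simp add: fstFun_pfst)
  then have "\<Gamma> \<tturnstile> Uni A (Stab (Dc (ApP1 (A \<bullet> wk 1) (fstFun A f \<star> wk 1) (Var 0))))"
    using true_I inst_ty[OF F_FunStab_Prop[OF A] g] by (metis FunStab_inst)
  from E_Uni[OF ty_Col[OF A] p this a] show ?thesis by (simp add: sigma)
qed

lemma FunP1_wk_Ap:
  assumes A: "\<Gamma> \<turnstile> A type Set" and g: "\<Gamma> \<turnstile> g \<Colon> FunP1 A"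
  shows "A # \<Gamma> \<turnstile> ApP1 (A \<bullet> wk 1) (g \<star> wk 1) (Var 0) \<Colon> P1"
  using E_FunP1[OF mor_ty[OF A wk_ctx1[OF A]] _ hyp0[OF A]] mor_tm[OF g wk_ctx1[OF A]] by simp

lemma FunStab_I:
  assumes A: "\<Gamma> \<turnstile> A type Set" and g: "\<Gamma> \<turnstile> g \<Colon> FunP1 A"
    and s: "A # \<Gamma> \<tturnstile> Stab (Dc (ApP1 (A \<bullet> wk 1) (g \<star> wk 1) (Var 0)))"
  shows "\<Gamma> \<tturnstile> FunStab A \<bullet> (g \<cdot> Var)"
  unfolding FunStab_inst by (rule I_Uni[OF ty_Col[OF A] F_Stab_Prop[OF Dc_Prop[OF FunP1_wk_Ap[OF A g]]] s])

lemma ApP1_LamP1_wk: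
  assumes A: "\<Gamma> \<turnstile> A type Set" and b: "A # \<Gamma> \<turnstile> b \<Colon> P1"
  shows "A # \<Gamma> \<turnstile> ApP1 (A \<bullet> wk 1) (LamP1 A b \<star> wk 1) (Var 0) \<doteq> b \<Colon> P1"
proof -
  note w = wk_ctx1[OF A]
  note a = mor_ty[OF A w]
  show ?thesis
    using B_FunP1[OF a _ hyp0[OF A], of "b \<star> up (wk 1)"] mor_tm[OF b mor_up[OF w ty_Col[OF a]]] by (simp add: sigma)
qed

text \<open>
  By beta, the values of the abstraction are the first components of elements of \<open>P1N\<close>, whose
  decodings are stable.
\<close>
lemma LamP1N_stab:
  assumes A: "\<Gamma> \<turnstile> A type Set" and b: "A # \<Gamma> \<turnstile> b \<Colon> P1N"
  shows "\<Gamma> \<tturnstile> FunStab A \<bullet> (LamP1 A (fstP1 b) \<cdot> Var)"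
  by (rule FunStab_I[OF A I_FunP1[OF A fstP1_tm[OF b]] Stab_Dc_eq[OF tm_sym[OF ApP1_LamP1_wk[OF A fstP1_tm[OF b]]] fstP1_Stab[OF b]]])

lemma LamP1N_tm:
  assumes A: "\<Gamma> \<turnstile> A type Set" and b: "A # \<Gamma> \<turnstile> b \<Colon> P1N"
  shows "\<Gamma> \<turnstile> LamP1N A b \<Colon> FunP1N A"
  unfolding LamP1N_def FunP1N_def
  by (rule I_Sig[OF F_FunP1[OF A] F_FunStab_Col[OF A] I_FunP1[OF A fstP1_tm[OF b]] LamP1N_stab[OF A b]])

lemma fstFun_LamP1N:
  assumes A: "\<Gamma> \<turnstile> A type Set" and b: "A # \<Gamma> \<turnstile> b \<Colon> P1N"
  shows "\<Gamma> \<turnstile> fstFun A (LamP1N A b) \<doteq> LamP1 A (fstP1 b) \<Colon> FunP1 A"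
  unfolding LamP1N_def fstFun_pfst
  by (rule pfst_Pair[OF F_FunP1[OF A] F_FunStab_Col[OF A] I_FunP1[OF A fstP1_tm[OF b]] LamP1N_stab[OF A b]])

lemma ApP1N_tm:
  assumes A: "\<Gamma> \<turnstile> A type Set" and f: "\<Gamma> \<turnstile> f \<Colon> FunP1N A" and a: "\<Gamma> \<turnstile> a \<Colon> A"
  shows "\<Gamma> \<turnstile> ApP1N A f a \<Colon> P1N"
  unfolding ApP1N_fstFun by (rule pairP1_tm[OF E_FunP1[OF A fstFun_tm[OF A f] a] fstFun_Stab[OF A f a]])

lemma fstP1_ApP1N:
  assumes A: "\<Gamma> \<turnstile> A type Set" and f: "\<Gamma> \<turnstile> f \<Colon> FunP1N A" and a: "\<Gamma> \<turnstile> a \<Colon> A"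
  shows "\<Gamma> \<turnstile> fstP1 (ApP1N A f a) \<doteq> ApP1 A (fstFun A f) a \<Colon> P1"
  unfolding ApP1N_fstFun by (rule fstP1_pair[OF E_FunP1[OF A fstFun_tm[OF A f] a] fstFun_Stab[OF A f a]])

lemma FunP1N_cong:
  assumes "\<Gamma> \<turnstile> A \<doteq> A' type Set"
  shows "FunP1 A # \<Gamma> \<turnstile> FunStab A \<doteq> FunStab A' type PropS" "\<Gamma> \<turnstile> FunP1N A \<doteq> FunP1N A' type Col"
proof -
  note A = eq_ty_l[OF assms]
  note f = F_FunP1[OF A]
  note w = wk_ctx1[OF f]
  note a = mor_ty[OF A w]
  note w2 = wk_ctx2[OF a]
  have "A \<bullet> wk 1 # FunP1 A # \<Gamma> \<turnstile> Var 1 \<Colon> FunP1 (A \<bullet> wk 2)" "A \<bullet> wk 1 # FunP1 A # \<Gamma> \<turnstile> Var 0 \<Colon> A \<bullet> wk 2"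
    using wk1_tm[OF hyp0[OF f] a] hyp0[OF a] wk1_ty[OF a a] by (simp_all add: sigma)
  then have "A \<bullet> wk 1 # FunP1 A # \<Gamma> \<turnstile> ApP1 (A \<bullet> wk 2) (Var 1) (Var 0) \<doteq> ApP1 (A' \<bullet> wk 2) (Var 1) (Var 0) \<Colon> P1"
    using mor_eq_ty[OF assms w2] by (blast intro: C_ApP1 tm_refl)
  from Stab_cong[OF _ Dc_cong_ty[OF this]]
  show 1: "FunP1 A # \<Gamma> \<turnstile> FunStab A \<doteq> FunStab A' type PropS"
    unfolding FunStab_def by (intro C_Uni[OF _ mor_eq_ty[OF assms w]]) (simp_all add: prop_over.intros)
  show "\<Gamma> \<turnstile> FunP1N A \<doteq> FunP1N A' type Col"
    unfolding FunP1N_def by (rule C_Sig[OF _ C_FunP1[OF assms] eq_ty_Col[OF 1]]) simp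
qed

lemma fstFun_cong:
  assumes "\<Gamma> \<turnstile> A \<doteq> A' type Set" "\<Gamma> \<turnstile> f \<doteq> f' \<Colon> FunP1N A"
  shows "\<Gamma> \<turnstile> fstFun A f \<doteq> fstFun A' f' \<Colon> FunP1 A"
proof -
  note A = eq_ty_l[OF assms(1)]
  note w = wk_ctx1[OF F_FunP1N[OF A]]
  have "FunStab A # FunP1 A # \<Gamma> \<turnstile> Var 1 \<Colon> FunP1 (A \<bullet> wk 1) \<bullet> (Pair (FunP1 A \<bullet> wk 2) (FunStab A \<bullet> up (wk 2)) (Var 1) (Var 0) \<cdot> wk 2)"
    using pfst_branch[OF F_FunP1[OF A] F_FunStab_Col[OF A]] by simp
  note br = tm_refl[OF this]
  show ?thesis
    using C_ElSig[OF C_FunP1[OF assms(1)] eq_ty_Col[OF FunP1N_cong(1)[OF assms(1)]]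
        C_FunP1[OF mor_eq_ty[OF assms(1) w], unfolded FunP1N_def] assms(2)[unfolded FunP1N_def] br]
    by (simp add: fstFun_def sigma)
qed

lemma LamP1N_cong:
  assumes "\<Gamma> \<turnstile> A \<doteq> A' type Set" "A # \<Gamma> \<turnstile> b \<doteq> b' \<Colon> P1N"
  shows "\<Gamma> \<turnstile> LamP1N A b \<doteq> LamP1N A' b' \<Colon> FunP1N A"
  unfolding LamP1N_def FunP1N_def
  by (intro C_Pair C_FunP1 C_LamP1 eq_ty_Col[OF FunP1N_cong(1)] fstP1_cong tm_refl LamP1N_stab assms eq_ty_l[OF assms(1)] eq_tm_l[OF assms(2)])

lemma ApP1N_cong:
  assumes "\<Gamma> \<turnstile> A \<doteq> A' type Set" "\<Gamma> \<turnstile> f \<doteq> f' \<Colon> FunP1N A" "\<Gamma> \<turnstile> a \<doteq> a' \<Colon> A"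
  shows "\<Gamma> \<turnstile> ApP1N A f a \<doteq> ApP1N A' f' a' \<Colon> P1N"
proof -
  note A = eq_ty_l[OF assms(1)] and f = eq_tm_l[OF assms(2)] and a = eq_tm_l[OF assms(3)]
  note c = ctx_of(3)[OF a]
  show ?thesis
    unfolding ApP1N_fstFun P1N_def using fstFun_Stab[OF A f a]
    by (intro Pair_cong F_P1 StabDc_Col c C_ApP1 fstFun_cong tm_refl assms) simp
qed

text \<open>
  By \<open>P1N_ext\<close> it suffices to compare first components, where the beta rule of \<open>A \<rightarrow> P(1)\<close> holds.
\<close>
lemma ApP1N_beta:
  assumes A: "\<Gamma> \<turnstile> A type Set" and b: "A # \<Gamma> \<turnstile> b \<Colon> P1N" and a: "\<Gamma> \<turnstile> a \<Colon> A"
  shows "\<Gamma> \<turnstile> ApP1N A (LamP1N A b) a \<doteq> b \<star> (a \<cdot> Var) \<Colon> P1N"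
proof (rule P1N_ext)
  note l = LamP1N_tm[OF A b]
  show "\<Gamma> \<turnstile> ApP1N A (LamP1N A b) a \<Colon> P1N" by (rule ApP1N_tm[OF A l a])
  show "\<Gamma> \<turnstile> b \<star> (a \<cdot> Var) \<Colon> P1N" using inst_tm[OF b a] by simp
  show "\<Gamma> \<turnstile> fstP1 (ApP1N A (LamP1N A b) a) \<doteq> fstP1 (b \<star> (a \<cdot> Var)) \<Colon> P1"
    using tm_trans[OF fstP1_ApP1N[OF A l a] tm_trans[OF C_ApP1[OF ty_refl[OF A] fstFun_LamP1N[OF A b] tm_refl[OF a]] B_FunP1[OF A fstP1_tm[OF b] a]]]
    by simp
qed

text \<open>
  As for beta, with the eta rule of \<open>A \<rightarrow> P(1)\<close> for the underlying functions.
\<close>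
lemma LamP1N_eta:
  assumes A: "\<Gamma> \<turnstile> A type Set" and f: "\<Gamma> \<turnstile> f \<Colon> FunP1N A"
  shows "\<Gamma> \<turnstile> LamP1N A (ApP1N (A \<bullet> wk 1) (f \<star> wk 1) (Var 0)) \<doteq> f \<Colon> FunP1N A"
proof (rule FunP1N_ext[OF A _ f])
  note w = wk_ctx1[OF A]
  note a = mor_ty[OF A w] and f' = mor_tm[OF f w, unfolded FunP1N_sub]
  note t = ApP1N_tm[OF a f' hyp0[OF A]]
  show "\<Gamma> \<turnstile> LamP1N A (ApP1N (A \<bullet> wk 1) (f \<star> wk 1) (Var 0)) \<Colon> FunP1N A" by (rule LamP1N_tm[OF A t])
  show "\<Gamma> \<turnstile> fstFun A (LamP1N A (ApP1N (A \<bullet> wk 1) (f \<star> wk 1) (Var 0))) \<doteq> fstFun A f \<Colon> FunP1 A"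
    using tm_trans[OF fstFun_LamP1N[OF A t] tm_trans[OF C_LamP1[OF ty_refl[OF A] fstP1_ApP1N[OF a f' hyp0[OF A]]]
      eta_FunP1[OF A fstFun_tm[OF A f], unfolded fstFun_sub]]] .
qed

text \<open>
  Functions are equal when their values at a fresh variable are, and these lie in \<open>P1N\<close>.
\<close>
lemma stable_eq_FunP1N:
  assumes "\<Gamma> \<turnstile> A type Set"
  shows "stable_eq \<Gamma> (FunP1N A)"
proof (rule stable_eq_I, unfold FunP1N_sub)
  fix \<Theta> \<sigma> f g assume s: "mor \<Theta> \<sigma> \<Gamma>" and f: "\<Theta> \<turnstile> f \<Colon> FunP1N (A \<bullet> \<sigma>)" and g: "\<Theta> \<turnstile> g \<Colon> FunP1N (A \<bullet> \<sigma>)"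
    and nn: "\<Theta> \<tturnstile> Neg (Neg (Eq (FunP1N (A \<bullet> \<sigma>)) f g))"
  define A' where "A' = A \<bullet> \<sigma>"
  have A: "\<Theta> \<turnstile> A' type Set" unfolding A'_def by (rule mor_ty[OF assms s])
  note f = f[folded A'_def] and g = g[folded A'_def] and nn = nn[folded A'_def]
  note w = wk_ctx1[OF A]
  note a = mor_ty[OF A w] and h = hyp0[OF A]
  note f' = mor_tm[OF f w, unfolded FunP1N_sub] and g' = mor_tm[OF g w, unfolded FunP1N_sub]
  note fx = ApP1N_tm[OF a f' h] and gx = ApP1N_tm[OF a g' h]
  let ?F = "ApP1N (A' \<bullet> wk 1) (f \<star> wk 1) (Var 0)"
  let ?G = "ApP1N (A' \<bullet> wk 1) (g \<star> wk 1) (Var 0)"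
  have "A' # \<Theta> \<tturnstile> Neg (Neg (Eq P1N ?F ?G))"
  proof (rule nn_eq_map[OF _ f' g' F_Eq_Prop[OF fx gx]])
    show "A' # \<Theta> \<tturnstile> Neg (Neg (Eq (FunP1N (A' \<bullet> wk 1)) (f \<star> wk 1) (g \<star> wk 1)))"
      using mor_true[OF nn w] by (simp add: FunP1N_sub)
    fix \<Xi> \<tau> assume t: "mor \<Xi> \<tau> (A' # \<Theta>)" and e: "\<Xi> \<turnstile> f \<star> wk 1 \<star> \<tau> \<doteq> g \<star> wk 1 \<star> \<tau> \<Colon> FunP1N (A' \<bullet> wk 1) \<bullet> \<tau>"
    show "\<Xi> \<tturnstile> Eq P1N ?F ?G \<bullet> \<tau>"
      unfolding sub_ty.simps ApP1N_sub P1N_sub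
      by (rule eq_true[OF ApP1N_cong[OF ty_refl[OF mor_ty[OF a t]] e[unfolded FunP1N_sub] tm_refl[OF mor_tm[OF h t]]]])
  qed
  from stable_eq_E[OF stable_eq_P1N fx gx this]
  have "\<Theta> \<turnstile> f \<doteq> g \<Colon> FunP1N A'"
    using LamP1N_cong[OF ty_refl[OF A]] LamP1N_eta[OF A f] LamP1N_eta[OF A g] by (blast intro: tm_trans tm_sym)
  then show "\<Theta> \<turnstile> f \<doteq> g \<Colon> FunP1N (A \<bullet> \<sigma>)" by (simp add: A'_def)
qed

section \<open>Disjoint sums\<close>

text \<open>
  Case analysis in the form in which branches are checked at an arbitrary morphism; the
  variable of the branch is one instance.
\<close>
lemma Sum_cases:
  assumes A: "\<Gamma> \<turnstile> A type Set" and B: "\<Gamma> \<turnstile> B type Set" and \<phi>: "Sum A B # \<Gamma> \<turnstile> \<phi> type Prop" and c: "\<Gamma> \<turnstile> c \<Colon> Sum A B"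
    and l: "\<And>\<Theta> \<sigma> a. \<lbrakk>mor \<Theta> \<sigma> \<Gamma>; \<Theta> \<turnstile> a \<Colon> A \<bullet> \<sigma>\<rbrakk> \<Longrightarrow> \<Theta> \<tturnstile> \<phi> \<bullet> (Inl (A \<bullet> \<sigma>) (B \<bullet> \<sigma>) a \<cdot> \<sigma>)"
    and r: "\<And>\<Theta> \<sigma> b. \<lbrakk>mor \<Theta> \<sigma> \<Gamma>; \<Theta> \<turnstile> b \<Colon> B \<bullet> \<sigma>\<rbrakk> \<Longrightarrow> \<Theta> \<tturnstile> \<phi> \<bullet> (Inr (A \<bullet> \<sigma>) (B \<bullet> \<sigma>) b \<cdot> \<sigma>)"
  shows "\<Gamma> \<tturnstile> \<phi> \<bullet> (c \<cdot> Var)"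
  by (rule true_I[OF inst_ty[OF \<phi> c] E_Sum[OF A B ty_Col[OF \<phi>] c l[OF wk_ctx1[OF A] hyp0[OF A]] r[OF wk_ctx1[OF B] hyp0[OF B]]]])

context
  fixes \<Gamma> A B
  assumes A: "\<Gamma> \<turnstile> A type Set" and B: "\<Gamma> \<turnstile> B type Set"
begin

text \<open>
  Apply the function that is the identity on the left summand; its value on the right summand
  is the given \<open>a\<close>, which serves as default.
\<close>
lemma Inl_inj:
  assumes e: "\<Gamma> \<turnstile> Inl A B a \<doteq> Inl A B a' \<Colon> Sum A B" and a: "\<Gamma> \<turnstile> a \<Colon> A" "\<Gamma> \<turnstile> a' \<Colon> A"
  shows "\<Gamma> \<turnstile> a \<doteq> a' \<Colon> A"
proof -
  note S = F_Sum[OF A B]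
  let ?f = "\<lambda>c. ElSum A B (A \<bullet> wk 1) c (Var 0) (a \<star> wk 1)"
  have L: "Sum A B # \<Gamma> \<turnstile> A \<bullet> wk 1 type Col" by (rule ty_Col[OF wk1_ty[OF A S]])
  have m: "A # \<Gamma> \<turnstile> Var 0 \<Colon> A \<bullet> wk 1 \<bullet> (Inl (A \<bullet> wk 1) (B \<bullet> wk 1) (Var 0) \<cdot> wk 1)"
    using hyp0[OF A] by (simp add: sigma)
  have n: "B # \<Gamma> \<turnstile> a \<star> wk 1 \<Colon> A \<bullet> wk 1 \<bullet> (Inr (A \<bullet> wk 1) (B \<bullet> wk 1) (Var 0) \<cdot> wk 1)"
    using wk1_tm[OF a(1) B] by (simp add: sigma)
  have "\<Gamma> \<turnstile> ?f (Inl A B a) \<doteq> ?f (Inl A B a') \<Colon> A"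
    using C_ElSum[OF ty_refl[OF A] ty_refl[OF B] ty_refl[OF L] e tm_refl[OF m] tm_refl[OF n]] by (simp add: sigma)
  moreover have "\<Gamma> \<turnstile> ?f (Inl A B x) \<doteq> x \<Colon> A" if "\<Gamma> \<turnstile> x \<Colon> A" for x
    using B1_Sum[OF A B L that m n] by (simp add: sigma)
  ultimately show ?thesis using a by (meson tm_sym tm_trans)
qed

lemma Inr_inj:
  assumes e: "\<Gamma> \<turnstile> Inr A B b \<doteq> Inr A B b' \<Colon> Sum A B" and b: "\<Gamma> \<turnstile> b \<Colon> B" "\<Gamma> \<turnstile> b' \<Colon> B"
  shows "\<Gamma> \<turnstile> b \<doteq> b' \<Colon> B"
proof -
  note S = F_Sum[OF A B]
  let ?f = "\<lambda>c. ElSum A B (B \<bullet> wk 1) c (b \<star> wk 1) (Var 0)"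
  have L: "Sum A B # \<Gamma> \<turnstile> B \<bullet> wk 1 type Col" by (rule ty_Col[OF wk1_ty[OF B S]])
  have m: "A # \<Gamma> \<turnstile> b \<star> wk 1 \<Colon> B \<bullet> wk 1 \<bullet> (Inl (A \<bullet> wk 1) (B \<bullet> wk 1) (Var 0) \<cdot> wk 1)"
    using wk1_tm[OF b(1) A] by (simp add: sigma)
  have n: "B # \<Gamma> \<turnstile> Var 0 \<Colon> B \<bullet> wk 1 \<bullet> (Inr (A \<bullet> wk 1) (B \<bullet> wk 1) (Var 0) \<cdot> wk 1)"
    using hyp0[OF B] by (simp add: sigma)
  have "\<Gamma> \<turnstile> ?f (Inr A B b) \<doteq> ?f (Inr A B b') \<Colon> B"
    using C_ElSum[OF ty_refl[OF A] ty_refl[OF B] ty_refl[OF L] e tm_refl[OF m] tm_refl[OF n]] by (simp add: sigma)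
  moreover have "\<Gamma> \<turnstile> ?f (Inr A B x) \<doteq> x \<Colon> B" if "\<Gamma> \<turnstile> x \<Colon> B" for x
    using B2_Sum[OF A B L that m n] by (simp add: sigma)
  ultimately show ?thesis using b by (meson tm_sym tm_trans)
qed

text \<open>
  Map the two summands to \<open>[\<top>]\<close> and \<open>[\<bottom>]\<close>.
\<close>
lemma Inl_Inr_disjoint:
  assumes e: "\<Gamma> \<turnstile> Inl A B a \<doteq> Inr A B b \<Colon> Sum A B" and a: "\<Gamma> \<turnstile> a \<Colon> A" and b: "\<Gamma> \<turnstile> b \<Colon> B"
  shows "\<Gamma> \<tturnstile> Falsum"
proof -
  let ?f = "\<lambda>c. ElSum A B P1 c (Code Top) (Code Falsum)"
  have L: "Sum A B # \<Gamma> \<turnstile> P1 type Col" by (rule F_P1[OF ctx_cons[OF F_Sum[OF A B]]])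
  have m: "A # \<Gamma> \<turnstile> Code Top \<Colon> P1 \<bullet> (Inl (A \<bullet> wk 1) (B \<bullet> wk 1) (Var 0) \<cdot> wk 1)"
    using I_P1[OF F_Top[OF ctx_cons[OF A]]] by simp
  have n: "B # \<Gamma> \<turnstile> Code Falsum \<Colon> P1 \<bullet> (Inr (A \<bullet> wk 1) (B \<bullet> wk 1) (Var 0) \<cdot> wk 1)"
    using I_P1[OF F_Falsum[OF ctx_cons[OF B]]] by simp
  have "\<Gamma> \<turnstile> ?f (Inl A B a) \<doteq> ?f (Inr A B b) \<Colon> P1"
    using C_ElSum[OF ty_refl[OF A] ty_refl[OF B] ty_refl[OF L] e tm_refl[OF m] tm_refl[OF n]] by simp
  moreover have "\<Gamma> \<turnstile> ?f (Inl A B a) \<doteq> Code Top \<Colon> P1" "\<Gamma> \<turnstile> ?f (Inr A B b) \<doteq> Code Falsum \<Colon> P1"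
    using B1_Sum[OF A B L a m n] B2_Sum[OF A B L b m n] by simp_all
  ultimately show ?thesis by (meson tm_sym tm_trans Code_Top_Falsum)
qed

end

text \<open>
  Stability of an equation passes along an equivalence of equations that holds at every
  morphism.
\<close>
lemma Stab_Eq_inj:
  assumes a: "\<Gamma> \<turnstile> a \<Colon> A" "\<Gamma> \<turnstile> b \<Colon> A" and c: "\<Gamma> \<turnstile> c \<Colon> C" "\<Gamma> \<turnstile> d \<Colon> C"
    and s: "\<Gamma> \<tturnstile> Stab (Eq A a b)"
    and inj: "\<And>\<Theta> \<sigma>. \<lbrakk>mor \<Theta> \<sigma> \<Gamma>; \<Theta> \<turnstile> c \<star> \<sigma> \<doteq> d \<star> \<sigma> \<Colon> C \<bullet> \<sigma>\<rbrakk> \<Longrightarrow> \<Theta> \<turnstile> a \<star> \<sigma> \<doteq> b \<star> \<sigma> \<Colon> A \<bullet> \<sigma>"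
    and cong: "\<And>\<Theta> \<sigma>. \<lbrakk>mor \<Theta> \<sigma> \<Gamma>; \<Theta> \<turnstile> a \<star> \<sigma> \<doteq> b \<star> \<sigma> \<Colon> A \<bullet> \<sigma>\<rbrakk> \<Longrightarrow> \<Theta> \<turnstile> c \<star> \<sigma> \<doteq> d \<star> \<sigma> \<Colon> C \<bullet> \<sigma>"
  shows "\<Gamma> \<tturnstile> Stab (Eq C c d)"
proof (rule Stab_Eq_I[OF c])
  fix \<Theta> \<sigma> assume m: "mor \<Theta> \<sigma> \<Gamma>" and nn: "\<Theta> \<tturnstile> Neg (Neg (Eq (C \<bullet> \<sigma>) (c \<star> \<sigma>) (d \<star> \<sigma>)))"
  note c' = mor_tm[OF c(1) m] mor_tm[OF c(2) m] and a' = mor_tm[OF a(1) m] mor_tm[OF a(2) m]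
  have "\<Theta> \<tturnstile> Neg (Neg (Eq (A \<bullet> \<sigma>) (a \<star> \<sigma>) (b \<star> \<sigma>)))"
  proof (rule nn_eq_map[OF nn c' F_Eq_Prop[OF a']])
    fix \<Xi> \<tau> assume t: "mor \<Xi> \<tau> \<Theta>" and e: "\<Xi> \<turnstile> c \<star> \<sigma> \<star> \<tau> \<doteq> d \<star> \<sigma> \<star> \<tau> \<Colon> C \<bullet> \<sigma> \<bullet> \<tau>"
    from eq_true[OF inj[OF mor_comp[OF m t]]] e
    show "\<Xi> \<tturnstile> Eq (A \<bullet> \<sigma>) (a \<star> \<sigma>) (b \<star> \<sigma>) \<bullet> \<tau>" by (simp add: sub_sub)
  qed
  with Stab_Eq_E[OF _ a'] mor_true[OF s m] cong[OF m]
  show "\<Theta> \<turnstile> c \<star> \<sigma> \<doteq> d \<star> \<sigma> \<Colon> C \<bullet> \<sigma>" by simp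
qed

text \<open>
  An absurd equation is stable because falsum is.
\<close>
lemma Stab_Eq_disjoint:
  assumes c: "\<Gamma> \<turnstile> c \<Colon> C" "\<Gamma> \<turnstile> d \<Colon> C"
    and dis: "\<And>\<Theta> \<sigma>. \<lbrakk>mor \<Theta> \<sigma> \<Gamma>; \<Theta> \<turnstile> c \<star> \<sigma> \<doteq> d \<star> \<sigma> \<Colon> C \<bullet> \<sigma>\<rbrakk> \<Longrightarrow> \<Theta> \<tturnstile> Falsum"
  shows "\<Gamma> \<tturnstile> Stab (Eq C c d)"
proof (rule Stab_Eq_I[OF c])
  fix \<Theta> \<sigma> assume m: "mor \<Theta> \<sigma> \<Gamma>" and nn: "\<Theta> \<tturnstile> Neg (Neg (Eq (C \<bullet> \<sigma>) (c \<star> \<sigma>) (d \<star> \<sigma>)))"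
  note c' = mor_tm[OF c(1) m] mor_tm[OF c(2) m]
  have "\<Theta> \<tturnstile> Neg (Neg Falsum)"
  proof (rule nn_eq_map[OF nn c' F_Falsum_Prop[OF mor_ctx[OF m]]])
    fix \<Xi> \<tau> assume "mor \<Xi> \<tau> \<Theta>" and "\<Xi> \<turnstile> c \<star> \<sigma> \<star> \<tau> \<doteq> d \<star> \<sigma> \<star> \<tau> \<Colon> C \<bullet> \<sigma> \<bullet> \<tau>"
    with dis[OF mor_comp[OF m]] show "\<Xi> \<tturnstile> Falsum \<bullet> \<tau>" by (simp add: sub_sub)
  qed
  from Falsum_eq[OF Falsum_of_nn[OF this] c'] show "\<Theta> \<turnstile> c \<star> \<sigma> \<doteq> d \<star> \<sigma> \<Colon> C \<bullet> \<sigma>" .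
qed

lemma Stab_Eq_sym:
  assumes a: "\<Gamma> \<turnstile> a \<Colon> A" "\<Gamma> \<turnstile> b \<Colon> A" and s: "\<Gamma> \<tturnstile> Stab (Eq A a b)"
  shows "\<Gamma> \<tturnstile> Stab (Eq A b a)"
  by (rule Stab_Eq_inj[OF a a(2,1) s]) (simp_all add: tm_sym)

lemma Stab_Eq_Inl:
  assumes A: "\<Gamma> \<turnstile> A type Set" and B: "\<Gamma> \<turnstile> B type Set" and s: "stable_eq \<Gamma> A"
    and a: "\<Gamma> \<turnstile> a \<Colon> A" and c: "\<Gamma> \<turnstile> c \<Colon> Sum A B"
  shows "\<Gamma> \<tturnstile> Stab (Eq (Sum A B) (Inl A B a) c)"
proof -
  note S = F_Sum[OF A B] and i = I_Inl[OF A B a]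
  let ?\<phi> = "Stab (Eq (Sum A B \<bullet> wk 1) (Inl A B a \<star> wk 1) (Var 0))"
  have "\<Gamma> \<tturnstile> ?\<phi> \<bullet> (c \<cdot> Var)"
  proof (rule Sum_cases[OF A B _ c])
    show "Sum A B # \<Gamma> \<turnstile> ?\<phi> type Prop"
      by (intro F_Stab_Prop F_Eq_Prop mor_tm[OF i wk_ctx1[OF S]] hyp0[OF S])
    fix \<Theta> \<sigma> assume m: "mor \<Theta> \<sigma> \<Gamma>"
    let ?S = "Sum (A \<bullet> \<sigma>) (B \<bullet> \<sigma>)"
    let ?i = "Inl (A \<bullet> \<sigma>) (B \<bullet> \<sigma>) (a \<star> \<sigma>)"
    let ?inl = "Inl (A \<bullet> \<sigma>) (B \<bullet> \<sigma>)"
    let ?inr = "Inr (A \<bullet> \<sigma>) (B \<bullet> \<sigma>)"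
    note A' = mor_ty[OF A m] and B' = mor_ty[OF B m] and a' = mor_tm[OF a m]
    note i' = I_Inl[OF A' B' a']
    {
      fix x assume x: "\<Theta> \<turnstile> x \<Colon> A \<bullet> \<sigma>"
      have "\<Theta> \<tturnstile> Stab (Eq ?S ?i (?inl x))"
      proof (rule Stab_Eq_inj[OF a' x i' I_Inl[OF A' B' x] stable_eq_D[OF stable_eq_mor[OF s m] a' x]])
        fix \<Xi> \<tau> assume t: "mor \<Xi> \<tau> \<Theta>"
        note t1 = mor_ty[OF A' t] mor_ty[OF B' t]
        show "\<Xi> \<turnstile> ?i \<star> \<tau> \<doteq> ?inl x \<star> \<tau> \<Colon> ?S \<bullet> \<tau> \<Longrightarrow> \<Xi> \<turnstile> a \<star> \<sigma> \<star> \<tau> \<doteq> x \<star> \<tau> \<Colon> A \<bullet> \<sigma> \<bullet> \<tau>"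
          using Inl_inj[OF t1 _ mor_tm[OF a' t] mor_tm[OF x t]] by simp
        show "\<Xi> \<turnstile> a \<star> \<sigma> \<star> \<tau> \<doteq> x \<star> \<tau> \<Colon> A \<bullet> \<sigma> \<bullet> \<tau> \<Longrightarrow> \<Xi> \<turnstile> ?i \<star> \<tau> \<doteq> ?inl x \<star> \<tau> \<Colon> ?S \<bullet> \<tau>"
          using C_Inl[OF ty_refl[OF t1(1)] ty_refl[OF t1(2)]] by simp
      qed
      then show "\<Theta> \<tturnstile> ?\<phi> \<bullet> (?inl x \<cdot> \<sigma>)" by (simp add: sigma)
    next
      fix x assume x: "\<Theta> \<turnstile> x \<Colon> B \<bullet> \<sigma>"
      have "\<Theta> \<tturnstile> Stab (Eq ?S ?i (?inr x))"
      proof (rule Stab_Eq_disjoint[OF i' I_Inr[OF A' B' x]])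
        fix \<Xi> \<tau> assume t: "mor \<Xi> \<tau> \<Theta>" and "\<Xi> \<turnstile> ?i \<star> \<tau> \<doteq> ?inr x \<star> \<tau> \<Colon> ?S \<bullet> \<tau>"
        then show "\<Xi> \<tturnstile> Falsum"
          using Inl_Inr_disjoint[OF mor_ty[OF A' t] mor_ty[OF B' t] _ mor_tm[OF a' t] mor_tm[OF x t]] by simp
      qed
      then show "\<Theta> \<tturnstile> ?\<phi> \<bullet> (?inr x \<cdot> \<sigma>)" by (simp add: sigma)
    }
  qed
  then show ?thesis by (simp add: sigma)
qed

lemma Stab_Eq_Inr:
  assumes A: "\<Gamma> \<turnstile> A type Set" and B: "\<Gamma> \<turnstile> B type Set" and s: "stable_eq \<Gamma> A" "stable_eq \<Gamma> B"
    and b: "\<Gamma> \<turnstile> b \<Colon> B" and c: "\<Gamma> \<turnstile> c \<Colon> Sum A B"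
  shows "\<Gamma> \<tturnstile> Stab (Eq (Sum A B) (Inr A B b) c)"
proof -
  note S = F_Sum[OF A B] and i = I_Inr[OF A B b]
  let ?\<phi> = "Stab (Eq (Sum A B \<bullet> wk 1) (Inr A B b \<star> wk 1) (Var 0))"
  have "\<Gamma> \<tturnstile> ?\<phi> \<bullet> (c \<cdot> Var)"
  proof (rule Sum_cases[OF A B _ c])
    show "Sum A B # \<Gamma> \<turnstile> ?\<phi> type Prop"
      by (intro F_Stab_Prop F_Eq_Prop mor_tm[OF i wk_ctx1[OF S]] hyp0[OF S])
    fix \<Theta> \<sigma> assume m: "mor \<Theta> \<sigma> \<Gamma>"
    let ?S = "Sum (A \<bullet> \<sigma>) (B \<bullet> \<sigma>)"
    let ?i = "Inr (A \<bullet> \<sigma>) (B \<bullet> \<sigma>) (b \<star> \<sigma>)"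
    let ?inr = "Inr (A \<bullet> \<sigma>) (B \<bullet> \<sigma>)"
    note A' = mor_ty[OF A m] and B' = mor_ty[OF B m] and b' = mor_tm[OF b m]
    note i' = I_Inr[OF A' B' b']
    {
      fix x assume x: "\<Theta> \<turnstile> x \<Colon> A \<bullet> \<sigma>"
      note j = I_Inl[OF A' B' x]
      from Stab_Eq_sym[OF j i' Stab_Eq_Inl[OF A' B' stable_eq_mor[OF s(1) m] x i']]
      show "\<Theta> \<tturnstile> ?\<phi> \<bullet> (Inl (A \<bullet> \<sigma>) (B \<bullet> \<sigma>) x \<cdot> \<sigma>)" by (simp add: sigma)
    next
      fix x assume x: "\<Theta> \<turnstile> x \<Colon> B \<bullet> \<sigma>"
      have "\<Theta> \<tturnstile> Stab (Eq ?S ?i (?inr x))"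
      proof (rule Stab_Eq_inj[OF b' x i' I_Inr[OF A' B' x] stable_eq_D[OF stable_eq_mor[OF s(2) m] b' x]])
        fix \<Xi> \<tau> assume t: "mor \<Xi> \<tau> \<Theta>"
        note t1 = mor_ty[OF A' t] mor_ty[OF B' t]
        show "\<Xi> \<turnstile> ?i \<star> \<tau> \<doteq> ?inr x \<star> \<tau> \<Colon> ?S \<bullet> \<tau> \<Longrightarrow> \<Xi> \<turnstile> b \<star> \<sigma> \<star> \<tau> \<doteq> x \<star> \<tau> \<Colon> B \<bullet> \<sigma> \<bullet> \<tau>"
          using Inr_inj[OF t1 _ mor_tm[OF b' t] mor_tm[OF x t]] by simp
        show "\<Xi> \<turnstile> b \<star> \<sigma> \<star> \<tau> \<doteq> x \<star> \<tau> \<Colon> B \<bullet> \<sigma> \<bullet> \<tau> \<Longrightarrow> \<Xi> \<turnstile> ?i \<star> \<tau> \<doteq> ?inr x \<star> \<tau> \<Colon> ?S \<bullet> \<tau>"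
          using C_Inr[OF ty_refl[OF t1(1)] ty_refl[OF t1(2)]] by simp
      qed
      then show "\<Theta> \<tturnstile> ?\<phi> \<bullet> (?inr x \<cdot> \<sigma>)" by (simp add: sigma)
    }
  qed
  then show ?thesis by (simp add: sigma)
qed

lemma stable_eq_Sum:
  assumes A: "\<Gamma> \<turnstile> A type Set" and B: "\<Gamma> \<turnstile> B type Set" and s: "stable_eq \<Gamma> A" "stable_eq \<Gamma> B"
  shows "stable_eq \<Gamma> (Sum A B)"
  unfolding stable_eq_def
proof (intro allI impI)
  fix \<Theta> \<sigma> c d assume m: "mor \<Theta> \<sigma> \<Gamma>" and c: "\<Theta> \<turnstile> c \<Colon> Sum A B \<bullet> \<sigma>" and d: "\<Theta> \<turnstile> d \<Colon> Sum A B \<bullet> \<sigma>"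
  note A' = mor_ty[OF A m] and B' = mor_ty[OF B m] and s' = stable_eq_mor[OF s(1) m] stable_eq_mor[OF s(2) m]
  note S = F_Sum[OF A' B']
  let ?\<phi> = "Stab (Eq (Sum (A \<bullet> \<sigma>) (B \<bullet> \<sigma>) \<bullet> wk 1) (Var 0) (d \<star> wk 1))"
  have "\<Theta> \<tturnstile> ?\<phi> \<bullet> (c \<cdot> Var)"
  proof (rule Sum_cases[OF A' B' _ c[unfolded sub_ty.simps]])
    show "Sum (A \<bullet> \<sigma>) (B \<bullet> \<sigma>) # \<Theta> \<turnstile> ?\<phi> type Prop"
      using mor_tm[OF d wk_ctx1[OF S]] by (intro F_Stab_Prop F_Eq_Prop hyp0[OF S]) simp
    fix \<Xi> \<tau> x assume t: "mor \<Xi> \<tau> \<Theta>"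
    note d' = mor_tm[OF d t, unfolded sub_ty.simps]
    show "\<Xi> \<turnstile> x \<Colon> A \<bullet> \<sigma> \<bullet> \<tau> \<Longrightarrow> \<Xi> \<tturnstile> ?\<phi> \<bullet> (Inl (A \<bullet> \<sigma> \<bullet> \<tau>) (B \<bullet> \<sigma> \<bullet> \<tau>) x \<cdot> \<tau>)"
      using Stab_Eq_Inl[OF mor_ty[OF A' t] mor_ty[OF B' t] stable_eq_mor[OF s'(1) t] _ d'] by (simp add: sigma)
    show "\<Xi> \<turnstile> x \<Colon> B \<bullet> \<sigma> \<bullet> \<tau> \<Longrightarrow> \<Xi> \<tturnstile> ?\<phi> \<bullet> (Inr (A \<bullet> \<sigma> \<bullet> \<tau>) (B \<bullet> \<sigma> \<bullet> \<tau>) x \<cdot> \<tau>)"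
      using Stab_Eq_Inr[OF mor_ty[OF A' t] mor_ty[OF B' t] stable_eq_mor[OF s'(1) t] stable_eq_mor[OF s'(2) t] _ d'] by (simp add: sigma)
  qed
  then show "\<Theta> \<tturnstile> Stab (Eq (Sum A B \<bullet> \<sigma>) c d)" by (simp add: sigma)
qed

section \<open>Lists\<close>

lemma List_induct:
  assumes A: "\<Gamma> \<turnstile> A type Set" and \<phi>: "List A # \<Gamma> \<turnstile> \<phi> type Prop" and c: "\<Gamma> \<turnstile> c \<Colon> List A"
    and nil: "\<Gamma> \<tturnstile> \<phi> \<bullet> (Nil A \<cdot> Var)"
    and cons: "\<And>\<Theta> \<sigma> l a. \<lbrakk>mor \<Theta> \<sigma> \<Gamma>; \<Theta> \<turnstile> l \<Colon> List (A \<bullet> \<sigma>); \<Theta> \<turnstile> a \<Colon> A \<bullet> \<sigma>; \<Theta> \<tturnstile> \<phi> \<bullet> (l \<cdot> \<sigma>)\<rbrakk>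
       \<Longrightarrow> \<Theta> \<tturnstile> \<phi> \<bullet> (Cons (A \<bullet> \<sigma>) l a \<cdot> \<sigma>)"
  shows "\<Gamma> \<tturnstile> \<phi> \<bullet> (c \<cdot> Var)"
proof (rule true_I[OF inst_ty[OF \<phi> c] E_List[OF A ty_Col[OF \<phi>] c nil]])
  note l = list_ctx[OF A ty_Col[OF \<phi>]]
  have "A \<bullet> wk 1 # List A # \<Gamma> \<turnstile> Var 1 \<Colon> List A \<bullet> wk 2"
    using wk1_tm[OF hyp0[OF F_List[OF A]] l(2)] by (simp add: sigma)
  then have p: "A \<bullet> wk 1 # List A # \<Gamma> \<turnstile> \<phi> \<bullet> (Var 1 \<cdot> wk 2) type Prop"
    by (intro mor_ty[OF \<phi>] mor_scons wk_ctx2[OF l(2)])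
  have "\<phi> \<bullet> (Var 1 \<cdot> wk 2) # A \<bullet> wk 1 # List A # \<Gamma> \<tturnstile> \<phi> \<bullet> (Var 2 \<cdot> wk 3)"
    using hyp_true[OF p] by (simp add: sigma)
  from cons[OF l(3,4,5) this]
  show "\<phi> \<bullet> (Var 1 \<cdot> wk 2) # A \<bullet> wk 1 # List A # \<Gamma> \<tturnstile> \<phi> \<bullet> (Cons (A \<bullet> wk 3) (Var 2) (Var 1) \<cdot> wk 3)" .
qed

context
  fixes \<Gamma> A
  assumes A: "\<Gamma> \<turnstile> A type Set"
begin

text \<open>
  The two projections are defined by list elimination; the default values on the empty list are
  the empty list and the given \<open>a\<close>.
\<close>
lemma Cons_inj:
  assumes e: "\<Gamma> \<turnstile> Cons A l a \<doteq> Cons A l' a' \<Colon> List A"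
    and l: "\<Gamma> \<turnstile> l \<Colon> List A" "\<Gamma> \<turnstile> l' \<Colon> List A" and a: "\<Gamma> \<turnstile> a \<Colon> A" "\<Gamma> \<turnstile> a' \<Colon> A"
  shows "\<Gamma> \<turnstile> l \<doteq> l' \<Colon> List A" "\<Gamma> \<turnstile> a \<doteq> a' \<Colon> A"
proof -
  note S = F_List[OF A]
  show "\<Gamma> \<turnstile> l \<doteq> l' \<Colon> List A"
  proof -
    let ?f = "\<lambda>c. ElList A (List A \<bullet> wk 1) c (Nil A) (Var 2)"
    have L: "List A # \<Gamma> \<turnstile> List A \<bullet> wk 1 type Col" by (rule ty_Col[OF wk1_ty[OF S S]])
    have n: "\<Gamma> \<turnstile> Nil A \<Colon> List A \<bullet> wk 1 \<bullet> (Nil A \<cdot> Var)"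
      using I_Nil[OF A] by (simp add: sigma)
    have m: "List A \<bullet> wk 1 \<bullet> (Var 1 \<cdot> wk 2) # A \<bullet> wk 1 # List A # \<Gamma> \<turnstile> Var 2 \<Colon> List A \<bullet> wk 1 \<bullet> (Cons (A \<bullet> wk 3) (Var 2) (Var 1) \<cdot> wk 3)"
      using list_ctx(4)[OF A L] by (simp add: sigma)
    have "\<Gamma> \<turnstile> ?f (Cons A l a) \<doteq> ?f (Cons A l' a') \<Colon> List A"
      using C_ElList[OF ty_refl[OF A] ty_refl[OF L] e tm_refl[OF n] tm_refl[OF m]] by (simp add: sigma)
    moreover have "\<Gamma> \<turnstile> ?f (Cons A l a) \<doteq> l \<Colon> List A" "\<Gamma> \<turnstile> ?f (Cons A l' a') \<doteq> l' \<Colon> List A"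
      using B2_List[OF A L l(1) a(1) n m] B2_List[OF A L l(2) a(2) n m] by (simp_all add: sigma)
    ultimately show ?thesis by (meson tm_sym tm_trans)
  qed
  show "\<Gamma> \<turnstile> a \<doteq> a' \<Colon> A"
  proof -
    let ?f = "\<lambda>c. ElList A (A \<bullet> wk 1) c a (Var 1)"
    have L: "List A # \<Gamma> \<turnstile> A \<bullet> wk 1 type Col" by (rule ty_Col[OF wk1_ty[OF A S]])
    have n: "\<Gamma> \<turnstile> a \<Colon> A \<bullet> wk 1 \<bullet> (Nil A \<cdot> Var)"
      using a by (simp add: sigma)
    have m: "A \<bullet> wk 1 \<bullet> (Var 1 \<cdot> wk 2) # A \<bullet> wk 1 # List A # \<Gamma> \<turnstile> Var 1 \<Colon> A \<bullet> wk 1 \<bullet> (Cons (A \<bullet> wk 3) (Var 2) (Var 1) \<cdot> wk 3)"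
      using list_ctx(5)[OF A L] by (simp add: sigma)
    have "\<Gamma> \<turnstile> ?f (Cons A l a) \<doteq> ?f (Cons A l' a') \<Colon> A"
      using C_ElList[OF ty_refl[OF A] ty_refl[OF L] e tm_refl[OF n] tm_refl[OF m]] by (simp add: sigma)
    moreover have "\<Gamma> \<turnstile> ?f (Cons A l a) \<doteq> a \<Colon> A" "\<Gamma> \<turnstile> ?f (Cons A l' a') \<doteq> a' \<Colon> A"
      using B2_List[OF A L l(1) a(1) n m] B2_List[OF A L l(2) a(2) n m] by (simp_all add: sigma)
    ultimately show ?thesis by (meson tm_sym tm_trans)
  qed
qed

lemma Nil_Cons_disjoint:
  assumes e: "\<Gamma> \<turnstile> Nil A \<doteq> Cons A l a \<Colon> List A" and l: "\<Gamma> \<turnstile> l \<Colon> List A" and a: "\<Gamma> \<turnstile> a \<Colon> A"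
  shows "\<Gamma> \<tturnstile> Falsum"
proof -
  note c = ctx_of(3)[OF a]
  let ?f = "\<lambda>c. ElList A P1 c (Code Top) (Code Falsum)"
  have L: "List A # \<Gamma> \<turnstile> P1 type Col" by (rule F_P1[OF ctx_cons[OF F_List[OF A]]])
  have n: "\<Gamma> \<turnstile> Code Top \<Colon> P1 \<bullet> (Nil A \<cdot> Var)"
    using I_P1[OF F_Top[OF c]] by simp
  have m: "P1 \<bullet> (Var 1 \<cdot> wk 2) # A \<bullet> wk 1 # List A # \<Gamma> \<turnstile> Code Falsum \<Colon> P1 \<bullet> (Cons (A \<bullet> wk 3) (Var 2) (Var 1) \<cdot> wk 3)"
    using I_P1[OF F_Falsum[OF ctx_cons[OF list_ctx(1)[OF A L]]]] by simp
  have "\<Gamma> \<turnstile> ?f (Nil A) \<doteq> ?f (Cons A l a) \<Colon> P1"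
    using C_ElList[OF ty_refl[OF A] ty_refl[OF L] e tm_refl[OF n] tm_refl[OF m]] by simp
  moreover have "\<Gamma> \<turnstile> ?f (Nil A) \<doteq> Code Top \<Colon> P1" "\<Gamma> \<turnstile> ?f (Cons A l a) \<doteq> Code Falsum \<Colon> P1"
    using B1_List[OF A L n m] B2_List[OF A L l a n m] by simp_all
  ultimately show ?thesis by (meson tm_sym tm_trans Code_Top_Falsum)
qed

end

lemma Stab_Eq_Nil_Cons:
  assumes A: "\<Gamma> \<turnstile> A type Set" and l: "\<Gamma> \<turnstile> l \<Colon> List A" and a: "\<Gamma> \<turnstile> a \<Colon> A"
  shows "\<Gamma> \<tturnstile> Stab (Eq (List A) (Nil A) (Cons A l a))"
proof (rule Stab_Eq_disjoint[OF I_Nil[OF A] I_Cons[OF A l a]])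
  fix \<Theta> \<sigma> assume m: "mor \<Theta> \<sigma> \<Gamma>" and "\<Theta> \<turnstile> Nil A \<star> \<sigma> \<doteq> Cons A l a \<star> \<sigma> \<Colon> List A \<bullet> \<sigma>"
  then show "\<Theta> \<tturnstile> Falsum"
    using Nil_Cons_disjoint[OF mor_ty[OF A m] _ mor_tm[OF l m, unfolded sub_ty.simps] mor_tm[OF a m]] by simp
qed

lemma Stab_Eq_Nil:
  assumes A: "\<Gamma> \<turnstile> A type Set" and c: "\<Gamma> \<turnstile> c \<Colon> List A"
  shows "\<Gamma> \<tturnstile> Stab (Eq (List A) (Nil A) c)"
proof -
  note S = F_List[OF A] and i = I_Nil[OF A]
  let ?\<phi> = "Stab (Eq (List A \<bullet> wk 1) (Nil A \<star> wk 1) (Var 0))"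
  have "\<Gamma> \<tturnstile> ?\<phi> \<bullet> (c \<cdot> Var)"
  proof (rule List_induct[OF A _ c])
    show "List A # \<Gamma> \<turnstile> ?\<phi> type Prop"
      by (intro F_Stab_Prop F_Eq_Prop mor_tm[OF i wk_ctx1[OF S]] hyp0[OF S])
    have "\<Gamma> \<tturnstile> Stab (Eq (List A) (Nil A) (Nil A))"
      by (rule Stab_Eq_I[OF i i]) (rule tm_refl[OF mor_tm[OF i]])
    then show "\<Gamma> \<tturnstile> ?\<phi> \<bullet> (Nil A \<cdot> Var)" by (simp add: sigma)
    fix \<Theta> \<sigma> l a assume m: "mor \<Theta> \<sigma> \<Gamma>" and "\<Theta> \<turnstile> l \<Colon> List (A \<bullet> \<sigma>)" "\<Theta> \<turnstile> a \<Colon> A \<bullet> \<sigma>"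
    from Stab_Eq_Nil_Cons[OF mor_ty[OF A m] this(2,3)]
    show "\<Theta> \<tturnstile> ?\<phi> \<bullet> (Cons (A \<bullet> \<sigma>) l a \<cdot> \<sigma>)" by (simp add: sigma)
  qed
  then show ?thesis by (simp add: sigma)
qed

lemma Stab_Eq_Cons_Cons:
  assumes A: "\<Gamma> \<turnstile> A type Set" and l: "\<Gamma> \<turnstile> l \<Colon> List A" "\<Gamma> \<turnstile> l' \<Colon> List A" and a: "\<Gamma> \<turnstile> a \<Colon> A" "\<Gamma> \<turnstile> a' \<Colon> A"
    and s: "\<Gamma> \<tturnstile> Stab (Eq A a a')" "\<Gamma> \<tturnstile> Stab (Eq (List A) l l')"
  shows "\<Gamma> \<tturnstile> Stab (Eq (List A) (Cons A l a) (Cons A l' a'))"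
proof (rule Stab_Eq_I[OF I_Cons[OF A l(1) a(1)] I_Cons[OF A l(2) a(2)]])
  fix \<Theta> \<sigma> assume m: "mor \<Theta> \<sigma> \<Gamma>" and "\<Theta> \<tturnstile> Neg (Neg (Eq (List A \<bullet> \<sigma>) (Cons A l a \<star> \<sigma>) (Cons A l' a' \<star> \<sigma>)))"
  then have nn: "\<Theta> \<tturnstile> Neg (Neg (Eq (List (A \<bullet> \<sigma>)) (Cons (A \<bullet> \<sigma>) (l \<star> \<sigma>) (a \<star> \<sigma>)) (Cons (A \<bullet> \<sigma>) (l' \<star> \<sigma>) (a' \<star> \<sigma>))))" by simp
  let ?c = "Cons (A \<bullet> \<sigma>) (l \<star> \<sigma>) (a \<star> \<sigma>)"
  let ?c' = "Cons (A \<bullet> \<sigma>) (l' \<star> \<sigma>) (a' \<star> \<sigma>)"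
  note A' = mor_ty[OF A m] and l' = mor_tm[OF l(1) m, unfolded sub_ty.simps] mor_tm[OF l(2) m, unfolded sub_ty.simps]
  note a' = mor_tm[OF a(1) m] mor_tm[OF a(2) m]
  note i = I_Cons[OF A' l'(1) a'(1)] I_Cons[OF A' l'(2) a'(2)]
  have inj: "\<Xi> \<turnstile> l \<star> \<sigma> \<star> \<tau> \<doteq> l' \<star> \<sigma> \<star> \<tau> \<Colon> List (A \<bullet> \<sigma> \<bullet> \<tau>) \<and> \<Xi> \<turnstile> a \<star> \<sigma> \<star> \<tau> \<doteq> a' \<star> \<sigma> \<star> \<tau> \<Colon> A \<bullet> \<sigma> \<bullet> \<tau>"
    if t: "mor \<Xi> \<tau> \<Theta>" and e: "\<Xi> \<turnstile> ?c \<star> \<tau> \<doteq> ?c' \<star> \<tau> \<Colon> List (A \<bullet> \<sigma>) \<bullet> \<tau>" for \<Xi> \<tau>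
    using Cons_inj[OF mor_ty[OF A' t] e[unfolded sub_ty.simps sub_tm.simps] mor_tm[OF l'(1) t, unfolded sub_ty.simps]
      mor_tm[OF l'(2) t, unfolded sub_ty.simps] mor_tm[OF a'(1) t] mor_tm[OF a'(2) t]] by blast
  have "\<Theta> \<tturnstile> Neg (Neg (Eq (List (A \<bullet> \<sigma>)) (l \<star> \<sigma>) (l' \<star> \<sigma>)))"
    by (rule nn_eq_map[OF nn i F_Eq_Prop[OF l']]) (simp add: eq_true inj)
  moreover have "\<Theta> \<tturnstile> Neg (Neg (Eq (A \<bullet> \<sigma>) (a \<star> \<sigma>) (a' \<star> \<sigma>)))"
    by (rule nn_eq_map[OF nn i F_Eq_Prop[OF a']]) (simp add: eq_true inj)
  ultimately show "\<Theta> \<turnstile> Cons A l a \<star> \<sigma> \<doteq> Cons A l' a' \<star> \<sigma> \<Colon> List A \<bullet> \<sigma>"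
    using Stab_Eq_E[OF _ l'] Stab_Eq_E[OF _ a'] mor_true[OF s(1) m] mor_true[OF s(2) m] by (simp add: C_Cons ty_refl A')
qed

text \<open>
  The induction step of stability for lists: a case distinction on \<open>c\<close>, where the induction
  hypothesis on the tail \<open>l\<close> has to be available for all lists.
\<close>
lemma Stab_Eq_Cons:
  assumes A: "\<Gamma> \<turnstile> A type Set" and s: "stable_eq \<Gamma> A"
    and l: "\<Gamma> \<turnstile> l \<Colon> List A" and a: "\<Gamma> \<turnstile> a \<Colon> A" and c: "\<Gamma> \<turnstile> c \<Colon> List A"
    and IH: "\<And>\<Theta> \<sigma> l'. \<lbrakk>mor \<Theta> \<sigma> \<Gamma>; \<Theta> \<turnstile> l' \<Colon> List (A \<bullet> \<sigma>)\<rbrakk> \<Longrightarrow> \<Theta> \<tturnstile> Stab (Eq (List (A \<bullet> \<sigma>)) (l \<star> \<sigma>) l')"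
  shows "\<Gamma> \<tturnstile> Stab (Eq (List A) (Cons A l a) c)"
proof -
  note S = F_List[OF A] and i = I_Cons[OF A l a]
  let ?\<phi> = "Stab (Eq (List A \<bullet> wk 1) (Cons A l a \<star> wk 1) (Var 0))"
  have "\<Gamma> \<tturnstile> ?\<phi> \<bullet> (c \<cdot> Var)"
  proof (rule List_induct[OF A _ c])
    show "List A # \<Gamma> \<turnstile> ?\<phi> type Prop"
      by (intro F_Stab_Prop F_Eq_Prop mor_tm[OF i wk_ctx1[OF S]] hyp0[OF S])
    from Stab_Eq_sym[OF I_Nil[OF A] i Stab_Eq_Nil_Cons[OF A l a]]
    show "\<Gamma> \<tturnstile> ?\<phi> \<bullet> (Nil A \<cdot> Var)" by (simp add: sigma)
    fix \<Theta> \<sigma> l' a' assume m: "mor \<Theta> \<sigma> \<Gamma>" and l': "\<Theta> \<turnstile> l' \<Colon> List (A \<bullet> \<sigma>)" and a': "\<Theta> \<turnstile> a' \<Colon> A \<bullet> \<sigma>"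
    from Stab_Eq_Cons_Cons[OF mor_ty[OF A m] mor_tm[OF l m, unfolded sub_ty.simps] l' mor_tm[OF a m] a'
        stable_eq_D[OF stable_eq_mor[OF s m] mor_tm[OF a m] a'] IH[OF m l']]
    show "\<Theta> \<tturnstile> ?\<phi> \<bullet> (Cons (A \<bullet> \<sigma>) l' a' \<cdot> \<sigma>)" by (simp add: sigma)
  qed
  then show ?thesis by (simp add: sigma)
qed

text \<open>
  Induction on the first list, for the proposition that its equality with every second list is
  stable.
\<close>
lemma stable_eq_List:
  assumes A: "\<Gamma> \<turnstile> A type Set" and s: "stable_eq \<Gamma> A"
  shows "stable_eq \<Gamma> (List A)"
  unfolding stable_eq_def
proof (intro allI impI)
  fix \<Theta> \<sigma> c d assume m: "mor \<Theta> \<sigma> \<Gamma>" and c: "\<Theta> \<turnstile> c \<Colon> List A \<bullet> \<sigma>" and d: "\<Theta> \<turnstile> d \<Colon> List A \<bullet> \<sigma>"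
  define A' where "A' = A \<bullet> \<sigma>"
  have c: "\<Theta> \<turnstile> c \<Colon> List A'" and d: "\<Theta> \<turnstile> d \<Colon> List A'" using c d by (simp_all add: A'_def)
  have A': "\<Theta> \<turnstile> A' type Set" and s': "stable_eq \<Theta> A'"
    unfolding A'_def by (rule mor_ty[OF A m] stable_eq_mor[OF s m])+
  note S = F_List[OF A']
  note w = wk_ctx1[OF S]
  note S1 = mor_ty[OF S w]
  let ?\<psi> = "Stab (Eq (List A' \<bullet> wk 2) (Var 1) (Var 0))"
  let ?\<phi> = "Uni (List A' \<bullet> wk 1) ?\<psi>"
  have p: "List A' \<bullet> wk 1 # List A' # \<Theta> \<turnstile> ?\<psi> type Prop"
    using wk1_tm[OF hyp0[OF S] S1] hyp0[OF S1] by (intro F_Stab_Prop F_Eq_Prop) (simp_all add: sigma)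
  have q: "List A' # \<Theta> \<turnstile> ?\<phi> type Prop" using p ty_Col[OF S1] by (blast intro: F_Uni prop_over.intros)
  \<comment> \<open>introduction and elimination of \<open>?\<phi>\<close>, stated so that no substitution under the quantifier remains\<close>
  have phi_I: "\<Xi> \<tturnstile> ?\<phi> \<bullet> (l \<cdot> \<tau>)"
    if t: "mor \<Xi> \<tau> \<Theta>" and l: "\<Xi> \<turnstile> l \<Colon> List (A' \<bullet> \<tau>)"
      and *: "List (A' \<bullet> \<tau>) # \<Xi> \<tturnstile> Stab (Eq (List (A' \<bullet> \<tau> \<bullet> wk 1)) (l \<star> wk 1) (Var 0))" for \<Xi> \<tau> l
  proof -
    note m1 = mor_scons[OF t, of l "List A'", unfolded sub_ty.simps, OF l]
    from *[THEN tm_ty] have L: "\<Xi> \<turnstile> List (A' \<bullet> \<tau>) type Col" by (rule ctx_head[OF ctx_of(2)])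
    have L': "\<Xi> \<turnstile> List A' \<bullet> wk 1 \<bullet> (l \<cdot> \<tau>) type Col" using L by (simp add: sigma)
    show ?thesis
      using I_Uni[OF L' mor_ty[OF p mor_up[OF m1 L']]] * by (simp add: sigma)
  qed
  have phi_E: "\<Xi> \<tturnstile> Stab (Eq (List (A' \<bullet> \<tau>)) l x)"
    if t: "mor \<Xi> \<tau> \<Theta>" and l: "\<Xi> \<turnstile> l \<Colon> List (A' \<bullet> \<tau>)" and x: "\<Xi> \<turnstile> x \<Colon> List (A' \<bullet> \<tau>)"
      and *: "\<Xi> \<tturnstile> ?\<phi> \<bullet> (l \<cdot> \<tau>)" for \<Xi> \<tau> l x
  proof -
    note m1 = mor_scons[OF t, of l "List A'", unfolded sub_ty.simps, OF l]
    have L': "\<Xi> \<turnstile> List A' \<bullet> wk 1 \<bullet> (l \<cdot> \<tau>) type Col" using tm_ty[OF x] by (simp add: sigma)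
    show ?thesis
      using E_Uni[OF L' mor_ty[OF p mor_up[OF m1 L']], of x] * x by (simp add: sigma)
  qed
  have "\<Theta> \<tturnstile> ?\<phi> \<bullet> (c \<cdot> Var)"
  proof (rule List_induct[OF A' q c])
    show "\<Theta> \<tturnstile> ?\<phi> \<bullet> (Nil A' \<cdot> Var)"
    proof (rule phi_I[OF mor_id[OF mor_ctx[OF m]], unfolded sub_id, OF I_Nil[OF A']])
      show "List A' # \<Theta> \<tturnstile> Stab (Eq (List (A' \<bullet> wk 1)) (Nil A' \<star> wk 1) (Var 0))"
        using Stab_Eq_Nil[OF mor_ty[OF A' w] hyp0[OF S, unfolded sub_ty.simps]] by simp
    qed
    fix \<Xi> \<tau> l a assume t: "mor \<Xi> \<tau> \<Theta>" and l: "\<Xi> \<turnstile> l \<Colon> List (A' \<bullet> \<tau>)" and a: "\<Xi> \<turnstile> a \<Colon> A' \<bullet> \<tau>"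
      and h: "\<Xi> \<tturnstile> ?\<phi> \<bullet> (l \<cdot> \<tau>)"
    note A2 = mor_ty[OF A' t]
    note w2 = wk_ctx1[OF F_List[OF A2]]
    show "\<Xi> \<tturnstile> ?\<phi> \<bullet> (Cons (A' \<bullet> \<tau>) l a \<cdot> \<tau>)"
    proof (rule phi_I[OF t I_Cons[OF A2 l a]])
      have "List (A' \<bullet> \<tau>) # \<Xi> \<tturnstile> Stab (Eq (List (A' \<bullet> \<tau> \<bullet> wk 1)) (Cons (A' \<bullet> \<tau> \<bullet> wk 1) (l \<star> wk 1) (a \<star> wk 1)) (Var 0))"
      proof (rule Stab_Eq_Cons[OF mor_ty[OF A2 w2] stable_eq_mor[OF stable_eq_mor[OF s' t] w2] mor_tm[OF l w2, unfolded sub_ty.simps] mor_tm[OF a w2] hyp0[OF F_List[OF A2], unfolded sub_ty.simps]])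
        fix \<Xi>' \<rho> x assume r: "mor \<Xi>' \<rho> (List (A' \<bullet> \<tau>) # \<Xi>)" and x: "\<Xi>' \<turnstile> x \<Colon> List (A' \<bullet> \<tau> \<bullet> wk 1 \<bullet> \<rho>)"
        note wr = mor_comp[OF w2 r]
        show "\<Xi>' \<tturnstile> Stab (Eq (List (A' \<bullet> \<tau> \<bullet> wk 1 \<bullet> \<rho>)) (l \<star> wk 1 \<star> \<rho>) x)"
          using phi_E[OF mor_comp[OF t wr], of "l \<star> (wk 1 \<odot> \<rho>)" x] mor_tm[OF l wr] mor_true[OF h wr] x by (simp add: sigma)
      qed
      then show "List (A' \<bullet> \<tau>) # \<Xi> \<tturnstile> Stab (Eq (List (A' \<bullet> \<tau> \<bullet> wk 1)) (Cons (A' \<bullet> \<tau>) l a \<star> wk 1) (Var 0))" by simp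
    qed
  qed
  from phi_E[OF mor_id[OF mor_ctx[OF m]] _ _ this] c d
  show "\<Theta> \<tturnstile> Stab (Eq (List A \<bullet> \<sigma>) c d)" by (simp add: A'_def)
qed

section \<open>Excluded middle, disjunction and existence up to double negation\<close>

text \<open>
  From \<open>\<not>(\<phi> \<or> \<not>\<phi>)\<close> follows \<open>\<not>\<phi>\<close>, hence \<open>\<phi> \<or> \<not>\<phi>\<close>.
\<close>
lemma nn_LEM:
  assumes "\<Gamma> \<turnstile> \<phi> type Prop"
  shows "\<Gamma> \<tturnstile> Neg (Neg (Disj \<phi> (Neg \<phi>)))"
proof -
  have D: "\<Gamma> \<turnstile> Disj \<phi> (Neg \<phi>) type Prop" if "\<Gamma> \<turnstile> \<phi> type Prop" for \<Gamma> \<phi>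
    using that by (simp add: F_Disj F_Neg_Prop)
  note n = F_Neg_Prop[OF D[OF assms]]
  note p = wk1_ty[OF assms n]
  note w = wk_ctx1[OF p]
  note h = hyp_true[OF n, unfolded defined_sub sub_ty.simps]
  have "\<phi> \<bullet> wk 1 # Neg (Disj \<phi> (Neg \<phi>)) # \<Gamma> \<tturnstile> Falsum"
    by (rule Neg_E[OF D[OF mor_ty[OF p w]] _ I1_Disj[OF mor_ty[OF p w] F_Neg_Prop[OF mor_ty[OF p w]] hyp_true[OF p]]])
      (use mor_true[OF h w] in simp)
  from Neg_E[OF D[OF p] h I2_Disj[OF p F_Neg_Prop[OF p] Neg_I[OF p this]]]
  show ?thesis by (rule Neg_I[OF n])
qed

text \<open>
  The case distinction proves the double negation of the conclusion, and stability removes it.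
\<close>
lemma nn_Disj_E:
  assumes p: "\<Gamma> \<turnstile> \<phi> type Prop" "\<Gamma> \<turnstile> \<psi> type Prop" "\<Gamma> \<turnstile> \<chi> type Prop"
    and s: "\<Gamma> \<tturnstile> Stab \<chi>" and nn: "\<Gamma> \<tturnstile> Neg (Neg (Disj \<phi> \<psi>))"
    and c: "\<phi> # \<Gamma> \<tturnstile> \<chi> \<bullet> wk 1" "\<psi> # \<Gamma> \<tturnstile> \<chi> \<bullet> wk 1"
  shows "\<Gamma> \<tturnstile> \<chi>"
proof -
  have D: "\<Gamma> \<turnstile> Disj \<phi> \<psi> type Prop" using p by (simp add: F_Disj)
  note w = wk_ctx1[OF D]
  note p' = mor_ty[OF p(1) w] mor_ty[OF p(2) w] mor_ty[OF p(3) w]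
  have "Disj \<phi> \<psi> # \<Gamma> \<tturnstile> \<chi> \<bullet> wk 1"
    using hyp_true[OF D] mor_true[OF c(1) mor_up[OF w ty_Col[OF p'(1)]]] mor_true[OF c(2) mor_up[OF w ty_Col[OF p'(2)]]]
    by (intro E_Disj[OF p']) (simp_all add: sigma)
  from Stab_E[OF p(3) s nn_mono[OF D p(3) nn this]] show ?thesis .
qed

lemma nn_Exi_E:
  assumes A: "\<Gamma> \<turnstile> A type Col" and p: "A # \<Gamma> \<turnstile> \<phi> type Prop" "\<Gamma> \<turnstile> \<chi> type Prop"
    and s: "\<Gamma> \<tturnstile> Stab \<chi>" and nn: "\<Gamma> \<tturnstile> Neg (Neg (Exi A \<phi>))"
    and c: "\<phi> # A # \<Gamma> \<tturnstile> \<chi> \<bullet> wk 2"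
  shows "\<Gamma> \<tturnstile> \<chi>"
proof -
  have D: "\<Gamma> \<turnstile> Exi A \<phi> type Prop" using A p by (blast intro: F_Exi prop_over.intros)
  note w = wk_ctx1[OF D]
  note A' = mor_ty[OF A w]
  note u = mor_up[OF w A']
  note p' = mor_ty[OF p(1) u] mor_ty[OF p(2) w]
  have "Exi A \<phi> # \<Gamma> \<tturnstile> \<chi> \<bullet> wk 1"
    using hyp_true[OF D] mor_true[OF c(1) mor_up[OF u ty_Col[OF p'(1)]]]
    by (intro E_Exi[OF A' p']) (simp_all add: sigma)
  from Stab_E[OF p(2) s nn_mono[OF D p(2) nn this]] show ?thesis .
qed

section \<open>Stable propositions and collections\<close>

text \<open>
  The invariant of the translation, for a type of kind \<open>K\<close>.
\<close>
definition stable_ty :: "ty list \<Rightarrow> ty \<Rightarrow> kind \<Rightarrow> bool" where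
  "stable_ty \<Gamma> A K \<longleftrightarrow> stable_eq \<Gamma> A \<and> (K \<in> {PropS, Prop} \<longrightarrow> \<Gamma> \<tturnstile> Stab A)"

lemma stable_prop: "\<lbrakk>K \<in> {PropS, Prop}; \<Gamma> \<turnstile> \<phi> type K; \<Gamma> \<tturnstile> Stab \<phi>\<rbrakk> \<Longrightarrow> stable_ty \<Gamma> \<phi> K"
  by (auto simp: stable_ty_def intro: stable_eq_prop PropS_Prop)

lemma stable_Stab: "\<lbrakk>stable_ty \<Gamma> \<phi> K; K \<in> {PropS, Prop}\<rbrakk> \<Longrightarrow> \<Gamma> \<tturnstile> Stab \<phi>"
  by (auto simp: stable_ty_def)

lemma stable_type: "\<lbrakk>K \<in> {Set, Col}; stable_eq \<Gamma> A\<rbrakk> \<Longrightarrow> stable_ty \<Gamma> A K"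
  by (auto simp: stable_ty_def)

lemma stable_eqD: "stable_ty \<Gamma> A K \<Longrightarrow> stable_eq \<Gamma> A"
  by (simp add: stable_ty_def)

lemma stable_mor: "\<lbrakk>stable_ty \<Gamma> A K; mor \<Theta> \<sigma> \<Gamma>\<rbrakk> \<Longrightarrow> stable_ty \<Theta> (A \<bullet> \<sigma>) K"
  unfolding stable_ty_def by (metis stable_eq_mor mor_true defined_sub(5))

lemma stable_conv: "\<lbrakk>stable_ty \<Gamma> A K; \<Gamma> \<turnstile> A \<doteq> B type K\<rbrakk> \<Longrightarrow> stable_ty \<Gamma> B K"
  unfolding stable_ty_def by (blast intro: stable_eq_conv Stab_conv)

lemma stable_incl: "\<lbrakk>stable_ty \<Gamma> A K; incl K K'\<rbrakk> \<Longrightarrow> stable_ty \<Gamma> A K'"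
  unfolding stable_ty_def by (auto elim: incl.cases)

lemma prop_over_kinds: "prop_over K K' \<Longrightarrow> K \<in> {PropS, Prop} \<and> K' \<in> {Set, Col}"
  by (auto elim: prop_over.cases)

lemma stable_Falsum: "T \<turnstile> \<Gamma> ctx \<Longrightarrow> stable_ty \<Gamma> Falsum PropS"
  by (rule stable_prop) (auto intro: F_Falsum Stab_Falsum)

lemma stable_Conj:
  "\<lbrakk>K \<in> {PropS, Prop}; \<Gamma> \<turnstile> \<phi> type K; \<Gamma> \<turnstile> \<psi> type K; stable_ty \<Gamma> \<phi> K; stable_ty \<Gamma> \<psi> K\<rbrakk> \<Longrightarrow> stable_ty \<Gamma> (Conj \<phi> \<psi>) K"
  by (rule stable_prop) (blast intro: F_Conj Stab_Conj prop_ty stable_Stab)+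

lemma stable_Impl:
  "\<lbrakk>K \<in> {PropS, Prop}; \<Gamma> \<turnstile> \<phi> type K; \<Gamma> \<turnstile> \<psi> type K; stable_ty \<Gamma> \<psi> K\<rbrakk> \<Longrightarrow> stable_ty \<Gamma> (Impl \<phi> \<psi>) K"
  by (rule stable_prop) (blast intro: F_Impl Stab_Impl prop_ty stable_Stab)+

lemma stable_Neg: "\<lbrakk>K \<in> {PropS, Prop}; \<Gamma> \<turnstile> \<phi> type K\<rbrakk> \<Longrightarrow> stable_ty \<Gamma> (Neg \<phi>) K"
  by (rule stable_prop) (blast intro: F_Neg Stab_Neg prop_ty)+

lemma stable_Uni:
  "\<lbrakk>prop_over K K'; \<Gamma> \<turnstile> A type K'; A # \<Gamma> \<turnstile> \<phi> type K; stable_ty (A # \<Gamma>) \<phi> K\<rbrakk> \<Longrightarrow> stable_ty \<Gamma> (Uni A \<phi>) K"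
  using prop_over_kinds[of K K'] by (intro stable_prop) (blast intro: F_Uni Stab_Uni prop_ty stable_Stab ty_Col)+

lemma stable_Eq:
  "\<lbrakk>prop_over K K'; \<Gamma> \<turnstile> A type K'; \<Gamma> \<turnstile> a \<Colon> A; \<Gamma> \<turnstile> b \<Colon> A; stable_ty \<Gamma> A K'\<rbrakk> \<Longrightarrow> stable_ty \<Gamma> (Eq A a b) K"
  using prop_over_kinds[of K K'] by (intro stable_prop) (blast intro: F_Eq stable_eq_D stable_eqD)+

text \<open>
  This is where codes need their propositions to be stable: the second component of the pair is a
  proof that the decoding of the code is stable.
\<close>
lemma Code_tm:
  assumes "\<Gamma> \<turnstile> \<phi> type PropS" "stable_ty \<Gamma> \<phi> PropS"
  shows "\<Gamma> \<turnstile> pairP1 (Code \<phi>) \<Colon> P1N" "\<Gamma> \<turnstile> fstP1 (pairP1 (Code \<phi>)) \<doteq> Code \<phi> \<Colon> P1"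
  using stable_Stab[OF assms(2)] assms(1) by (auto intro!: pairP1_tm fstP1_pair I_P1 Stab_Dc_Code)

lemma Code_cong:
  assumes "\<Gamma> \<turnstile> Code \<phi> \<doteq> Code \<psi> \<Colon> P1" "\<Gamma> \<turnstile> \<phi> type PropS" "stable_ty \<Gamma> \<phi> PropS"
  shows "\<Gamma> \<turnstile> pairP1 (Code \<phi>) \<doteq> pairP1 (Code \<psi>) \<Colon> P1N"
proof -
  note c = ctx_of(5)[OF assms(1)]
  have "\<Gamma> \<tturnstile> Stab (Dc (Var 0)) \<bullet> (Code \<phi> \<cdot> Var)"
    using Stab_Dc_Code[OF assms(2)] stable_Stab[OF assms(3)] by simp
  from Pair_cong[OF F_P1[OF c] StabDc_Col[OF c] assms(1) tm_refl[OF this]] show ?thesis by (simp add: P1N_def)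
qed

lemma fstP1_Code_Top: "T \<turnstile> \<Gamma> ctx \<Longrightarrow> \<Gamma> \<turnstile> fstP1 (pairP1 (Code Top)) \<doteq> Code Top \<Colon> P1"
  by (rule Code_tm(2)[OF F_Top]) (auto simp: Top_def intro: stable_Neg F_Falsum)

text \<open>
  The translation of a decoding is small because the first component of \<open>[\<top>]\<close> is \<open>[\<top>]\<close> again, so
  that the rule for decodings applies up to judgemental equality.
\<close>
lemma F_Dc_N:
  assumes "\<Gamma> \<turnstile> U \<Colon> P1N" "\<Gamma> \<turnstile> V \<doteq> pairP1 (Code Top) \<Colon> P1N"
  shows "\<Gamma> \<turnstile> Eq P1 (fstP1 U) (fstP1 V) type PropS" "stable_ty \<Gamma> (Eq P1 (fstP1 U) (fstP1 V)) PropS"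
proof -
  show *: "\<Gamma> \<turnstile> Eq P1 (fstP1 U) (fstP1 V) type PropS"
    by (rule F_Dc[OF fstP1_tm[OF assms(1)] tm_trans[OF fstP1_cong[OF assms(2)] fstP1_Code_Top[OF ctx_of(3)[OF assms(1)]]]])
  show "stable_ty \<Gamma> (Eq P1 (fstP1 U) (fstP1 V)) PropS"
    by (rule stable_prop[OF _ * Stab_Eq_fstP1[OF assms(1) eq_tm_l[OF assms(2)]]]) simp
qed

text \<open>
  The translation of the rule that every truth value is the code of its decoding.
\<close>
lemma Code_Dc_N:
  assumes U: "\<Gamma> \<turnstile> U \<Colon> P1N"
  shows "\<Gamma> \<turnstile> U \<doteq> pairP1 (Code (Eq P1 (fstP1 U) (fstP1 (pairP1 (Code Top))))) \<Colon> P1N"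
proof -
  note c = ctx_of(3)[OF U]
  have t: "\<Gamma> \<turnstile> pairP1 (Code Top) \<doteq> pairP1 (Code Top) \<Colon> P1N"
    by (rule tm_refl[OF Code_tm(1)[OF F_Top[OF c]]]) (auto simp: Top_def intro: stable_Neg F_Falsum c)
  note f = F_Dc_N[OF U t]
  have "\<Gamma> \<turnstile> Code (Eq P1 (fstP1 U) (fstP1 (pairP1 (Code Top)))) \<doteq> Code (Dc (fstP1 U)) \<Colon> P1"
    unfolding Dc_def[of "fstP1 U"] by (rule C_Code[OF C_Dc[OF tm_refl[OF fstP1_tm[OF U]] fstP1_Code_Top[OF c] fstP1_Code_Top[OF c]]])
  with eta_P1[OF fstP1_tm[OF U]] Code_tm(2)[OF f]
  have "\<Gamma> \<turnstile> fstP1 U \<doteq> fstP1 (pairP1 (Code (Eq P1 (fstP1 U) (fstP1 (pairP1 (Code Top)))))) \<Colon> P1"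
    by (blast intro: tm_trans tm_sym)
  then show ?thesis by (rule P1N_ext[OF U Code_tm(1)[OF f]])
qed

end

section \<open>The translation and substitution\<close>

definition N_sub :: "(nat \<Rightarrow> tm) \<Rightarrow> nat \<Rightarrow> tm" where
  "N_sub \<sigma> = (\<lambda>n. N_tm (\<sigma> n))"

lemma N_sub_app: "N_sub \<sigma> n = N_tm (\<sigma> n)"
  by (simp add: N_sub_def)

lemma ren_eq_P1 [simp]: "ren_ty r A = P1 \<longleftrightarrow> A = P1"
  by (cases A) simp_all

lemma sub_eq_P1 [simp]: "A \<bullet> \<sigma> = P1 \<longleftrightarrow> A = P1"
  by (cases A) simp_all

lemma ren_derived:
  "ren_ty r (Neg \<phi>) = Neg (ren_ty r \<phi>)" "ren_ty r P1N = P1N" "ren_ty r (FunP1N A) = FunP1N (ren_ty r A)"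
  "ren_tm r (fstP1 u) = fstP1 (ren_tm r u)" "ren_tm r (LamP1N A b) = LamP1N (ren_ty r A) (ren_tm (upr r) b)"
  "ren_tm r (ApP1N A f a) = ApP1N (ren_ty r A) (ren_tm r f) (ren_tm r a)"
  "ren_tm r (pairP1 U) = pairP1 (ren_tm r U)"
  by (simp_all add: ren_as_sub FunP1N_sub LamP1N_sub ApP1N_sub up_Var[symmetric]) (simp add: up_def)

lemma N_ren: "N_ty (ren_ty r A) = ren_ty r (N_ty A)" "N_tm (ren_tm r a) = ren_tm r (N_tm a)"
proof (induction A and a arbitrary: r and r)
  case (Code \<phi>)
  then show ?case using ren_derived(7) by simp
qed (simp_all add: ren_derived)

lemma N_sub_up: "N_sub (up \<sigma>) = up (N_sub \<sigma>)"
  by (rule ext) (simp add: N_sub_def up_def scons_def N_ren split: nat.split)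

lemma N_sub_sub: "N_ty (A \<bullet> \<sigma>) = N_ty A \<bullet> N_sub \<sigma>" "N_tm (a \<star> \<sigma>) = N_tm a \<star> N_sub \<sigma>"
proof (induction A and a arbitrary: \<sigma> and \<sigma>)
  case (Var n)
  then show ?case by (simp add: N_sub_def)
next
  case (Code \<phi>)
  then show ?case by (simp add: up_conv)
qed (simp_all add: N_sub_up FunP1N_sub LamP1N_sub ApP1N_sub)

lemma N_sub_simps:
  "N_sub (a \<cdot> \<sigma>) = N_tm a \<cdot> N_sub \<sigma>" "N_sub (wk k) = wk k" "N_sub Var = Var"
  by (rule ext, simp add: N_sub_def wk_def scons_def split: nat.split)+

lemma N_derived: "N_ty (Neg \<phi>) = Neg (N_ty \<phi>)" "N_ty Top = Top" "N_ty (Iff \<phi> \<psi>) = Iff (N_ty \<phi>) (N_ty \<psi>)"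
  "N_ty (Dc U) = Eq P1 (fstP1 (N_tm U)) (fstP1 (pairP1 (Code Top)))"
  by (simp_all add: Neg_def Top_def Iff_def Dc_def)

lemma N_ctx_simps: "N_ctx [] = []" "N_ctx (A # \<Gamma>) = N_ty A # N_ctx \<Gamma>" "length (N_ctx \<Gamma>) = length \<Gamma>"
  by (simp_all add: N_ctx_def)

lemmas N_simps = N_sub_sub N_sub_up N_sub_simps N_derived N_ctx_simps

text \<open>
  Type equality is generated by congruence rules, so it preserves head constructors. In
  particular \<open>P(1)\<close> is equal to itself only, and the only kind it has is that of collections.
\<close>
lemma P1_rigid:
  "T \<turnstile> \<Gamma> ctx \<Longrightarrow> True"
  "T \<parallel> \<Gamma> \<turnstile> A type K \<Longrightarrow> A = P1 \<Longrightarrow> K = Col"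
  "T \<parallel> \<Gamma> \<turnstile> a \<Colon> A \<Longrightarrow> True"
  "T \<parallel> \<Gamma> \<turnstile> A \<doteq> B type K \<Longrightarrow> (A = P1 \<longleftrightarrow> B = P1) \<and> (A = P1 \<longrightarrow> K = Col)"
  "T \<parallel> \<Gamma> \<turnstile> a \<doteq> b \<Colon> A \<Longrightarrow> True"
  by (induction rule: ctx_ok_is_ty_is_tm_eq_ty_eq_tm.inducts) (auto elim: incl.cases)

section \<open>Soundness of the translation\<close>

lemma N_mor:
  assumes "emTT \<turnstile> N_ctx \<Gamma> ctx" "\<forall>i<length \<Delta>. emTT \<parallel> N_ctx \<Gamma> \<turnstile> N_tm (\<sigma> i) \<Colon> N_ty (\<Delta> ! i \<bullet> wk (Suc i) \<bullet> \<sigma>)"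
  shows "mor emTT (N_ctx \<Gamma>) (N_sub \<sigma>) (N_ctx \<Delta>)"
  using assms by (auto simp: mor_def N_ctx_def N_simps(1-2) N_sub_simps N_sub_app)

text \<open>
  For equal types the invariant is carried for the left-hand side only: congruence rules
  prove it from their premises, and symmetry transports it along the equation. The
  stability that the rules for codes and the eliminations of disjunction and existence ask for comes
  from the premises that form or equate the propositions concerned.
\<close>
lemma N_sound:
  "T \<turnstile> \<Gamma> ctx \<Longrightarrow> emTT \<turnstile> N_ctx \<Gamma> ctx"
  "T \<parallel> \<Gamma> \<turnstile> A type K \<Longrightarrow> emTT \<parallel> N_ctx \<Gamma> \<turnstile> N_ty A type K \<and> stable_ty emTT (N_ctx \<Gamma>) (N_ty A) K"
  "T \<parallel> \<Gamma> \<turnstile> a \<Colon> A \<Longrightarrow> emTT \<parallel> N_ctx \<Gamma> \<turnstile> N_tm a \<Colon> N_ty A"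
  "T \<parallel> \<Gamma> \<turnstile> A \<doteq> B type K \<Longrightarrow> emTT \<parallel> N_ctx \<Gamma> \<turnstile> N_ty A \<doteq> N_ty B type K \<and> stable_ty emTT (N_ctx \<Gamma>) (N_ty A) K"
  "T \<parallel> \<Gamma> \<turnstile> a \<doteq> b \<Colon> A \<Longrightarrow> emTT \<parallel> N_ctx \<Gamma> \<turnstile> N_tm a \<doteq> N_tm b \<Colon> N_ty A"
proof (induction rule: ctx_ok_is_ty_is_tm_eq_ty_eq_tm.inducts)
  case (var \<Gamma> i)
  then show ?case using ctx_ok_is_ty_is_tm_eq_ty_eq_tm.var[of emTT "N_ctx \<Gamma>" i] by (simp add: N_simps N_ctx_def)
next
  case (sub_ty \<Delta> A K \<Gamma> \<sigma>)
  then show ?case using N_mor[of \<Gamma> \<Delta> \<sigma>] by (auto simp: N_simps(1-2) intro: mor_ty stable_mor)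
next
  case (sub_tm \<Delta> a A \<Gamma> \<sigma>)
  then show ?case using N_mor[of \<Gamma> \<Delta> \<sigma>] by (auto simp: N_simps(1-2) intro: mor_tm)
next
  case (sub_eq_ty \<Delta> A B K \<Gamma> \<sigma> \<tau>)
  have s: "mor emTT (N_ctx \<Gamma>) (N_sub \<sigma>) (N_ctx \<Delta>)" and t: "mor emTT (N_ctx \<Gamma>) (N_sub \<tau>) (N_ctx \<Delta>)"
    using sub_eq_ty by (auto intro: N_mor)
  have e: "\<forall>i<length (N_ctx \<Delta>). emTT \<parallel> N_ctx \<Gamma> \<turnstile> N_sub \<sigma> i \<doteq> N_sub \<tau> i \<Colon> N_ctx \<Delta> ! i \<bullet> wk (Suc i) \<bullet> N_sub \<sigma>"
    using sub_eq_ty by (auto simp: N_ctx_def N_simps(1-2) N_sub_simps N_sub_app)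
  then show ?case using sub_eq_ty s t e ctx_ok_is_ty_is_tm_eq_ty_eq_tm.sub_eq_ty[of emTT "N_ctx \<Delta>" _ _ _ "N_ctx \<Gamma>"] by (auto simp: N_simps(1-2) mor_def intro: stable_mor[OF _ s])
next
  case (sub_eq_tm \<Delta> a b A \<Gamma> \<sigma> \<tau>)
  have s: "mor emTT (N_ctx \<Gamma>) (N_sub \<sigma>) (N_ctx \<Delta>)" and t: "mor emTT (N_ctx \<Gamma>) (N_sub \<tau>) (N_ctx \<Delta>)"
    using sub_eq_tm by (auto intro: N_mor)
  have e: "\<forall>i<length (N_ctx \<Delta>). emTT \<parallel> N_ctx \<Gamma> \<turnstile> N_sub \<sigma> i \<doteq> N_sub \<tau> i \<Colon> N_ctx \<Delta> ! i \<bullet> wk (Suc i) \<bullet> N_sub \<sigma>"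
    using sub_eq_tm by (auto simp: N_ctx_def N_simps(1-2) N_sub_simps N_sub_app)
  then show ?case using sub_eq_tm s t e ctx_ok_is_ty_is_tm_eq_ty_eq_tm.sub_eq_tm[of emTT "N_ctx \<Delta>" _ _ _ "N_ctx \<Gamma>"] by (auto simp: N_simps(1-2) mor_def)
next
  case ty_sym
  then show ?case by (blast intro: ctx_ok_is_ty_is_tm_eq_ty_eq_tm.ty_sym stable_conv)
next
  case ty_trans
  then show ?case by (blast intro: ctx_ok_is_ty_is_tm_eq_ty_eq_tm.ty_trans)
next
  case tm_sym
  then show ?case by (blast intro: ctx_ok_is_ty_is_tm_eq_ty_eq_tm.tm_sym)
next
  case tm_trans
  then show ?case by (blast intro: ctx_ok_is_ty_is_tm_eq_ty_eq_tm.tm_trans)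
next
  case conv
  then show ?case by (blast intro: ctx_ok_is_ty_is_tm_eq_ty_eq_tm.conv)
next
  case conv_eq
  then show ?case by (blast intro: ctx_ok_is_ty_is_tm_eq_ty_eq_tm.conv_eq)
next
  case incl_ty
  then show ?case by (blast intro: ctx_ok_is_ty_is_tm_eq_ty_eq_tm.incl_ty stable_incl)
next
  case incl_eq_ty
  then show ?case by (blast intro: ctx_ok_is_ty_is_tm_eq_ty_eq_tm.incl_eq_ty stable_incl)
next
  case F_Disj
  then show ?case by (simp add: ctx_ok_is_ty_is_tm_eq_ty_eq_tm.F_Disj F_Neg stable_Neg del: insert_iff)
next
  case C_Conj
  then show ?case by (auto simp: ctx_ok_is_ty_is_tm_eq_ty_eq_tm.C_Conj intro!: stable_Conj dest: eq_ty_l eq_ty_r stable_conv simp del: insert_iff)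
next
  case C_Impl
  then show ?case by (auto simp: ctx_ok_is_ty_is_tm_eq_ty_eq_tm.C_Impl intro!: stable_Impl dest: eq_ty_l simp del: insert_iff)
next
  case C_Disj
  then show ?case by (auto intro!: Neg_cong stable_Neg F_Neg F_Disj ctx_ok_is_ty_is_tm_eq_ty_eq_tm.C_Disj intro: eq_ty_l)
next
  case F_Exi
  then show ?case using prop_over_kinds by (auto simp: N_simps intro!: F_Neg stable_Neg intro: ctx_ok_is_ty_is_tm_eq_ty_eq_tm.F_Exi simp del: insert_iff)
next
  case C_Exi
  then show ?case using prop_over_kinds by (auto simp: N_simps intro!: Neg_cong F_Neg stable_Neg intro: ctx_ok_is_ty_is_tm_eq_ty_eq_tm.C_Exi F_Exi eq_ty_l simp del: insert_iff)
next
  case (F_Eq K K' \<Gamma> A a b)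
  then show ?case
  proof (cases "A = P1")
    case True
    \<comment> \<open>\<open>P(1)\<close> is not a set, so this rule forms equality on it with kind \<open>Prop\<close> only\<close>
    with P1_rigid(2)[of T \<Gamma> A K'] F_Eq have "K = Prop" by (auto elim: prop_over.cases)
    with True F_Eq show ?thesis
      by (auto intro!: F_Eq_Prop fstP1_tm stable_prop Stab_Eq_fstP1)
  next
    case False
    with F_Eq show ?thesis by (auto intro: ctx_ok_is_ty_is_tm_eq_ty_eq_tm.F_Eq stable_Eq)
  qed
next
  case (C_Eq K K' \<Gamma> A A' a a' b b')
  then show ?case
  proof (cases "A = P1")
    case True
    with P1_rigid(4)[of T \<Gamma> A A' K'] C_Eq have K: "K = Prop" "A' = P1" by (auto elim: prop_over.cases)
    have "emTT \<parallel> N_ctx \<Gamma> \<turnstile> Eq P1 (fstP1 (N_tm a)) (fstP1 (N_tm b)) \<doteq> Eq P1 (fstP1 (N_tm a')) (fstP1 (N_tm b')) type Prop"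
      using C_Eq True by (intro ctx_ok_is_ty_is_tm_eq_ty_eq_tm.C_Eq[of Prop Col] ty_refl F_P1) (auto intro: prop_over.intros fstP1_cong ctx_of)
    with C_Eq K True show ?thesis
      by (auto intro!: stable_prop Stab_Eq_fstP1 dest: eq_ty_l eq_tm_l)
  next
    case False
    with P1_rigid(4)[of T \<Gamma> A A' K'] C_Eq have "A' \<noteq> P1" by blast
    with False C_Eq show ?thesis by (auto intro: ctx_ok_is_ty_is_tm_eq_ty_eq_tm.C_Eq stable_Eq dest: eq_ty_l eq_tm_l)
  qed
next
  case (F_Dc \<Gamma> U V)
  then show ?case using F_Dc_N by (simp add: N_simps)
next
  case (C_Dc \<Gamma> U U' V V')
  then show ?case
    using F_Dc_N[of emTT "N_ctx \<Gamma>" "N_tm U" "N_tm V"] fstP1_Code_Top[of emTT "N_ctx \<Gamma>"]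
    by (auto simp: N_simps intro!: ctx_ok_is_ty_is_tm_eq_ty_eq_tm.C_Dc fstP1_cong dest: eq_tm_l ctx_of(3) intro: tm_trans[OF fstP1_cong])
next
  case I1_Disj
  then show ?case by (auto intro!: nn_I F_Disj ctx_ok_is_ty_is_tm_eq_ty_eq_tm.I1_Disj)
next
  case I2_Disj
  then show ?case by (auto intro!: nn_I F_Disj ctx_ok_is_ty_is_tm_eq_ty_eq_tm.I2_Disj)
next
  case I_Exi
  then show ?case by (auto simp: N_simps intro!: nn_I intro: ctx_ok_is_ty_is_tm_eq_ty_eq_tm.I_Exi F_Exi prop_over.intros)
next
  case (I_Eq \<Gamma> A a)
  then show ?case by (auto intro!: eq_true tm_refl fstP1_tm)
next
  case (E_Eq \<Gamma> A a b)
  then show ?case by (auto split: if_splits intro: eq_reflect P1N_ext fstP1_tm)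
next
  case eq_Quot
  then show ?case by (auto simp: N_simps intro: ctx_ok_is_ty_is_tm_eq_ty_eq_tm.eq_Quot[unfolded wk_0])
next
  case eff_Quot
  then show ?case by (auto simp: N_simps intro: ctx_ok_is_ty_is_tm_eq_ty_eq_tm.eff_Quot[unfolded wk_0])
next
  case C_Code
  then show ?case by (auto intro!: Code_cong ctx_ok_is_ty_is_tm_eq_ty_eq_tm.C_Code intro: eq_ty_l)
next
  case eq_P1
  then show ?case by (auto simp: N_simps intro!: Code_cong ctx_ok_is_ty_is_tm_eq_ty_eq_tm.eq_P1)
next
  case (eff_P1 \<Gamma> \<phi> \<psi>)
  then show ?case
    using Code_tm(2)[of emTT "N_ctx \<Gamma>" "N_ty \<phi>"] Code_tm(2)[of emTT "N_ctx \<Gamma>" "N_ty \<psi>"]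
      fstP1_cong[of emTT "N_ctx \<Gamma>" "pairP1 (Code (N_ty \<phi>))" "pairP1 (Code (N_ty \<psi>))"]
    by (auto simp: N_simps intro!: ctx_ok_is_ty_is_tm_eq_ty_eq_tm.eff_P1 intro: tm_trans tm_sym)
qed (auto simp: N_simps intro:
    ctx_empty ctx_ext true_I proof_irr ty_refl tm_refl E_Falsum I_Conj E1_Conj E2_Conj I_Impl E_Impl
    I_Uni E_Uni nn_Disj_E nn_Exi_E nn_LEM stable_Stab[of _ _ _ Prop] E_N0 C_ElN0 I_N1 E_N1 B_N1
    C_ElN1 I_Nil C_Nil I_Cons C_Cons E_List B1_List B2_List C_ElList I_Inl I_Inr C_Inl C_Inr E_Sum
    B1_Sum B2_Sum C_ElSum I_Sig C_Pair E_Sig B_Sig C_ElSig I_Pi C_Lam E_Pi C_Ap B_Pi eta_Pi I_Quot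
    C_Cls E_Quot B_Quot C_ElQ C_Quot F_Falsum F_Conj F_Impl F_Uni C_Uni stable_Falsum stable_Conj
    stable_Impl stable_Uni F_N0 F_N1 F_List F_Sum F_Pi F_Sig F_Quot C_List C_Sum C_Pi C_Sig
    stable_type stable_eq_N0 stable_eq_N1 stable_eq_List stable_eq_Sum stable_eq_Pi stable_eq_Sig
    stable_eq_Quot stable_eq_P1N stable_eq_FunP1N stable_eqD stable_Stab[of _ _ _ PropS] eq_ty_l
    ty_Col F_P1N F_FunP1N FunP1N_cong(2) Code_tm(1) Code_Dc_N LamP1N_tm LamP1N_cong ApP1N_tm
    ApP1N_cong ApP1N_beta LamP1N_eta)

theorem theorem2:
  shows "(\<forall>\<Gamma>. emTTc \<turnstile> \<Gamma> ctx \<longrightarrow> emTT \<turnstile> N_ctx \<Gamma> ctx) \<and>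
    (\<forall>\<Gamma> A K. emTTc \<parallel> \<Gamma> \<turnstile> A type K \<longrightarrow> emTT \<parallel> N_ctx \<Gamma> \<turnstile> N_ty A type K) \<and>
    (\<forall>\<Gamma> a A. emTTc \<parallel> \<Gamma> \<turnstile> a \<Colon> A \<longrightarrow> emTT \<parallel> N_ctx \<Gamma> \<turnstile> N_tm a \<Colon> N_ty A) \<and>
    (\<forall>\<Gamma> A B K. emTTc \<parallel> \<Gamma> \<turnstile> A \<doteq> B type K \<longrightarrow> emTT \<parallel> N_ctx \<Gamma> \<turnstile> N_ty A \<doteq> N_ty B type K) \<and>
    (\<forall>\<Gamma> a b A. emTTc \<parallel> \<Gamma> \<turnstile> a \<doteq> b \<Colon> A \<longrightarrow> emTT \<parallel> N_ctx \<Gamma> \<turnstile> N_tm a \<doteq> N_tm b \<Colon> N_ty A) \<and>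
    (\<forall>\<Gamma> \<phi>. emTTc \<parallel> \<Gamma> \<turnstile> \<phi> type Prop \<longrightarrow>
       emTT \<parallel> N_ctx \<Gamma> \<turnstile> true \<Colon> Impl (Neg (Neg (N_ty \<phi>))) (N_ty \<phi>)) \<and>
    (\<forall>\<Gamma> A. emTTc \<parallel> \<Gamma> \<turnstile> A type Col \<longrightarrow>
       emTT \<parallel> (N_ty A \<bullet> wk 1) # N_ty A # N_ctx \<Gamma> \<turnstile> true \<Colon>
         Impl (Neg (Neg (Eq (N_ty A \<bullet> wk 2) (Var 1) (Var 0)))) (Eq (N_ty A \<bullet> wk 2) (Var 1) (Var 0)))"
proof (intro conjI allI impI)
  fix \<Gamma> \<phi> assume "emTTc \<parallel> \<Gamma> \<turnstile> \<phi> type Prop"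
  from N_sound(2)[OF this] show "emTT \<parallel> N_ctx \<Gamma> \<turnstile> true \<Colon> Impl (Neg (Neg (N_ty \<phi>))) (N_ty \<phi>)"
    by (simp add: stable_ty_def Stab_def)
next
  fix \<Gamma> A assume "emTTc \<parallel> \<Gamma> \<turnstile> A type Col"
  from N_sound(2)[OF this] have A: "emTT \<parallel> N_ctx \<Gamma> \<turnstile> N_ty A type Col" and s: "stable_eq emTT (N_ctx \<Gamma>) (N_ty A)"
    by (simp_all add: stable_ty_def)
  note a = wk1_ty[OF A A]
  have "emTT \<parallel> (N_ty A \<bullet> wk 1) # N_ty A # N_ctx \<Gamma> \<turnstile> Var 1 \<Colon> N_ty A \<bullet> wk 2"
    "emTT \<parallel> (N_ty A \<bullet> wk 1) # N_ty A # N_ctx \<Gamma> \<turnstile> Var 0 \<Colon> N_ty A \<bullet> wk 2"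
    using wk1_tm[OF hyp0[OF A] a] hyp0[OF a] by (simp_all add: sigma)
  from stable_eq_D[OF stable_eq_mor[OF s wk_ctx2[OF a]] this]
  show "emTT \<parallel> (N_ty A \<bullet> wk 1) # N_ty A # N_ctx \<Gamma> \<turnstile> true \<Colon>
         Impl (Neg (Neg (Eq (N_ty A \<bullet> wk 2) (Var 1) (Var 0)))) (Eq (N_ty A \<bullet> wk 2) (Var 1) (Var 0))"
    by (simp add: Stab_def)
qed (use N_sound in blast)+

end
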